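(* Let $k\ge 2$ and $\alpha\in(0,1)$. For $i=1,\dots,k$ let $X_{ir_i,n_i}\le X_{i(r_i+1),n_i}\le\dots\le X_{is_i,n_i}$ be $k$ independent doubly Type-II censored random samples from the two-parameter exponential distributions $\mathrm{Exp}(\mu_i,\sigma_i)$, and put $\theta_i=\mu_i+\sigma_i$. Assume that $r_i-1=n_ip_i$ and $n_i-s_i=n_iq_i$, where $p_i,q_i\ge 0$ are fixed with $0\le p_i+q_i<1$. Suppose that $\frac{n_i}{n}\to c_i\in(0,1)$, $i=1,\dots,k$, as $n\to\infty$, where $n=n_1+\dots+n_k$. Let $\delta_i$, $F_{il}$ and the fiducial quantile $f_{\alpha,n}$ (the $(1-\alpha)$-th quantile of $F_n$) be as defined in the context. Then, as $n\to\infty$, $$\mathbb{P}\left(\theta_i-\theta_l\in\left[\delta_i-\delta_l-f_{\alpha,n}\sqrt{F_{il}},\ \delta_i-\delta_l+f_{\alpha,n}\sqrt{F_{il}}\right]\ \ \forall\, i\ne l\right)\to 1-\alpha.$$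
   Context: $\mathrm{Exp}(\mu,\sigma)$, with $\mu\in\mathbb{R}$, $\sigma>0$, has density $\frac1\sigma e^{-(x-\mu)/\sigma}$ for $x>\mu$ and $0$ otherwise. For each $i=1,\dots,k$, $X_{i1},\dots,X_{in_i}$ is a random sample of size $n_i$ from $\mathrm{Exp}(\mu_i,\sigma_i)$; all observations are mutually independent across and within samples. The doubly Type-II censored sample consists of the order statistics $X_{ir_i,n_i}\le X_{i(r_i+1),n_i}\le\dots\le X_{is_i,n_i}$ of ranks $r_i,\dots,s_i$ (the smallest $r_i-1$ and the largest $n_i-s_i$ observations are removed), with $r_i<s_i$. The parameters $\mu_i,\sigma_i$ are fixed (unknown). Define $$V_{i,n_i}=-(n_i-r_i)X_{ir_i,n_i}+X_{i(r_i+1),n_i}+\dots+X_{i(s_i-1),n_i}+(n_i-s_i+1)X_{is_i,n_i},\qquad h_i=\sum_{j=n_i-r_i+1}^{n_i}\frac1j,\qquad g_i=\sum_{j=n_i-r_i+1}^{n_i}\frac1{j^2},$$ $$\delta_i=X_{ir_i,n_i}+\frac{V_{i,n_i}}{s_i-r_i}(1-h_i),$$ $$F_{il}=\sum_{m\in\{i,l\}}\left[\frac{V_{m,n_m}^2}{(s_m-r_m)(s_m-r_m+1)}\,g_m+\frac{V_{m,n_m}^2}{(s_m-r_m)^2(s_m-r_m+1)}(1-h_m)^2\right],\quad i\ne l.$$ Fiducial generalized pivotal quantities: let $(X^*_{ir_i,n_i},V^*_{i,n_i})$, $i=1,\dots,k$, be an independent copy of $(X_{ir_i,n_i},V_{i,n_i})$,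 $i=1,\dots,k$ (independent of the data). Thus all the variables $X^*_{ir_i,n_i}$, $V^*_{i,n_i}$ are mutually independent, $X^*_{ir_i,n_i}\overset{d}{=}\mu_i+\sigma_iZ_i^*$ with $Z_i^*$ the $r_i$-th order statistic of $n_i$ i.i.d. $\mathrm{Exp}(0,1)$ variables, and $V^*_{i,n_i}\overset{d}{=}\frac{\sigma_i}{2}W_i$ with $W_i\sim\chi^2_{2(s_i-r_i)}$. Define $$R_{\theta_i}=X_{ir_i,n_i}-(X^*_{ir_i,n_i}-\mu_i-\sigma_i)\frac{V_{i,n_i}}{V^*_{i,n_i}},\qquad R_{\theta_{il}}=R_{\theta_i}-R_{\theta_l},\qquad F_n=\max_{i\ne l}\left|\frac{(\delta_i-\delta_l)-R_{\theta_{il}}}{\sqrt{F_{il}}}\right|.$$ $f_{\alpha,n}$ is the $(1-\alpha)$-th quantile of the conditional distribution of $F_n$ given the data (i.e. with the observed values of $X_{ir_i,n_i},V_{i,n_i}$ held fixed). *)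

theory Defs
  imports "HOL-Probability.Probability"
begin

definition two_param_exp_density :: "real \<Rightarrow> real \<Rightarrow> real \<Rightarrow> real" where
  "two_param_exp_density \<mu> \<sigma> x = (if x > \<mu> then (1 / \<sigma>) * exp (- (x - \<mu>) / \<sigma>) else 0)"

(* The sample is x 1, ..., x n, and ranks start at 1. *)
definition order_stat :: "nat \<Rightarrow> (nat \<Rightarrow> real) \<Rightarrow> nat \<Rightarrow> real" where
  "order_stat n x j = sort (map x [1..<Suc n]) ! (j - 1)"

definition V_stat :: "nat \<Rightarrow> nat \<Rightarrow> nat \<Rightarrow> (nat \<Rightarrow> real) \<Rightarrow> real" where
  "V_stat n r s x =
     - (real n - real r) * order_stat n x r
     + (\<Sum>j = r + 1..s - 1. order_stat n x j)
     + (real n - real s + 1) * order_stat n x s"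

definition h_coef :: "nat \<Rightarrow> nat \<Rightarrow> real" where
  "h_coef n r = (\<Sum>j = n - r + 1..n. 1 / real j)"

definition g_coef :: "nat \<Rightarrow> nat \<Rightarrow> real" where
  "g_coef n r = (\<Sum>j = n - r + 1..n. 1 / (real j)\<^sup>2)"

(* From here on the arguments x and v are the values of X_{i r_i, n_i} and V_{i, n_i};
   xs and vs are those of their fiducial copies. *)

definition delta_stat :: "nat \<Rightarrow> nat \<Rightarrow> nat \<Rightarrow> real \<Rightarrow> real \<Rightarrow> real" where
  "delta_stat n r s x v = x + v / (real s - real r) * (1 - h_coef n r)"

definition F_pair ::
  "(nat \<Rightarrow> nat) \<Rightarrow> (nat \<Rightarrow> nat) \<Rightarrow> (nat \<Rightarrow> nat) \<Rightarrow> (nat \<Rightarrow> real) \<Rightarrow> nat \<Rightarrow> nat \<Rightarrow> real" where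
  "F_pair n r s v i l = (\<Sum>m\<in>{i, l}.
      (v m)\<^sup>2 / ((real (s m) - real (r m)) * (real (s m) - real (r m) + 1)) * g_coef (n m) (r m)
    + (v m)\<^sup>2 / ((real (s m) - real (r m))\<^sup>2 * (real (s m) - real (r m) + 1))
        * (1 - h_coef (n m) (r m))\<^sup>2)"

definition R_theta :: "real \<Rightarrow> real \<Rightarrow> real \<Rightarrow> real \<Rightarrow> real \<Rightarrow> real \<Rightarrow> real" where
  "R_theta \<mu> \<sigma> x v xs vs = x - (xs - \<mu> - \<sigma>) * (v / vs)"

definition F_max ::
  "nat \<Rightarrow> (nat \<Rightarrow> nat) \<Rightarrow> (nat \<Rightarrow> nat) \<Rightarrow> (nat \<Rightarrow> nat) \<Rightarrow> (nat \<Rightarrow> real) \<Rightarrow> (nat \<Rightarrow> real) \<Rightarrow>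
   (nat \<Rightarrow> real) \<Rightarrow> (nat \<Rightarrow> real) \<Rightarrow> (nat \<Rightarrow> real) \<Rightarrow> (nat \<Rightarrow> real) \<Rightarrow> real" where
  "F_max k n r s \<mu> \<sigma> x v xs vs =
     (let \<delta> = (\<lambda>i. delta_stat (n i) (r i) (s i) (x i) (v i));
          R = (\<lambda>i. R_theta (\<mu> i) (\<sigma> i) (x i) (v i) (xs i) (vs i))
      in Max {\<bar>((\<delta> i - \<delta> l) - (R i - R l)) / sqrt (F_pair n r s v i l)\<bar> | i l.
               i \<in> {1..k} \<and> l \<in> {1..k} \<and> i \<noteq> l})"

definition dist_quantile :: "real measure \<Rightarrow> real \<Rightarrow> real" where
  "dist_quantile D p = Inf {y. p \<le> cdf D y}"

(* The data values x, v are constants here and only the copies Xs, Vs are random: since the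
   copies are independent of the data, this is the conditional law of F_max given the data. *)
definition fiducial_law ::
  "'a measure \<Rightarrow> nat \<Rightarrow> (nat \<Rightarrow> nat) \<Rightarrow> (nat \<Rightarrow> nat) \<Rightarrow> (nat \<Rightarrow> nat) \<Rightarrow> (nat \<Rightarrow> real) \<Rightarrow>
   (nat \<Rightarrow> real) \<Rightarrow> (nat \<Rightarrow> 'a \<Rightarrow> real) \<Rightarrow> (nat \<Rightarrow> 'a \<Rightarrow> real) \<Rightarrow>
   (nat \<Rightarrow> real) \<Rightarrow> (nat \<Rightarrow> real) \<Rightarrow> real measure" where
  "fiducial_law M k n r s \<mu> \<sigma> Xs Vs x v =
     distr M borel (\<lambda>\<omega>'. F_max k n r s \<mu> \<sigma> x v (\<lambda>i. Xs i \<omega>') (\<lambda>i. Vs i \<omega>'))"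

end

theory Submission
  imports Defs "HOL-Real_Asymp.Real_Asymp"
begin

text \<open>
  By Renyi's representation the normalised spacings
  \<open>Y\<^sub>k = (n - k) (X\<^bsub>(k+1)\<^esub> - X\<^bsub>(k)\<^esub>)\<close>, \<open>0 \<le> k < n\<close>, \<open>X\<^bsub>(0)\<^esub> = \<mu>\<close>, of an exponential
  sample are i.i.d. exponential with mean \<open>\<sigma>\<close>. The statistic \<open>V\<close> of a censored sample is the
  sum of the spacings between its two extreme ranks, and the error \<open>D = \<delta> - \<theta>\<close> is a weighted sum
  of the centred spacings (the weights add up to one). Write \<open>S\<^sup>2\<close> for the variance of \<open>D\<close>,
  \<open>m = s - r\<close> and \<open>B = V / (m \<sigma>)\<close>, an average of \<open>m\<close> standard exponentials. Two identities drive
  the proof. The estimated variance \<open>F\<^sub>i\<^sub>l\<close> is the sum over the samples \<open>i\<close> and \<open>l\<close> of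
  \<open>B\<^sup>2 S\<^sup>2 m / (m + 1)\<close>, and the fiducial pivot satisfies \<open>\<delta> - R\<^sub>\<theta> = (B / B\<^sup>*) D\<^sup>*\<close>,
  where the starred quantities are those of the copy.

  Let \<open>G\<close> be the maximum over all pairs of
  \<open>\<bar>D\<^sub>i - D\<^sub>l\<bar> / sqrt (S\<^sub>i\<^sup>2 + S\<^sub>l\<^sup>2)\<close>, and \<open>G\<^sup>*\<close> its copy. When \<open>B\<close> and
  \<open>B\<^sup>*\<close> are close to 1 and \<open>D\<^sup>*\<close> is of the order of \<open>S\<close>, the statistic whose conditional
  quantile is \<open>f\<close> is close to \<open>G\<^sup>*\<close>, and the coverage event is close to \<open>G \<le> f\<close>. But \<open>G\<close> and
  \<open>G\<^sup>*\<close> have the same distribution function \<open>H\<close>, so \<open>f\<close> almost cuts off mass \<open>1 - \<alpha>\<close> of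
  \<open>H\<close>, provided that small shifts of the argument change \<open>H\<close> little, uniformly in the sample
  sizes.

  This uniformity is a concentration bound. The characteristic function of \<open>D\<close> has modulus
  \<open>\<Prod> (1 + w\<^sub>k\<^sup>2 \<sigma>\<^sup>2 u\<^sup>2)\<^bsup>-1/2\<^esup>\<close>. As soon as \<open>m \<ge> 2\<close>, no square \<open>w\<^sub>k\<^sup>2\<close> exceeds four
  fifths of the sum of all of them, so the product dominates a square and the modulus is at most
  \<open>1 / (1 + S\<^sup>2 u\<^sup>2 / 4)\<close>; this is integrable, and Levy inversion bounds the probability that
  \<open>D\<^sub>i - D\<^sub>l\<close> falls in an interval by its length over \<open>sqrt (S\<^sub>i\<^sup>2 + S\<^sub>l\<^sup>2)\<close>. Thus
  \<open>H\<close> is Lipschitz with a constant that depends only on \<open>k\<close>. Since \<open>H\<close> is continuous, it attains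
  the values \<open>1 - \<alpha> + \<epsilon>\<close> and \<open>1 - \<alpha> - 2 \<epsilon>\<close>; the points where it does enclose \<open>f\<close> up to the
  perturbations above, which gives the coverage up to \<open>4 \<epsilon>\<close> (lemma \<open>coverage_bound\<close>).
  Chebyshev's inequality controls \<open>B\<close> and \<open>D / S\<close>, and the assumptions on the sample sizes
  enter through \<open>s\<^sub>i - r\<^sub>i \<rightarrow> \<infinity>\<close>.
\<close>

section \<open>Sorted samples and normalised spacings\<close>

text \<open>The order statistics are indexed from zero here. A multiset rather than the sorted list of a
  fixed enumeration makes the removal of one index compatible with sorting, which the induction
  for Renyi's representation needs.\<close>
definition ascending :: "'i set \<Rightarrow> ('i \<Rightarrow> real) \<Rightarrow> real list" where
  "ascending I x = sorted_list_of_multiset (image_mset x (mset_set I))"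

lemma mset_ascending: "mset (ascending I x) = image_mset x (mset_set I)"
  by (simp add: ascending_def)

lemma sorted_ascending: "sorted (ascending I x)"
  by (simp add: ascending_def)

lemma length_ascending: "length (ascending I x) = card I"
  using arg_cong[OF mset_ascending, of size I x] by simp

lemma ascending_insert_least:
  assumes "finite J" "i \<notin> J" "\<And>j. j \<in> J \<Longrightarrow> x i \<le> x j"
  shows "ascending (insert i J) x = x i # ascending J x"
proof -
  have set: "set (ascending J x) = x ` J"
    by (metis assms(1) finite_set_mset_mset_set mset_ascending set_image_mset set_mset_mset)
  have "ascending (insert i J) x = insort (x i) (ascending J x)"
    using assms(1,2) by (simp add: ascending_def)
  also have "\<dots> = x i # ascending J x"
    using assms(3) by (intro insort_is_Cons) (auto simp: set)
  finally show ?thesis .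
qed

lemma ascending_cong: "(\<And>i. i \<in> I \<Longrightarrow> x i = y i) \<Longrightarrow> ascending I x = ascending I y"
  unfolding ascending_def
  by (cases "finite I") (auto intro!: arg_cong[where f = sorted_list_of_multiset] image_mset_cong)

text \<open>An order statistic is at most \<open>y\<close> exactly if enough observations are. The right-hand side is
  a counting condition, and this is how measurability of order statistics is obtained.\<close>
lemma sorted_nth_le_iff:
  assumes "sorted xs" "k < length xs"
  shows "xs ! k \<le> (y :: real) \<longleftrightarrow> k < length (filter (\<lambda>z. z \<le> y) xs)"
  using assms
proof (induction xs arbitrary: k)
  case (Cons a xs)
  show ?case
  proof (cases "a \<le> y")
    case True
    then show ?thesis using Cons by (cases k) auto
  next
    case False
    have *: "filter (\<lambda>z. z \<le> y) xs = []"
      using Cons.prems(1) False by (auto simp: filter_empty_conv)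
    have "a \<le> (a # xs) ! k"
      using Cons.prems by (cases k) auto
    with False * show ?thesis by auto
  qed
qed simp

lemma measurable_ascending_nth:
  assumes I: "finite I" and X: "\<And>i. i \<in> I \<Longrightarrow> X i \<in> borel_measurable M" and k: "k < card I"
  shows "(\<lambda>\<omega>. ascending I (\<lambda>i. X i \<omega>) ! k) \<in> borel_measurable M"
proof (rule borel_measurable_iff_le[THEN iffD2], intro allI)
  fix y :: real
  note X[measurable]
  have "length (filter (\<lambda>z. z \<le> y) (ascending I (\<lambda>i. X i \<omega>))) = card {i \<in> I. X i \<omega> \<le> y}" for \<omega>
  proof -
    have "length (filter (\<lambda>z. z \<le> y) (ascending I (\<lambda>i. X i \<omega>)))
        = size (filter_mset (\<lambda>z. z \<le> y) (image_mset (\<lambda>i. X i \<omega>) (mset_set I)))"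
      by (metis mset_ascending mset_filter size_mset)
    also have "\<dots> = size (mset_set {i \<in> I. X i \<omega> \<le> y})"
      by (simp add: filter_mset_image_mset I)
    finally show ?thesis by simp
  qed
  then have "ascending I (\<lambda>i. X i \<omega>) ! k \<le> y \<longleftrightarrow> real k < (\<Sum>i\<in>I. if X i \<omega> \<le> y then 1 else 0)" for \<omega>
    using sorted_nth_le_iff[OF sorted_ascending, of k I "\<lambda>i. X i \<omega>" y] k I
    by (simp add: length_ascending flip: sum.inter_filter)
  moreover have "{\<omega> \<in> space M. real k < (\<Sum>i\<in>I. if X i \<omega> \<le> y then 1 else 0)} \<in> sets M"
    by measurable
  ultimately show "{\<omega> \<in> space M. ascending I (\<lambda>i. X i \<omega>) ! k \<le> y} \<in> sets M"
    by simp
qed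

text \<open>The product of functions of the normalised spacings, starting from the left end point \<open>a\<close>.
  The functions are indexed by the number of observations that remain, not by rank: removing the
  least observation then leaves the same product for a smaller sample with a new left end point.\<close>
primrec spacing_prod :: "(nat \<Rightarrow> real \<Rightarrow> ennreal) \<Rightarrow> real \<Rightarrow> real list \<Rightarrow> ennreal" where
  "spacing_prod \<psi> a [] = 1"
| "spacing_prod \<psi> a (x # xs) =
     \<psi> (Suc (length xs)) (real (Suc (length xs)) * (x - a)) * spacing_prod \<psi> x xs"

lemma spacing_prod_eq:
  "spacing_prod \<psi> a xs = (\<Prod>k<length xs.
     \<psi> (length xs - k) (real (length xs - k) * (xs ! k - (a # xs) ! k)))"
proof (induction xs arbitrary: a)
  case (Cons x xs)
  show ?case
    unfolding spacing_prod.simps Cons.IH length_Cons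
    by (subst prod.lessThan_Suc_shift) simp
qed simp

lemma measurable_spacing_prod:
  assumes I: "finite I" and X: "\<And>i. i \<in> I \<Longrightarrow> X i \<in> borel_measurable M"
    and \<psi>: "\<And>l. \<psi> l \<in> borel_measurable borel" and A: "A \<in> borel_measurable M"
  shows "(\<lambda>\<omega>. spacing_prod \<psi> (A \<omega>) (ascending I (\<lambda>i. X i \<omega>))) \<in> borel_measurable M"
proof -
  have [measurable]: "(\<lambda>\<omega>. (A \<omega> # ascending I (\<lambda>i. X i \<omega>)) ! k) \<in> borel_measurable M"
    if "k < card I" for k
    using that A measurable_ascending_nth[OF I X, where k = "k - 1"] by (cases k) auto
  have [measurable]: "(\<lambda>\<omega>. ascending I (\<lambda>i. X i \<omega>) ! k) \<in> borel_measurable M"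
    if "k < card I" for k
    using measurable_ascending_nth[OF I X] that by auto
  note \<psi>[measurable]
  show ?thesis
    unfolding spacing_prod_eq length_ascending by (intro borel_measurable_prod_ennreal) simp
qed

lemma measurable_two_param_exp_density [measurable]:
  "two_param_exp_density a \<sigma> \<in> borel_measurable borel"
  unfolding two_param_exp_density_def by measurable

text \<open>The lack of memory, as a pointwise identity of densities: beyond \<open>u\<close>, the exponential density
  that starts at \<open>a\<close> is a multiple of the one that starts at \<open>u\<close>.\<close>
lemma two_param_exp_density_memoryless:
  assumes "a < u"
  shows "(if u < x then two_param_exp_density a \<sigma> x else 0)
    = exp (- (u - a) / \<sigma>) * two_param_exp_density u \<sigma> x"
proof -
  have "exp (- (x - a) / \<sigma>) = exp (- (u - a) / \<sigma>) * exp (- (x - u) / \<sigma>)"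
    unfolding exp_add[symmetric] by (simp add: diff_divide_distrib)
  then show ?thesis using assms by (auto simp: two_param_exp_density_def)
qed

interpretation lborel_prod: product_sigma_finite "\<lambda>_. lborel :: real measure" by standard

lemma AE_PiM_lborel_distinct:
  assumes I: "finite I"
  shows "AE x in PiM I (\<lambda>_. lborel :: real measure). \<forall>i\<in>I. \<forall>j\<in>I. i \<noteq> j \<longrightarrow> x i \<noteq> x j"
proof -
  have "AE x in PiM I (\<lambda>_. lborel :: real measure). x i \<noteq> x j"
    if ij: "i \<in> I" "j \<in> I" "i \<noteq> j" for i j
  proof (rule AE_I')
    define J where "J = I - {i}"
    have J: "finite J" "i \<notin> J" "I = insert i J" "j \<in> J" using I ij by (auto simp: J_def)
    let ?P = "\<lambda>K. PiM K (\<lambda>_. lborel :: real measure)"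
    let ?N = "{x \<in> space (?P I). x i = x j}"
    have meas: "?N \<in> sets (?P I)" using ij by measurable
    have "emeasure (?P I) ?N = (\<integral>\<^sup>+x. indicator ?N x \<partial>?P I)"
      using meas by simp
    also have "\<dots> = (\<integral>\<^sup>+x. \<integral>\<^sup>+y. indicator ?N (x(i := y)) \<partial>lborel \<partial>?P J)"
      using lborel_prod.product_nn_integral_insert[OF J(1,2), of "indicator ?N"] meas J(3) by simp
    also have "\<dots> \<le> (\<integral>\<^sup>+x. 0 \<partial>?P J)"
    proof (rule nn_integral_mono)
      fix x :: "_ \<Rightarrow> real"
      have "(\<integral>\<^sup>+y. indicator ?N (x(i := y)) \<partial>lborel) \<le> (\<integral>\<^sup>+y. indicator {x j} y \<partial>lborel)"
        using ij by (intro nn_integral_mono) (auto split: split_indicator)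
      also have "\<dots> = 0" by simp
      finally show "(\<integral>\<^sup>+y. indicator ?N (x(i := y)) \<partial>lborel) \<le> 0" .
    qed
    finally show "?N \<in> null_sets (?P I)" using meas by (auto simp: null_sets_def)
  qed auto
  then show ?thesis using I by (simp add: AE_finite_all AE_ball_countable countable_finite)
qed

text \<open>Renyi's representation for product functions, by induction on the number of observations.
  Almost surely there is a unique least observation. Given that it is observation \<open>i\<close> with value
  \<open>y\<close>, lack of memory turns the others into a smaller sample that starts at \<open>y\<close>, at the price
  of the factor \<open>exp (- m (y - a) / \<sigma>)\<close>. With the density of \<open>y\<close> itself this makes the first
  spacing, multiplied by the sample size, exponential with the original mean; the sample size
  comes from the sum over \<open>i\<close>.\<close>
lemma nn_integral_spacing_prod:
  fixes \<psi> :: "nat \<Rightarrow> real \<Rightarrow> ennreal"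
  assumes \<sigma>: "0 < \<sigma>" and \<psi>: "\<And>l. \<psi> l \<in> borel_measurable borel" and I: "finite I"
  shows "(\<integral>\<^sup>+x. (\<Prod>i\<in>I. ennreal (two_param_exp_density a \<sigma> (x i))) * spacing_prod \<psi> a (ascending I x)
            \<partial>PiM I (\<lambda>_. lborel))
    = (\<Prod>l\<in>{1..card I}. \<integral>\<^sup>+y. ennreal (two_param_exp_density 0 \<sigma> y) * \<psi> l y \<partial>lborel)"
  using I
proof (induction "card I" arbitrary: I a)
  case 0
  then have "I = {}" by simp
  then show ?case
    by (simp add: lborel_prod.nn_integral_empty ascending_def space_PiM emeasure_PiM_empty)
next
  case (Suc m)
  define N where "N = Suc m"
  let ?P = "\<lambda>K. PiM K (\<lambda>_. lborel :: real measure)"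
  let ?d = "\<lambda>a x. ennreal (two_param_exp_density a \<sigma> x)"
  let ?Y = "\<lambda>l. \<integral>\<^sup>+y. ?d 0 y * \<psi> l y \<partial>lborel"
  let ?h = "\<lambda>x. (\<Prod>i\<in>I. ?d a (x i)) * spacing_prod \<psi> a (ascending I x)"
  let ?least = "\<lambda>i x. if \<forall>j\<in>I - {i}. x i < x j then 1 else 0 :: ennreal"
  note \<psi>[measurable] Suc.prems[simp]
  have spm [measurable]: "(\<lambda>x. spacing_prod \<psi> b (ascending K x)) \<in> borel_measurable (?P K)"
    if "finite K" for K and b :: real
    using that by (intro measurable_spacing_prod) (auto simp: \<psi>)
  have hm [measurable]: "?h \<in> borel_measurable (?P I)" by measurable
  have split: "AE x in ?P I. ?h x = (\<Sum>i\<in>I. ?least i x * ?h x)"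
    using AE_PiM_lborel_distinct[OF Suc.prems]
  proof eventually_elim
    case (elim x)
    have "I \<noteq> {}" using Suc.hyps by auto
    then obtain i where i: "i \<in> I" "\<And>j. j \<in> I \<Longrightarrow> x i \<le> x j"
      using ex_min_if_finite[of "x ` I"] Suc.prems by (auto simp: not_less)
    have least: "?least j x = (if j = i then 1 else 0)" if "j \<in> I" for j
    proof (cases "j = i")
      case True
      have "x i < x l" if "l \<in> I - {i}" for l
        using that i elim by (metis DiffE insertCI order_le_less)
      then show ?thesis using True by auto
    next
      case False
      then show ?thesis using i that elim by (fastforce simp: not_less)
    qed
    have "(\<Sum>j\<in>I. ?least j x * ?h x) = (\<Sum>j\<in>I. if j = i then ?h x else 0)"
      using least by (intro sum.cong) auto
    then show ?case using i(1) by simp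
  qed
  have part: "(\<integral>\<^sup>+x. ?least i x * ?h x \<partial>?P I) =
      (\<integral>\<^sup>+y. ?d a y * ennreal (exp (- (y - a) / \<sigma>) ^ m) * \<psi> N (real N * (y - a)) \<partial>lborel)
        * (\<Prod>l\<in>{1..m}. ?Y l)" if i: "i \<in> I" for i
  proof -
    define J where "J = I - {i}"
    have J: "finite J" "i \<notin> J" "I = insert i J" "card J = m"
      using i Suc.hyps by (auto simp: J_def)
    have lm: "(\<lambda>x. ?least i x * ?h x) \<in> borel_measurable (?P I)"
      using i by measurable
    have inner: "(\<integral>\<^sup>+x. ?least i (x(i := y)) * ?h (x(i := y)) \<partial>?P J)
        = ?d a y * ennreal (exp (- (y - a) / \<sigma>) ^ m) * \<psi> N (real N * (y - a)) * (\<Prod>l\<in>{1..m}. ?Y l)" for y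
    proof (cases "a < y")
      case False
      then have "?d a y = 0" by (simp add: two_param_exp_density_def)
      then show ?thesis
        using J by simp
    next
      case True
      have "?least i (x(i := y)) * ?h (x(i := y)) =
          ?d a y * ennreal (exp (- (y - a) / \<sigma>) ^ m) * \<psi> N (real N * (y - a))
          * ((\<Prod>j\<in>J. ?d y (x j)) * spacing_prod \<psi> y (ascending J x))" for x
      proof (cases "\<forall>j\<in>J. y < x j")
        case False
        then have "\<exists>j\<in>J. ?d y (x j) = 0" by (auto simp: two_param_exp_density_def)
        then have "(\<Prod>j\<in>J. ?d y (x j)) = 0" using J(1) by (auto simp: prod_zero_iff)
        moreover have "?least i (x(i := y)) = 0"
          using False by (auto simp: J_def)
        ultimately show ?thesis by simp
      next
        case lt: True
        have "ascending I (x(i := y)) = y # ascending J (x(i := y))"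
          using ascending_insert_least[OF J(1,2), of "x(i := y)"] lt J(2)
          unfolding J(3) by (fastforce simp: less_imp_le)
        also have "ascending J (x(i := y)) = ascending J x"
          using J(2) by (intro ascending_cong) auto
        finally have asc: "ascending I (x(i := y)) = y # ascending J x" .
        have "(\<Prod>j\<in>J. ?d a (x j)) = (\<Prod>j\<in>J. ennreal (exp (- (y - a) / \<sigma>)) * ?d y (x j))"
        proof (rule prod.cong)
          fix j assume "j \<in> J"
          then show "?d a (x j) = ennreal (exp (- (y - a) / \<sigma>)) * ?d y (x j)"
            using two_param_exp_density_memoryless[OF True, of "x j" \<sigma>] lt
            by (simp flip: ennreal_mult')
        qed simp
        also have "\<dots> = ennreal (exp (- (y - a) / \<sigma>) ^ m) * (\<Prod>j\<in>J. ?d y (x j))"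
          by (simp add: prod.distrib J(4) ennreal_power)
        moreover have "(\<Prod>j\<in>J. ?d a ((x(i := y)) j)) = (\<Prod>j\<in>J. ?d a (x j))"
          using J(2) by (intro prod.cong) auto
        ultimately have dens: "(\<Prod>j\<in>I. ?d a ((x(i := y)) j))
            = ?d a y * (ennreal (exp (- (y - a) / \<sigma>) ^ m) * (\<Prod>j\<in>J. ?d y (x j)))"
          using J(1,2) unfolding J(3) by simp
        have "?least i (x(i := y)) = 1"
          using lt by (auto simp: J_def)
        then show ?thesis
          by (simp only: asc dens spacing_prod.simps length_ascending J(4) N_def mult_1_left) (simp add: mult_ac)
      qed
      then have "(\<integral>\<^sup>+x. ?least i (x(i := y)) * ?h (x(i := y)) \<partial>?P J) =
          (\<integral>\<^sup>+x. ?d a y * ennreal (exp (- (y - a) / \<sigma>) ^ m) * \<psi> N (real N * (y - a))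
          * ((\<Prod>j\<in>J. ?d y (x j)) * spacing_prod \<psi> y (ascending J x)) \<partial>?P J)"
        by (intro nn_integral_cong) simp
      also have "\<dots> = ?d a y * ennreal (exp (- (y - a) / \<sigma>) ^ m) * \<psi> N (real N * (y - a))
          * (\<integral>\<^sup>+x. ((\<Prod>j\<in>J. ?d y (x j)) * spacing_prod \<psi> y (ascending J x)) \<partial>?P J)"
        using J(1) by (intro nn_integral_cmult) measurable
      also have "(\<integral>\<^sup>+x. ((\<Prod>j\<in>J. ?d y (x j)) * spacing_prod \<psi> y (ascending J x)) \<partial>?P J)
          = (\<Prod>l\<in>{1..m}. ?Y l)"
        using Suc.hyps(1)[of J y] J by simp
      finally show ?thesis .
    qed
    show ?thesis
      using lborel_prod.product_nn_integral_insert_rev[OF J(1,2), of "\<lambda>x. ?least i x * ?h x"] lm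
      unfolding J(3)[symmetric] inner by (subst (asm) nn_integral_multc) auto
  qed
  have "(\<integral>\<^sup>+x. ?h x \<partial>?P I) = (\<integral>\<^sup>+x. (\<Sum>i\<in>I. ?least i x * ?h x) \<partial>?P I)"
    using split by (rule nn_integral_cong_AE)
  also have "\<dots> = (\<Sum>i\<in>I. \<integral>\<^sup>+x. ?least i x * ?h x \<partial>?P I)"
    by (intro nn_integral_sum) measurable
  also have "\<dots> = of_nat N * (\<integral>\<^sup>+y. ?d a y * ennreal (exp (- (y - a) / \<sigma>) ^ m)
      * \<psi> N (real N * (y - a)) \<partial>lborel) * (\<Prod>l\<in>{1..m}. ?Y l)"
    using part Suc.hyps(2) by (simp add: N_def mult.assoc)
  also have "of_nat N * (\<integral>\<^sup>+y. ?d a y * ennreal (exp (- (y - a) / \<sigma>) ^ m)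
      * \<psi> N (real N * (y - a)) \<partial>lborel) = ?Y N"
  proof -
    have "?Y N = ennreal \<bar>real N\<bar> * (\<integral>\<^sup>+y. ?d 0 (- (real N * a) + real N * y)
        * \<psi> N (- (real N * a) + real N * y) \<partial>lborel)"
      by (rule nn_integral_real_affine) (auto simp: N_def)
    also have "(\<integral>\<^sup>+y. ?d 0 (- (real N * a) + real N * y) * \<psi> N (- (real N * a) + real N * y) \<partial>lborel)
        = (\<integral>\<^sup>+y. ?d a y * ennreal (exp (- (y - a) / \<sigma>) ^ m) * \<psi> N (real N * (y - a)) \<partial>lborel)"
    proof (intro nn_integral_cong)
      fix y :: real
      have "two_param_exp_density 0 \<sigma> (real N * (y - a))
          = two_param_exp_density a \<sigma> y * exp (- (y - a) / \<sigma>) ^ m"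
      proof (cases "a < y")
        case True
        have "0 < real N * (y - a)" using True by (simp add: N_def)
        moreover have "exp (- (real N * (y - a)) / \<sigma>) = exp (- (y - a) / \<sigma>) * exp (- (y - a) / \<sigma>) ^ m"
          unfolding exp_of_nat_mult[symmetric] exp_add[symmetric] N_def
          by (rule arg_cong[where f=exp]) (use \<sigma> in \<open>simp add: field_simps\<close>)
        ultimately show ?thesis using True by (simp add: two_param_exp_density_def)
      next
        case False
        then have "\<not> 0 < real N * (y - a)" by (simp add: N_def zero_less_mult_iff)
        then show ?thesis using False by (simp add: two_param_exp_density_def)
      qed
      moreover have "- (real N * a) + real N * y = real N * (y - a)" by (simp add: algebra_simps)
      ultimately show "?d 0 (- (real N * a) + real N * y) * \<psi> N (- (real N * a) + real N * y)
          = ?d a y * ennreal (exp (- (y - a) / \<sigma>) ^ m) * \<psi> N (real N * (y - a))"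
        by (simp add: ennreal_mult'')
    qed
    finally show ?thesis by (simp add: ennreal_of_nat_eq_real_of_nat)
  qed
  finally show ?case
    unfolding Suc.hyps(2)[symmetric] N_def by (simp add: mult.commute)
qed

lemma density_two_param_exp_0:
  assumes "0 < \<sigma>"
  shows "density lborel (\<lambda>x. ennreal (two_param_exp_density 0 \<sigma> x))
    = density lborel (\<lambda>x. ennreal (exponential_density (1 / \<sigma>) x))"
proof (rule density_cong)
  have "AE x in lborel. x \<noteq> (0 :: real)" by (rule AE_lborel_singleton)
  then show "AE x in lborel. ennreal (two_param_exp_density 0 \<sigma> x) = ennreal (exponential_density (1 / \<sigma>) x)"
    by eventually_elim (auto simp: two_param_exp_density_def exponential_density_def)
qed auto

context prob_space begin

lemma nn_integral_spacings:
  fixes X :: "'i \<Rightarrow> 'a \<Rightarrow> real" and \<psi> :: "nat \<Rightarrow> real \<Rightarrow> ennreal"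
  assumes \<sigma>: "0 < \<sigma>" and I: "finite I" "I \<noteq> {}"
    and indep: "indep_vars (\<lambda>_. borel) X I"
    and X: "\<And>i. i \<in> I \<Longrightarrow> distributed M lborel (X i) (\<lambda>x. ennreal (two_param_exp_density a \<sigma> x))"
    and \<psi>: "\<And>k. \<psi> k \<in> borel_measurable borel"
  defines "Y \<equiv> \<lambda>k \<omega>. real (card I - k) *
      (ascending I (\<lambda>i. X i \<omega>) ! k - (a # ascending I (\<lambda>i. X i \<omega>)) ! k)"
  shows "(\<integral>\<^sup>+\<omega>. (\<Prod>k<card I. \<psi> k (Y k \<omega>)) \<partial>M)
    = (\<Prod>k<card I. \<integral>\<^sup>+y. ennreal (two_param_exp_density 0 \<sigma> y) * \<psi> k y \<partial>lborel)"
proof -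
  let ?d = "\<lambda>x. ennreal (two_param_exp_density a \<sigma> x)"
  let ?e = "density lborel ?d"
  let ?n = "card I"
  define \<phi> where "\<phi> l = \<psi> (?n - l)" for l
  have \<phi>: "\<phi> l \<in> borel_measurable borel" for l by (simp add: \<phi>_def \<psi>)
  have rv: "X i \<in> borel_measurable M" if "i \<in> I" for i
    using distributed_measurable[OF X[OF that]] by simp
  have law: "distr M borel (X i) = ?e" if "i \<in> I" for i
    using distributed_distr_eq_density[OF X[OF that]] distr_cong[of M M lborel borel "X i" "X i"] by simp
  obtain i0 where "i0 \<in> I" using I(2) by auto
  have prob_e: "prob_space ?e" 
    using law[OF \<open>i0 \<in> I\<close>] prob_space_distr[OF rv[OF \<open>i0 \<in> I\<close>]] by simp
  interpret e: product_sigma_finite "\<lambda>_ :: 'i. ?e"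
    unfolding product_sigma_finite_def using prob_space_imp_sigma_finite[OF prob_e] by blast
  have dens: "PiM I (\<lambda>_. ?e) = density (PiM I (\<lambda>_. lborel)) (\<lambda>x. \<Prod>i\<in>I. ?d (x i))"
  proof (rule e.PiM_eqI[symmetric])
    fix A :: "'i \<Rightarrow> real set" assume A: "\<And>i. i \<in> I \<Longrightarrow> A i \<in> sets ?e"
    then have [measurable]: "A i \<in> sets borel" if "i \<in> I" for i using that by simp
    have "emeasure (density (PiM I (\<lambda>_. lborel)) (\<lambda>x. \<Prod>i\<in>I. ?d (x i))) (Pi\<^sub>E I A)
        = (\<integral>\<^sup>+x. (\<Prod>i\<in>I. ?d (x i)) * indicator (Pi\<^sub>E I A) x \<partial>PiM I (\<lambda>_. lborel))"
      by (intro emeasure_density borel_measurable_prod_ennreal sets_PiM_I_finite I(1)) simp_all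
    also have "\<dots> = (\<integral>\<^sup>+x. (\<Prod>i\<in>I. ?d (x i) * indicator (A i) (x i)) \<partial>PiM I (\<lambda>_. lborel))"
    proof (intro nn_integral_cong)
      fix x assume "x \<in> space (PiM I (\<lambda>_. lborel :: real measure))"
      then have "x \<in> extensional I" by (simp add: space_PiM PiE_def)
      then have "indicator (Pi\<^sub>E I A) x = (\<Prod>i\<in>I. indicator (A i) (x i) :: ennreal)"
        using I(1) by (auto simp: indicator_def PiE_iff prod_zero_iff)
      then show "(\<Prod>i\<in>I. ?d (x i)) * indicator (Pi\<^sub>E I A) x = (\<Prod>i\<in>I. ?d (x i) * indicator (A i) (x i))"
        by (simp add: prod.distrib)
    qed
    also have "\<dots> = (\<Prod>i\<in>I. \<integral>\<^sup>+y. ?d y * indicator (A i) y \<partial>lborel)"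
      using I(1) by (intro lborel_prod.product_nn_integral_prod) measurable
    also have "\<dots> = (\<Prod>i\<in>I. emeasure ?e (A i))"
      by (intro prod.cong) (auto simp: emeasure_density)
    finally show "emeasure (density (PiM I (\<lambda>_. lborel)) (\<lambda>x. \<Prod>i\<in>I. ?d (x i))) (Pi\<^sub>E I A)
        = (\<Prod>i\<in>I. emeasure ?e (A i))" .
  qed (auto simp: I(1) intro!: sets_PiM_cong)
  have joint: "distr M (PiM I (\<lambda>_. borel)) (\<lambda>\<omega>. \<lambda>i\<in>I. X i \<omega>)
      = density (PiM I (\<lambda>_. lborel)) (\<lambda>x. \<Prod>i\<in>I. ?d (x i))"
  proof -
    have "distr M (PiM I (\<lambda>_. borel)) (\<lambda>\<omega>. \<lambda>i\<in>I. X i \<omega>) = PiM I (\<lambda>i. distr M borel (X i))"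
      using indep_vars_iff_distr_eq_PiM'[OF I(2), where M' = "\<lambda>_. borel" and X = X] rv indep by simp
    also have "\<dots> = PiM I (\<lambda>_. ?e)" by (intro PiM_cong law refl)
    finally show ?thesis unfolding dens .
  qed
  have [measurable]: "(\<lambda>x. spacing_prod \<phi> a (ascending I x)) \<in> borel_measurable (PiM I (\<lambda>_. borel))"
    by (rule measurable_spacing_prod[OF I(1) _ \<phi>]) auto
  have [measurable]: "(\<lambda>x. spacing_prod \<phi> a (ascending I x)) \<in> borel_measurable (PiM I (\<lambda>_. lborel))"
    by (rule measurable_spacing_prod[OF I(1) _ \<phi>]) auto
  have "(\<integral>\<^sup>+\<omega>. (\<Prod>k<?n. \<psi> k (Y k \<omega>)) \<partial>M) = (\<integral>\<^sup>+\<omega>. spacing_prod \<phi> a (ascending I (\<lambda>i\<in>I. X i \<omega>)) \<partial>M)"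
  proof (intro nn_integral_cong)
    fix \<omega>
    have "ascending I (\<lambda>i\<in>I. X i \<omega>) = ascending I (\<lambda>i. X i \<omega>)"
      by (rule ascending_cong) simp
    then show "(\<Prod>k<?n. \<psi> k (Y k \<omega>)) = spacing_prod \<phi> a (ascending I (\<lambda>i\<in>I. X i \<omega>))"
      by (simp add: spacing_prod_eq length_ascending \<phi>_def Y_def)
  qed
  also have "\<dots> = (\<integral>\<^sup>+x. spacing_prod \<phi> a (ascending I x) \<partial>distr M (PiM I (\<lambda>_. borel)) (\<lambda>\<omega>. \<lambda>i\<in>I. X i \<omega>))"
    by (intro nn_integral_distr[symmetric] measurable_restrict rv) simp_all
  also have "\<dots> = (\<integral>\<^sup>+x. (\<Prod>i\<in>I. ?d (x i)) * spacing_prod \<phi> a (ascending I x) \<partial>PiM I (\<lambda>_. lborel))"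
    unfolding joint by (intro nn_integral_density) measurable
  also have "\<dots> = (\<Prod>l\<in>{1..?n}. \<integral>\<^sup>+y. ennreal (two_param_exp_density 0 \<sigma> y) * \<phi> l y \<partial>lborel)"
    by (rule nn_integral_spacing_prod[OF \<sigma> \<phi> I(1)])
  also have "\<dots> = (\<Prod>k<?n. \<integral>\<^sup>+y. ennreal (two_param_exp_density 0 \<sigma> y) * \<psi> k y \<partial>lborel)"
  proof (rule prod.reindex_cong[where l = "\<lambda>k. ?n - k"])
    show "inj_on (\<lambda>k. ?n - k) {..<?n}" by (auto simp: inj_on_def)
    show "{1..?n} = (\<lambda>k. ?n - k) ` {..<?n}"
    proof (intro equalityI subsetI)
      fix l assume "l \<in> {1..?n}"
      then show "l \<in> (\<lambda>k. ?n - k) ` {..<?n}" by (intro image_eqI[of _ _ "?n - l"]) simp_all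
    qed auto
  qed (simp add: \<phi>_def)
  finally show ?thesis .
qed

text \<open>Taking indicator functions as the factors identifies the joint law of the spacings on boxes,
  hence as a product measure.\<close>
theorem renyi_spacings:
  fixes X :: "'i \<Rightarrow> 'a \<Rightarrow> real"
  assumes \<sigma>: "0 < \<sigma>" and I: "finite I" "I \<noteq> {}"
    and indep: "indep_vars (\<lambda>_. borel) X I"
    and X: "\<And>i. i \<in> I \<Longrightarrow> distributed M lborel (X i) (\<lambda>x. ennreal (two_param_exp_density a \<sigma> x))"
  defines "Y \<equiv> \<lambda>k \<omega>. real (card I - k) *
      (ascending I (\<lambda>i. X i \<omega>) ! k - (a # ascending I (\<lambda>i. X i \<omega>)) ! k)"
  shows "indep_vars (\<lambda>_. borel) Y {..<card I}"
    and "\<And>k. k < card I \<Longrightarrow> distributed M lborel (Y k) (exponential_density (1 / \<sigma>))"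
proof -
  let ?n = "card I"
  let ?e = "density lborel (\<lambda>x. ennreal (two_param_exp_density 0 \<sigma> x))"
  have rv: "X i \<in> borel_measurable M" if "i \<in> I" for i
    using distributed_measurable[OF X[OF that]] by simp
  have Ym: "Y k \<in> borel_measurable M" if "k < ?n" for k
  proof -
    have asc: "(\<lambda>\<omega>. ascending I (\<lambda>i. X i \<omega>) ! j) \<in> borel_measurable M" if "j < ?n" for j
      using I(1) rv that by (rule measurable_ascending_nth)
    have "(\<lambda>\<omega>. (a # ascending I (\<lambda>i. X i \<omega>)) ! k) \<in> borel_measurable M"
      using that asc[of "k - 1"] by (cases k) simp_all
    with asc[OF that] show ?thesis unfolding Y_def by measurable
  qed
  have prob_e: "prob_space ?e" 
    unfolding density_two_param_exp_0[OF \<sigma>] using \<sigma> by (intro prob_space_exponential_density) simp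
  interpret e: product_sigma_finite "\<lambda>_ :: nat. ?e"
    unfolding product_sigma_finite_def using prob_space_imp_sigma_finite[OF prob_e] by blast
  have rect: "emeasure M {\<omega> \<in> space M. \<forall>k<?n. Y k \<omega> \<in> A k} = (\<Prod>k<?n. emeasure ?e (A k))"
    if A: "\<And>k. A k \<in> sets borel" for A
  proof -
    have "{\<omega> \<in> space M. \<forall>k\<in>{..<?n}. Y k \<omega> \<in> A k} \<in> sets M"
    proof (intro sets.sets_Collect_finite_All)
      fix k assume "k \<in> {..<?n}"
      then have "Y k -` A k \<inter> space M \<in> sets M" using Ym A by (intro measurable_sets) simp_all
      moreover have "Y k -` A k \<inter> space M = {\<omega> \<in> space M. Y k \<omega> \<in> A k}" by blast
      ultimately show "{\<omega> \<in> space M. Y k \<omega> \<in> A k} \<in> sets M" by metis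
    qed simp
    then have S: "{\<omega> \<in> space M. \<forall>k<?n. Y k \<omega> \<in> A k} \<in> sets M"
      by (simp only: Ball_def lessThan_iff)
    have "emeasure M {\<omega> \<in> space M. \<forall>k<?n. Y k \<omega> \<in> A k}
        = (\<integral>\<^sup>+\<omega>. indicator {\<omega> \<in> space M. \<forall>k<?n. Y k \<omega> \<in> A k} \<omega> \<partial>M)"
      by (rule nn_integral_indicator[OF S, symmetric])
    also have "\<dots> = (\<integral>\<^sup>+\<omega>. (\<Prod>k<?n. indicator (A k) (Y k \<omega>)) \<partial>M)"
    proof (intro nn_integral_cong)
      fix \<omega> assume \<omega>: "\<omega> \<in> space M"
      show "indicator {\<omega> \<in> space M. \<forall>k<?n. Y k \<omega> \<in> A k} \<omega>
          = (\<Prod>k<?n. indicator (A k) (Y k \<omega>) :: ennreal)"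
      proof (cases "\<forall>k<?n. Y k \<omega> \<in> A k")
        case True
        then show ?thesis using \<omega> by simp
      next
        case False
        then obtain k where k: "k < ?n" "Y k \<omega> \<notin> A k" by blast
        have "(\<Prod>k<?n. indicator (A k) (Y k \<omega>)) = (0 :: ennreal)"
          by (rule prod_zero[OF finite_lessThan], rule bexI[of _ k]) (simp_all add: k)
        then show ?thesis using False by simp
      qed
    qed
    also have "\<dots> = (\<Prod>k<?n. \<integral>\<^sup>+y. ennreal (two_param_exp_density 0 \<sigma> y) * indicator (A k) y \<partial>lborel)"
    proof -
      have "indicator (A k) \<in> borel_measurable borel" for k
        using A by (intro borel_measurable_indicator) simp
      then show ?thesis
        unfolding Y_def by (intro nn_integral_spacings[where X = X and a = a and I = I and \<psi> = "\<lambda>k. indicator (A k)"]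
            \<sigma> I indep X)
    qed
    also have "\<dots> = (\<Prod>k<?n. emeasure ?e (A k))"
      by (simp add: emeasure_density A)
    finally show ?thesis .
  qed
  have law: "distr M borel (Y k) = ?e" if k: "k < ?n" for k
  proof (rule measure_eqI)
    fix B assume "B \<in> sets (distr M borel (Y k))"
    then have B: "B \<in> sets borel" by simp
    define A where "A j = (if j = k then B else UNIV)" for j
    have "emeasure (distr M borel (Y k)) B = emeasure M {\<omega> \<in> space M. \<forall>j<?n. Y j \<omega> \<in> A j}"
      using B Ym[OF k] k by (subst emeasure_distr) (auto simp: A_def intro!: arg_cong[where f = "emeasure M"])
    also have "\<dots> = (\<Prod>j<?n. emeasure ?e (A j))"
      using B by (intro rect) (auto simp: A_def)
    also have "\<dots> = (\<Prod>j<?n. if j = k then emeasure ?e B else 1)"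
      using prob_space.emeasure_space_1[OF prob_e] by (intro prod.cong) (auto simp: A_def)
    also have "\<dots> = emeasure ?e B" using k by simp
    finally show "emeasure (distr M borel (Y k)) B = emeasure ?e B" .
  qed simp
  show "distributed M lborel (Y k) (exponential_density (1 / \<sigma>))" if k: "k < ?n" for k
  proof -
    have "distr M lborel (Y k) = ?e"
      using law[OF k] distr_cong[of M M lborel borel "Y k" "Y k"] by simp
    then show ?thesis
      unfolding distributed_def density_two_param_exp_0[OF \<sigma>] using Ym[OF k] by simp
  qed
  have "distr M (PiM {..<?n} (\<lambda>_. borel)) (\<lambda>\<omega>. \<lambda>k\<in>{..<?n}. Y k \<omega>) = PiM {..<?n} (\<lambda>_. ?e)"
  proof (rule e.PiM_eqI)
    fix A :: "nat \<Rightarrow> real set" assume A: "\<And>k. k \<in> {..<?n} \<Longrightarrow> A k \<in> sets ?e"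
    define B where "B k = (if k < ?n then A k else {})" for k
    have B: "B k \<in> sets borel" for k
      using A[of k] by (cases "k < ?n") (simp_all add: B_def)
    have "emeasure (distr M (PiM {..<?n} (\<lambda>_. borel)) (\<lambda>\<omega>. \<lambda>k\<in>{..<?n}. Y k \<omega>)) (Pi\<^sub>E {..<?n} A)
        = emeasure M {\<omega> \<in> space M. \<forall>k<?n. Y k \<omega> \<in> B k}"
    proof (subst emeasure_distr)
      show "(\<lambda>\<omega>. \<lambda>k\<in>{..<?n}. Y k \<omega>) \<in> measurable M (PiM {..<?n} (\<lambda>_. borel))"
        using Ym by (intro measurable_restrict) simp
      show "Pi\<^sub>E {..<?n} A \<in> sets (PiM {..<?n} (\<lambda>_. borel))"
        using A by (intro sets_PiM_I_finite) simp_all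
      have "(\<lambda>\<omega>. \<lambda>k\<in>{..<?n}. Y k \<omega>) -` Pi\<^sub>E {..<?n} A \<inter> space M = {\<omega> \<in> space M. \<forall>k<?n. Y k \<omega> \<in> B k}"
        by (simp add: B_def PiE_iff vimage_def Int_def) blast
      then show "emeasure M ((\<lambda>\<omega>. \<lambda>k\<in>{..<?n}. Y k \<omega>) -` Pi\<^sub>E {..<?n} A \<inter> space M)
          = emeasure M {\<omega> \<in> space M. \<forall>k<?n. Y k \<omega> \<in> B k}" by simp
    qed
    also have "\<dots> = (\<Prod>k<?n. emeasure ?e (A k))"
      unfolding rect[OF B] by (intro prod.cong) (simp_all add: B_def)
    finally show "emeasure (distr M (PiM {..<?n} (\<lambda>_. borel)) (\<lambda>\<omega>. \<lambda>k\<in>{..<?n}. Y k \<omega>)) (Pi\<^sub>E {..<?n} A)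
        = (\<Prod>k<?n. emeasure ?e (A k))" .
  qed (auto intro!: sets_PiM_cong)
  moreover have "{..<?n} \<noteq> {}" using I by (simp add: lessThan_empty_iff)
  moreover have "PiM {..<?n} (\<lambda>k. distr M borel (Y k)) = PiM {..<?n} (\<lambda>_. ?e)"
    by (intro PiM_cong refl law) simp
  ultimately show "indep_vars (\<lambda>_. borel) Y {..<?n}"
    using Ym by (subst indep_vars_iff_distr_eq_PiM') auto
qed

end

section \<open>Concentration from characteristic functions\<close>

text \<open>The terms of degree at most two of the expanded product; \<open>((\<Sum>x)\<^sup>2 - \<Sum>x\<^sup>2) / 2\<close> is the
  second elementary symmetric polynomial.\<close>
lemma prod_one_plus_ge:
  fixes x :: "'b \<Rightarrow> real"
  assumes "finite A" "\<And>k. k \<in> A \<Longrightarrow> 0 \<le> x k"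
  shows "1 + sum x A + ((sum x A)\<^sup>2 - (\<Sum>k\<in>A. (x k)\<^sup>2)) / 2 \<le> (\<Prod>k\<in>A. 1 + x k)
    \<and> (\<Sum>k\<in>A. (x k)\<^sup>2) \<le> (sum x A)\<^sup>2"
  using assms
proof (induction A rule: finite_induct)
  case (insert k A)
  let ?S = "sum x A" and ?Q = "\<Sum>k\<in>A. (x k)\<^sup>2"
  have S: "0 \<le> ?S" and k: "0 \<le> x k" using insert.prems by (auto intro!: sum_nonneg)
  have IH: "1 + ?S + (?S\<^sup>2 - ?Q) / 2 \<le> (\<Prod>k\<in>A. 1 + x k)" "?Q \<le> ?S\<^sup>2"
    using insert.IH insert.prems by auto
  have "1 + (x k + ?S) + ((x k + ?S)\<^sup>2 - ((x k)\<^sup>2 + ?Q)) / 2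
      \<le> (1 + x k) * (1 + ?S + (?S\<^sup>2 - ?Q) / 2)"
    using mult_nonneg_nonneg[OF k, of "?S\<^sup>2 - ?Q"] IH(2)
    by (simp add: power2_eq_square field_simps)
  also have "\<dots> \<le> (1 + x k) * (\<Prod>k\<in>A. 1 + x k)"
    using IH(1) k by (intro mult_left_mono) auto
  finally show ?case
    using insert.hyps IH(2) mult_nonneg_nonneg[OF k S]
    by (simp add: power2_eq_square algebra_simps)
qed simp

text \<open>If no term dominates the sum, then the second elementary symmetric polynomial is at least a
  tenth of the squared sum. So the product grows quadratically, and its square root, which is the
  inverse modulus of a characteristic function, still grows linearly in \<open>sum x A\<close>.\<close>
lemma prod_one_plus_ge_square:
  fixes x :: "'b \<Rightarrow> real"
  assumes A: "finite A" and nn: "\<And>k. k \<in> A \<Longrightarrow> 0 \<le> x k"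
    and dom: "\<And>k. k \<in> A \<Longrightarrow> x k \<le> 4 / 5 * sum x A"
  shows "(1 + sum x A / 4)\<^sup>2 \<le> (\<Prod>k\<in>A. 1 + x k)"
proof -
  let ?S = "sum x A"
  have S: "0 \<le> ?S" using nn by (rule sum_nonneg)
  have "(\<Sum>k\<in>A. (x k)\<^sup>2) \<le> (\<Sum>k\<in>A. (4 / 5 * ?S) * x k)"
    unfolding power2_eq_square using dom nn by (intro sum_mono mult_right_mono) auto
  also have "\<dots> = 4 / 5 * ?S\<^sup>2" unfolding sum_distrib_left[symmetric] by (simp add: power2_eq_square)
  finally have "(\<Sum>k\<in>A. (x k)\<^sup>2) \<le> 4 / 5 * ?S\<^sup>2" .
  then have "(1 + ?S / 4)\<^sup>2 \<le> 1 + ?S + (?S\<^sup>2 - (\<Sum>k\<in>A. (x k)\<^sup>2)) / 2"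
  proof -
    have "(1 + ?S / 4)\<^sup>2 = 1 + ?S / 2 + ?S\<^sup>2 / 16"
      by (simp add: power2_eq_square algebra_simps)
    with \<open>(\<Sum>k\<in>A. (x k)\<^sup>2) \<le> 4 / 5 * ?S\<^sup>2\<close> show ?thesis
      using S zero_le_power2[of ?S] by argo
  qed
  also have "\<dots> \<le> (\<Prod>k\<in>A. 1 + x k)" by (rule prod_one_plus_ge[OF A nn, THEN conjunct1])
  finally show ?thesis .
qed

lemma integral_inverse_one_plus_square_scaled:
  assumes c: "0 < (c :: real)"
  shows "integrable lborel (\<lambda>t. inverse (1 + (c * t)\<^sup>2))"
    and "(\<integral>t. inverse (1 + (c * t)\<^sup>2) \<partial>lborel) = pi / c"
proof -
  have 1: "integrable lborel (\<lambda>x :: real. inverse (1 + x\<^sup>2))"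
    using integrable_inverse_1_plus_square by (simp add: set_integrable_def)
  have 2: "(\<integral>x. inverse (1 + x\<^sup>2) \<partial>lborel) = pi"
    using LBINT_inverse_1_plus_square
    by (simp add: interval_lebesgue_integral_def set_lebesgue_integral_def)
  show "integrable lborel (\<lambda>t. inverse (1 + (c * t)\<^sup>2))"
    using lborel_integrable_real_affine[OF 1, of c 0] c by simp
  show "(\<integral>t. inverse (1 + (c * t)\<^sup>2) \<partial>lborel) = pi / c"
    using lborel_integral_real_affine[of c "\<lambda>x. inverse (1 + x\<^sup>2)" 0] c 2
    by (simp add: field_simps)
qed

context real_distribution begin

text \<open>In the inversion formula the kernel \<open>(exp (- \<i> t a) - exp (- \<i> t b)) / (\<i> t)\<close> has modulus
  at most \<open>b - a\<close>, so the integral of the modulus of the characteristic function bounds the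
  density.\<close>
lemma measure_Ioc_le_of_char:
  assumes c: "0 < c" and char: "\<And>t. cmod (char M t) \<le> inverse (1 + (c * t)\<^sup>2)"
    and ab: "a \<le> b" and atoms: "measure M {a} = 0" "measure M {b} = 0"
  shows "measure M {a<..b} \<le> (b - a) / (2 * c)"
proof -
  let ?F = "\<lambda>t :: real. (iexp (- (t * a)) - iexp (- (t * b))) / (\<i> * t) * char M t"
  let ?g = "\<lambda>t. (b - a) * inverse (1 + (c * t)\<^sup>2)"
  have Fle: "cmod (?F t) \<le> ?g t" for t
  proof (cases "t = 0")
    case False
    have "cmod ((iexp (- (t * a)) - iexp (- (t * b))) / (\<i> * t)) \<le> b - a"
      using Levy_Inversion_aux2[of "- b" "- a" t] ab False by simp
    then show ?thesis
      unfolding norm_mult using char[of t] ab by (intro mult_mono) auto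
  qed (use ab in auto)
  have int: "integrable lborel ?g"
    using integral_inverse_one_plus_square_scaled(1)[OF c] by simp
  have bound: "cmod (1 / (2 * pi) * (CLBINT t=-T..T. ?F t)) \<le> (b - a) / (2 * c)" if T: "0 \<le> T" for T :: real
  proof -
    have "cmod (CLBINT t=-T..T. ?F t) \<le> (\<integral>t. cmod (indicator {-T<..<T} t *\<^sub>R ?F t) \<partial>lborel)"
    proof -
      have "(CLBINT t=-T..T. ?F t) = (\<integral>t. indicator {-T<..<T} t *\<^sub>R ?F t \<partial>lborel)"
        using T by (simp add: interval_lebesgue_integral_def set_lebesgue_integral_def)
      then show ?thesis by (simp only: integral_norm_bound)
    qed
    also have "\<dots> \<le> (\<integral>t. ?g t \<partial>lborel)"
    proof (rule integral_mono'[OF int])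
      fix t :: real
      show le: "cmod (indicator {-T<..<T} t *\<^sub>R ?F t) \<le> ?g t"
        using Fle[of t] order_trans[OF norm_ge_zero Fle[of t]] by (cases "t \<in> {-T<..<T}") simp_all
      show "0 \<le> ?g t" using ab by simp
    qed
    also have "\<dots> = (b - a) * (pi / c)"
      using integral_inverse_one_plus_square_scaled(2)[OF c] by simp
    finally have "cmod (CLBINT t=-T..T. ?F t) \<le> (b - a) * (pi / c)" .
    then have "1 / (2 * pi) * cmod (CLBINT t=-T..T. ?F t) \<le> 1 / (2 * pi) * ((b - a) * (pi / c))"
      by (intro mult_left_mono) auto
    then show ?thesis by (simp add: norm_mult norm_divide)
  qed
  have "cmod (complex_of_real (measure M {a<..b})) \<le> (b - a) / (2 * c)"
  proof (rule LIMSEQ_le_const2[OF tendsto_norm[OF Levy_Inversion[OF ab atoms]]], intro exI[of _ 0] allI impI)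
    fix T :: nat
    show "cmod (complex_of_real (1 / (2 * pi)) * (CLBINT t=ereal (real_of_int (- int T))..ereal (real T). ?F t))
        \<le> (b - a) / (2 * c)"
      using bound[of "real T"] by simp
  qed
  then show ?thesis by simp
qed

text \<open>Inversion speaks of intervals whose end points are no atoms. There are only countably many
  atoms, so the end points can be moved outwards by an arbitrarily small amount.\<close>
lemma measure_Icc_le_of_char:
  assumes c: "0 < c" and char: "\<And>t. cmod (char M t) \<le> inverse (1 + (c * t)\<^sup>2)" and ab: "a \<le> b"
  shows "measure M {a..b} \<le> (b - a) / (2 * c)"
proof (rule field_le_epsilon)
  fix e :: real assume e: "0 < e"
  have non_atom: "\<exists>x. u < x \<and> x < v \<and> measure M {x} = 0" if "u < v" for u v :: real
  proof -
    have "uncountable ({u<..<v} - {x. measure M {x} \<noteq> 0})"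
      using that countable_support by (intro uncountable_minus_countable) (simp_all add: uncountable_open_interval)
    then have "{u<..<v} - {x. measure M {x} \<noteq> 0} \<noteq> {}" by (metis countable_empty)
    then show ?thesis by auto
  qed
  obtain a' where a': "a - e * c < a'" "a' < a" "measure M {a'} = 0"
    using non_atom[of "a - e * c" a] e c by auto
  obtain b' where b': "b < b'" "b' < b + e * c" "measure M {b'} = 0"
    using non_atom[of b "b + e * c"] e c by auto
  have "measure M {a..b} \<le> measure M {a'<..b'}"
    using a' b' by (intro finite_measure_mono) auto
  also have "\<dots> \<le> (b' - a') / (2 * c)"
    using a' b' ab by (intro measure_Ioc_le_of_char[OF c char]) auto
  also have "\<dots> \<le> (b - a + 2 * (e * c)) / (2 * c)"
    using a' b' c by (intro divide_right_mono) auto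
  also have "\<dots> = (b - a) / (2 * c) + e"
    using c by (simp add: field_simps)
  finally show "measure M {a..b} \<le> (b - a) / (2 * c) + e" .
qed

end

section \<open>Weighted sums of independent exponentials\<close>

context prob_space begin

lemma indep_sum_square_expectation:
  fixes Z :: "'i \<Rightarrow> 'a \<Rightarrow> real"
  assumes "finite A" "indep_vars (\<lambda>_. borel) Z A"
    and "\<And>k. k \<in> A \<Longrightarrow> integrable M (\<lambda>\<omega>. (Z k \<omega>)\<^sup>2)"
    and "\<And>k. k \<in> A \<Longrightarrow> expectation (Z k) = 0"
  shows "integrable M (\<lambda>\<omega>. (\<Sum>k\<in>A. Z k \<omega>)\<^sup>2)
    \<and> expectation (\<lambda>\<omega>. (\<Sum>k\<in>A. Z k \<omega>)\<^sup>2) = (\<Sum>k\<in>A. expectation (\<lambda>\<omega>. (Z k \<omega>)\<^sup>2))"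
  using assms
proof (induction A rule: finite_induct)
  case (insert k A)
  let ?S = "\<lambda>\<omega>. \<Sum>j\<in>A. Z j \<omega>"
  have indep: "indep_var borel (Z k) borel ?S"
    using insert by (intro indep_vars_sum) auto
  have rv: "Z j \<in> borel_measurable M" if "j \<in> insert k A" for j
    using insert.prems(1) that by (auto simp: indep_vars_def)
  have int1: "integrable M (Z j)" if "j \<in> insert k A" for j
    using square_integrable_imp_integrable[OF rv[OF that] insert.prems(2)[OF that]] .
  have intS: "integrable M ?S" using int1 by (intro Bochner_Integration.integrable_sum) auto
  have IH: "integrable M (\<lambda>\<omega>. (?S \<omega>)\<^sup>2)"
    "expectation (\<lambda>\<omega>. (?S \<omega>)\<^sup>2) = (\<Sum>j\<in>A. expectation (\<lambda>\<omega>. (Z j \<omega>)\<^sup>2))"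
    using insert.IH insert.prems indep_vars_subset[OF insert.prems(1), of A] by auto
  have prod: "integrable M (\<lambda>\<omega>. Z k \<omega> * ?S \<omega>)" "expectation (\<lambda>\<omega>. Z k \<omega> * ?S \<omega>) = 0"
    using indep_var_integrable[OF indep int1 intS] indep_var_lebesgue_integral[OF indep int1 intS]
      insert.prems(3)[of k] by auto
  have int2: "integrable M (\<lambda>\<omega>. (Z k \<omega>)\<^sup>2)" using insert.prems(2) by simp
  have eq: "(\<Sum>j\<in>insert k A. Z j \<omega>)\<^sup>2 = (Z k \<omega>)\<^sup>2 + (?S \<omega>)\<^sup>2 + 2 * (Z k \<omega> * ?S \<omega>)" for \<omega>
    using insert.hyps by (simp add: power2_sum)
  have "integrable M (\<lambda>\<omega>. (Z k \<omega>)\<^sup>2 + (?S \<omega>)\<^sup>2 + 2 * (Z k \<omega> * ?S \<omega>))"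
    using int2 IH(1) prod(1) by (intro Bochner_Integration.integrable_add integrable_mult_right)
  moreover have "expectation (\<lambda>\<omega>. (Z k \<omega>)\<^sup>2 + (?S \<omega>)\<^sup>2 + 2 * (Z k \<omega> * ?S \<omega>))
      = expectation (\<lambda>\<omega>. (Z k \<omega>)\<^sup>2) + expectation (\<lambda>\<omega>. (?S \<omega>)\<^sup>2)"
    using int2 IH(1) prod by simp
  ultimately show ?case
    unfolding eq using IH(2) insert.hyps by simp
qed simp

lemma exponential_centred_moments:
  assumes \<sigma>: "0 < \<sigma>" and Y: "distributed M lborel Y (exponential_density (1 / \<sigma>))"
  shows "Y \<in> borel_measurable M"
    and "integrable M (\<lambda>\<omega>. (w * (Y \<omega> - \<sigma>))\<^sup>2)"
    and "expectation (\<lambda>\<omega>. w * (Y \<omega> - \<sigma>)) = 0"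
    and "expectation (\<lambda>\<omega>. (w * (Y \<omega> - \<sigma>))\<^sup>2) = (w * \<sigma>)\<^sup>2"
proof -
  have l: "0 < 1 / \<sigma>" using \<sigma> by simp
  show "Y \<in> borel_measurable M" using distributed_measurable[OF Y] by simp
  have int1: "integrable M Y" using erlang_ith_moment_integrable[OF l Y, of 1] by simp
  have int2: "integrable M (\<lambda>\<omega>. (Y \<omega>)\<^sup>2)" by (rule erlang_ith_moment_integrable[OF l Y])
  have EY: "expectation Y = \<sigma>" using exponential_distributed_expectation[OF l Y] by simp
  have "integrable M (\<lambda>\<omega>. w\<^sup>2 * ((Y \<omega>)\<^sup>2 - 2 * \<sigma> * Y \<omega> + \<sigma>\<^sup>2))"
    using int1 int2 by simp
  then show "integrable M (\<lambda>\<omega>. (w * (Y \<omega> - \<sigma>))\<^sup>2)"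
    by (simp add: power2_eq_square algebra_simps)
  show "expectation (\<lambda>\<omega>. w * (Y \<omega> - \<sigma>)) = 0"
    using int1 EY by (simp add: prob_space)
  show "expectation (\<lambda>\<omega>. (w * (Y \<omega> - \<sigma>))\<^sup>2) = (w * \<sigma>)\<^sup>2"
    using exponential_distributed_variance[OF l Y]
    by (simp add: EY power_mult_distrib power_divide)
qed

end

lemma char_exponential:
  assumes l: "0 < l"
  shows "char (density lborel (exponential_density l)) u = l / (l - \<i> * u)"
proof -
  define z where "z = complex_of_real l - \<i> * u"
  have z: "z \<noteq> 0" "Re z = l" using l by (auto simp: z_def complex_eq_iff)
  let ?f = "\<lambda>x :: real. l * exp (- z * x)"
  let ?F = "\<lambda>x :: real. - (l / z) * exp (- z * x)"
  have normf: "cmod (?f x) = l * exp (- x * l)" for x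
    using l z(2) by (simp add: norm_mult norm_exp_eq_Re mult.commute)
  have int: "set_integrable lborel {0<..} ?f"
    unfolding set_integrable_def
  proof (rule Bochner_Integration.integrable_bound)
    interpret prob_space "density lborel (exponential_density l)"
      using l by (rule prob_space_exponential_density)
    have "integrable (density lborel (exponential_density l)) (\<lambda>x. 1 :: real)" by simp
    then show "integrable lborel (exponential_density l)"
      using l by (subst (asm) integrable_density) (auto simp: exponential_density_nonneg)
    show "(\<lambda>x. indicator {0<..} x *\<^sub>R ?f x) \<in> borel_measurable lborel" by measurable
    have "cmod (indicator {0<..} x *\<^sub>R ?f x) \<le> norm (exponential_density l x)" for x
      using normf[of x] l by (auto simp: exponential_density_def split: split_indicator)
    then show "AE x in lborel. cmod (indicator {0<..} x *\<^sub>R ?f x) \<le> norm (exponential_density l x)" by simp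
  qed
  have "char (density lborel (exponential_density l)) u
      = (\<integral>x. exponential_density l x *\<^sub>R iexp (u * x) \<partial>lborel)"
    unfolding char_def using l by (intro integral_density) (auto simp: exponential_density_nonneg)
  also have "\<dots> = (\<integral>x. indicator {0<..} x *\<^sub>R ?f x \<partial>lborel)"
  proof (rule integral_cong_AE)
    have "AE x in lborel. x \<noteq> (0 :: real)" by (rule AE_lborel_singleton)
    then show "AE x in lborel. exponential_density l x *\<^sub>R iexp (u * x) = indicator {0<..} x *\<^sub>R ?f x"
    proof eventually_elim
      case (elim x)
      have "exp (- z * x) = complex_of_real (exp (- x * l)) * iexp (u * x)"
        by (simp add: z_def exp_of_real[symmetric] mult_exp_exp algebra_simps)
      then show ?case
        using elim by (auto simp: exponential_density_def scaleR_conv_of_real split: split_indicator)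
    qed
  qed auto
  also have "\<dots> = (LBINT x=0..\<infinity>. ?f x)"
    unfolding interval_lebesgue_integral_0_infty set_lebesgue_integral_def ..
  also have "\<dots> = 0 - (- (l / z))"
  proof (rule interval_integral_FTC_integrable)
    fix x :: real
    have "((\<lambda>y. - (l / z) * exp (- z * y)) has_field_derivative l * exp (- z * of_real x)) (at (of_real x))"
      using z(1) by (auto intro!: derivative_eq_intros)
    then show "(?F has_vector_derivative ?f x) (at x)"
      by (rule has_vector_derivative_real_field)
    show "isCont ?f x" by (intro continuous_intros)
  next
    have "((\<lambda>x. ?F x) \<longlongrightarrow> ?F 0) (at_right 0)" by (intro tendsto_intros)
    then show "((?F \<circ> real_of_ereal) \<longlongrightarrow> - (l / z)) (at_right 0)"
      by (simp add: zero_ereal_def ereal_tendsto_simps)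
  next
    have "((\<lambda>x :: real. exp (- (l * x))) \<longlongrightarrow> 0) at_top"
      using l by real_asymp
    then have "((\<lambda>x :: real. cmod (l / z) * exp (- (l * x))) \<longlongrightarrow> 0) at_top"
      by (rule tendsto_mult_right_zero)
    moreover have "cmod (?F x) = cmod (l / z) * exp (- (l * x))" for x
      using z(2) by (simp add: norm_mult norm_exp_eq_Re norm_divide)
    ultimately have "((\<lambda>x. cmod (?F x)) \<longlongrightarrow> 0) at_top" by simp
    then have "((\<lambda>x. ?F x) \<longlongrightarrow> 0) at_top" by (rule tendsto_norm_zero_cancel)
    then show "((?F \<circ> real_of_ereal) \<longlongrightarrow> 0) (at_left \<infinity>)"
      by (simp add: ereal_tendsto_simps)
  next
    show "set_integrable lborel (einterval 0 \<infinity>) ?f"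
      using int by (simp add: zero_ereal_def)
  qed simp
  finally show ?thesis by (simp add: z_def)
qed

lemma cmod_char_exponential_centred:
  assumes \<sigma>: "0 < \<sigma>" and M: "prob_space M" and Y: "distributed M lborel Y (exponential_density (1 / \<sigma>))"
  shows "(cmod (char (distr M borel (\<lambda>\<omega>. w * (Y \<omega> - \<sigma>))) u))\<^sup>2 = inverse (1 + (u * w * \<sigma>)\<^sup>2)"
proof -
  have [measurable]: "Y \<in> borel_measurable M" using distributed_measurable[OF Y] by simp
  have l: "0 < 1 / \<sigma>" using \<sigma> by simp
  have "char (distr M borel (\<lambda>\<omega>. w * (Y \<omega> - \<sigma>))) u = (CLINT \<omega>|M. iexp (- (u * w * \<sigma>)) * iexp (u * w * Y \<omega>))"
    unfolding char_def by (subst integral_distr) (auto simp: mult_exp_exp algebra_simps)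
  also have "\<dots> = iexp (- (u * w * \<sigma>)) * (CLINT \<omega>|M. iexp (u * w * Y \<omega>))"
    by simp
  also have "(CLINT \<omega>|M. iexp (u * w * Y \<omega>)) = char (distr M lborel Y) (u * w)"
    unfolding char_def by (subst integral_distr) auto
  also have "\<dots> = (1 / \<sigma>) / (1 / \<sigma> - \<i> * (u * w))"
    using char_exponential[OF l] by (simp add: distributed_distr_eq_density[OF Y])
  finally have eq: "char (distr M borel (\<lambda>\<omega>. w * (Y \<omega> - \<sigma>))) u
      = iexp (- (u * w * \<sigma>)) * ((1 / \<sigma>) / (1 / \<sigma> - \<i> * (u * w)))" .
  have "(cmod (1 / \<sigma> - \<i> * (u * w)))\<^sup>2 = (1 / \<sigma>)\<^sup>2 + (u * w)\<^sup>2"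
    by (simp add: cmod_power2)
  moreover have "cmod (complex_of_real (1 / \<sigma>)) = 1 / \<sigma>" using \<sigma> by (simp only: norm_of_real) simp
  moreover have "cmod (iexp (- (u * w * \<sigma>))) = 1" by (simp add: norm_exp_eq_Re)
  ultimately have "(cmod (char (distr M borel (\<lambda>\<omega>. w * (Y \<omega> - \<sigma>))) u))\<^sup>2 = (1 / \<sigma>)\<^sup>2 / ((1 / \<sigma>)\<^sup>2 + (u * w)\<^sup>2)"
    unfolding eq norm_mult norm_divide[of "complex_of_real (1 / \<sigma>)"] power_mult_distrib[of "cmod _"] power_divide[of "cmod _"]
    by (simp only: power_one mult_1_left)
  also have "\<dots> = inverse (1 + (u * w * \<sigma>)\<^sup>2)"
  proof -
    have "(1 / \<sigma>)\<^sup>2 + (u * w)\<^sup>2 = (1 / \<sigma>)\<^sup>2 * (1 + (u * w * \<sigma>)\<^sup>2)"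
      using \<sigma> by (simp add: power2_eq_square field_simps)
    then show ?thesis using \<sigma> by (simp add: divide_simps)
  qed
  finally show ?thesis .
qed

context prob_space begin

text \<open>The tail bound is Chebyshev's inequality, with the second moments added up by independence. The
  bound \<open>4 / 5\<close> on the share of a single weight is what \<open>prod_one_plus_ge_square\<close> needs, and with it the modulus
  is bounded by an integrable function, whose integral is of the order of the inverse standard
  deviation.\<close>
lemma weighted_exponential_sum:
  fixes Y :: "'i \<Rightarrow> 'a \<Rightarrow> real" and w :: "'i \<Rightarrow> real"
  assumes \<sigma>: "0 < \<sigma>" and A: "finite A" and indep: "indep_vars (\<lambda>_. borel) Y A"
    and Y: "\<And>k. k \<in> A \<Longrightarrow> distributed M lborel (Y k) (exponential_density (1 / \<sigma>))"
  defines "D \<equiv> \<lambda>\<omega>. \<Sum>k\<in>A. w k * (Y k \<omega> - \<sigma>)"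
  defines "S2 \<equiv> \<sigma>\<^sup>2 * (\<Sum>k\<in>A. (w k)\<^sup>2)"
  shows weighted_exponential_sum_tail: "0 < e \<Longrightarrow> prob {\<omega> \<in> space M. e \<le> \<bar>D \<omega>\<bar>} \<le> S2 / e\<^sup>2"
    and weighted_exponential_sum_char: "(\<And>k. k \<in> A \<Longrightarrow> (w k)\<^sup>2 \<le> 4 / 5 * (\<Sum>k\<in>A. (w k)\<^sup>2)) \<Longrightarrow>
      cmod (char (distr M borel D) u) \<le> inverse (1 + S2 * u\<^sup>2 / 4)"
proof -
  let ?Z = "\<lambda>k \<omega>. w k * (Y k \<omega> - \<sigma>)"
  have indepZ: "indep_vars (\<lambda>_. borel) ?Z A"
    by (rule indep_vars_compose2[OF indep]) simp
  have Z: "integrable M (\<lambda>\<omega>. (?Z k \<omega>)\<^sup>2)" "expectation (?Z k) = 0"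
    "expectation (\<lambda>\<omega>. (?Z k \<omega>)\<^sup>2) = (w k * \<sigma>)\<^sup>2" if "k \<in> A" for k
    using exponential_centred_moments[OF \<sigma> Y[OF that]] by auto
  have D2: "integrable M (\<lambda>\<omega>. (D \<omega>)\<^sup>2)" "expectation (\<lambda>\<omega>. (D \<omega>)\<^sup>2) = S2"
  proof -
    note sq = indep_sum_square_expectation[OF A indepZ Z(1,2)]
    show "integrable M (\<lambda>\<omega>. (D \<omega>)\<^sup>2)" unfolding D_def by (rule sq[THEN conjunct1])
    have "expectation (\<lambda>\<omega>. (D \<omega>)\<^sup>2) = (\<Sum>k\<in>A. expectation (\<lambda>\<omega>. (?Z k \<omega>)\<^sup>2))"
      unfolding D_def by (rule sq[THEN conjunct2])
    also have "\<dots> = (\<Sum>k\<in>A. (w k * \<sigma>)\<^sup>2)" by (intro sum.cong refl Z(3))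
    finally show "expectation (\<lambda>\<omega>. (D \<omega>)\<^sup>2) = S2"
      by (simp add: S2_def sum_distrib_left power_mult_distrib mult.commute)
  qed
  have Dm: "D \<in> borel_measurable M"
    unfolding D_def using exponential_centred_moments(1)[OF \<sigma> Y]
    by (intro borel_measurable_sum borel_measurable_times borel_measurable_diff) simp_all
  show "prob {\<omega> \<in> space M. e \<le> \<bar>D \<omega>\<bar>} \<le> S2 / e\<^sup>2" if "0 < e"
    using second_moment_method[OF Dm D2(1) that] D2(2) by simp
  assume dom: "\<And>k. k \<in> A \<Longrightarrow> (w k)\<^sup>2 \<le> 4 / 5 * (\<Sum>k\<in>A. (w k)\<^sup>2)"
  let ?x = "\<lambda>k. (u * w k * \<sigma>)\<^sup>2"
  have sumx: "sum ?x A = S2 * u\<^sup>2"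
    by (simp add: S2_def power_mult_distrib sum_distrib_left mult_ac)
  have "(cmod (char (distr M borel D) u))\<^sup>2 = (\<Prod>k\<in>A. (cmod (char (distr M borel (?Z k)) u))\<^sup>2)"
    unfolding D_def char_distr_sum[OF indepZ] by (simp add: prod_norm[symmetric] prod_power_distrib)
  also have "\<dots> = inverse (\<Prod>k\<in>A. 1 + ?x k)"
    using cmod_char_exponential_centred[OF \<sigma> prob_space_axioms Y]
    by (simp add: prod_inversef[symmetric] comp_def)
  also have "\<dots> \<le> inverse ((1 + sum ?x A / 4)\<^sup>2)"
  proof (rule le_imp_inverse_le)
    show "(1 + sum ?x A / 4)\<^sup>2 \<le> (\<Prod>k\<in>A. 1 + ?x k)"
    proof (rule prod_one_plus_ge_square[OF A])
      fix k assume "k \<in> A"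
      then have "(u * \<sigma>)\<^sup>2 * (w k)\<^sup>2 \<le> (u * \<sigma>)\<^sup>2 * (4 / 5 * (\<Sum>k\<in>A. (w k)\<^sup>2))"
        using dom by (intro mult_left_mono) auto
      then show "?x k \<le> 4 / 5 * sum ?x A"
        unfolding sumx by (simp add: S2_def power_mult_distrib mult_ac)
    qed simp
    have "0 \<le> sum ?x A" by (intro sum_nonneg) simp
    then show "0 < (1 + sum ?x A / 4)\<^sup>2" by simp
  qed
  also have "\<dots> = (inverse (1 + S2 * u\<^sup>2 / 4))\<^sup>2"
    unfolding sumx by (simp add: power_inverse)
  finally show "cmod (char (distr M borel D) u) \<le> inverse (1 + S2 * u\<^sup>2 / 4)"
    by (rule power2_le_imp_le) (simp add: S2_def sum_nonneg)
qed

end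

section \<open>The statistics of one censored sample\<close>

lemma order_stat_eq_ascending: "order_stat n x j = ascending {1..n} x ! (j - 1)"
proof -
  have "mset (map x [1..<Suc n]) = image_mset x (mset_set {1..n})"
    by (metis mset_map mset_set_set distinct_upt set_upt atLeastLessThanSuc_atLeastAtMost)
  then show ?thesis
    unfolding order_stat_def ascending_def by (metis sorted_list_of_multiset_mset)
qed

definition norm_spacing :: "nat \<Rightarrow> real \<Rightarrow> (nat \<Rightarrow> real) \<Rightarrow> nat \<Rightarrow> real" where
  "norm_spacing n \<mu> x k = real (n - k) * (ascending {1..n} x ! k - (\<mu> # ascending {1..n} x) ! k)"

lemma order_stat_eq_sum_spacings:
  assumes "1 \<le> r" "r \<le> n"
  shows "order_stat n x r = \<mu> + (\<Sum>k<r. norm_spacing n \<mu> x k / real (n - k))"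
proof -
  let ?L = "\<mu> # ascending {1..n} x"
  have "(\<Sum>k<r. norm_spacing n \<mu> x k / real (n - k)) = (\<Sum>k<r. ?L ! Suc k - ?L ! k)"
    using assms by (intro sum.cong) (auto simp: norm_spacing_def)
  also have "\<dots> = ?L ! r - ?L ! 0" by (rule sum_lessThan_telescope)
  also have "?L ! r = order_stat n x r"
    using assms by (simp add: order_stat_eq_ascending nth_Cons')
  finally show ?thesis by simp
qed

text \<open>Summation by parts, as an induction on the upper rank \<open>s\<close>.\<close>
lemma V_stat_eq_sum_spacings:
  assumes r: "1 \<le> r" "r < s" "s \<le> n"
  shows "V_stat n r s x = (\<Sum>k=r..<s. norm_spacing n \<mu> x k)"
proof -
  have "Suc r \<le> s" using r by simp
  then show ?thesis using r(3)
  proof (induction s rule: dec_induct)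
    case base
    then show ?case
      using r(1) by (simp add: V_stat_def norm_spacing_def order_stat_eq_ascending nth_Cons' algebra_simps of_nat_diff)
  next
    case (step s)
    have "V_stat n r (Suc s) x = V_stat n r s x + norm_spacing n \<mu> x s"
    proof -
      have "(\<Sum>j = r + 1..s. order_stat n x j) = (\<Sum>j = r + 1..s - 1. order_stat n x j) + order_stat n x s"
        using step by (cases s) auto
      then show ?thesis
        using step r(1) by (simp add: V_stat_def norm_spacing_def order_stat_eq_ascending nth_Cons' algebra_simps of_nat_diff)
    qed
    then show ?case using step by simp
  qed
qed

lemma h_coef_eq_sum: "r \<le> n \<Longrightarrow> h_coef n r = (\<Sum>k<r. 1 / real (n - k))"
  unfolding h_coef_def
  by (rule sum.reindex_bij_witness[where i = "\<lambda>k. n - k" and j = "\<lambda>j. n - j"]) auto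

lemma g_coef_eq_sum: "r \<le> n \<Longrightarrow> g_coef n r = (\<Sum>k<r. (1 / real (n - k))\<^sup>2)"
  unfolding g_coef_def
  by (rule sum.reindex_bij_witness[where i = "\<lambda>k. n - k" and j = "\<lambda>j. n - j"]) (auto simp: power_divide)

text \<open>The coefficients of the spacings in \<open>\<delta> - \<theta>\<close>: the \<open>r\<close>-th order statistic contributes the
  first case, and \<open>V\<close> with its factor \<open>(1 - h) / (s - r)\<close> the second.\<close>
definition delta_weight :: "nat \<Rightarrow> nat \<Rightarrow> nat \<Rightarrow> nat \<Rightarrow> real" where
  "delta_weight n r s k = (if k < r then 1 / real (n - k) else (1 - h_coef n r) / (real s - real r))"

text \<open>The variance of \<open>\<delta>\<close>. In terms of \<open>g\<close> and \<open>h\<close> it is given by \<open>delta_var_eq\<close> below.\<close>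
definition delta_var :: "nat \<Rightarrow> nat \<Rightarrow> nat \<Rightarrow> real \<Rightarrow> real" where
  "delta_var n r s \<sigma> = \<sigma>\<^sup>2 * (\<Sum>k<s. (delta_weight n r s k)\<^sup>2)"

lemma sum_lessThan_split:
  fixes f :: "nat \<Rightarrow> real"
  shows "r \<le> s \<Longrightarrow> sum f {..<s} = sum f {..<r} + sum f {r..<s}"
  by (metis lessThan_atLeast0 sum.atLeastLessThan_concat zero_le)

text \<open>The weights add up to \<open>h + (1 - h) = 1\<close>, which is why \<open>\<delta>\<close> is unbiased for \<open>\<mu> + \<sigma>\<close> and the
  spacings appear centred.\<close>
lemma delta_stat_eq_sum_spacings:
  assumes r: "1 \<le> r" "r < s" "s \<le> n"
  shows "delta_stat n r s (order_stat n x r) (V_stat n r s x) - (\<mu> + \<sigma>)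
    = (\<Sum>k<s. delta_weight n r s k * (norm_spacing n \<mu> x k - \<sigma>))"
proof -
  let ?Y = "norm_spacing n \<mu> x" and ?w = "delta_weight n r s"
  have sr: "real s - real r > 0" using r by simp
  have "(\<Sum>k<s. ?w k * (?Y k - \<sigma>)) = (\<Sum>k<s. ?w k * ?Y k) - (\<Sum>k<s. ?w k) * \<sigma>"
    by (simp add: right_diff_distrib sum_subtractf sum_distrib_right)
  also have "(\<Sum>k<s. ?w k * ?Y k) = (\<Sum>k<r. ?Y k / real (n - k)) + (1 - h_coef n r) / (real s - real r) * (\<Sum>k=r..<s. ?Y k)"
    using r by (subst sum_lessThan_split[of r s]) (auto simp: delta_weight_def sum_distrib_left intro!: sum.cong)
  also have "(\<Sum>k<s. ?w k) = h_coef n r + (1 - h_coef n r) / (real s - real r) * (real s - real r)"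
    using r by (subst sum_lessThan_split[of r s]) (auto simp: delta_weight_def h_coef_eq_sum of_nat_diff)
  also have "\<dots> = 1" using sr by simp
  also have "(\<Sum>k<r. ?Y k / real (n - k)) = order_stat n x r - \<mu>"
    using order_stat_eq_sum_spacings[of r n x \<mu>] r by simp
  also have "(\<Sum>k=r..<s. ?Y k) = V_stat n r s x"
    using V_stat_eq_sum_spacings[OF r] by simp
  finally show ?thesis by (simp add: delta_stat_def)
qed

lemma delta_var_eq:
  assumes "1 \<le> r" "r < s" "s \<le> n"
  shows "delta_var n r s \<sigma> = \<sigma>\<^sup>2 * (g_coef n r + (1 - h_coef n r)\<^sup>2 / (real s - real r))"
proof -
  have "(\<Sum>k=r..<s. (delta_weight n r s k)\<^sup>2) = (real s - real r) * ((1 - h_coef n r) / (real s - real r))\<^sup>2"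
    using assms by (simp add: delta_weight_def of_nat_diff)
  also have "\<dots> = (1 - h_coef n r)\<^sup>2 / (real s - real r)"
  proof -
    have "real s - real r \<noteq> 0" using assms by simp
    then show ?thesis by (simp add: power_divide power2_eq_square)
  qed
  finally show ?thesis
    using assms unfolding delta_var_def by (subst sum_lessThan_split[of r s]) (auto simp: delta_weight_def g_coef_eq_sum)
qed

lemma delta_var_pos:
  assumes "0 < \<sigma>" "1 \<le> r" "r < s" "s \<le> n"
  shows "0 < delta_var n r s \<sigma>"
proof -
  have "(delta_weight n r s 0)\<^sup>2 \<le> (\<Sum>k<s. (delta_weight n r s k)\<^sup>2)"
    using assms by (intro member_le_sum) auto
  moreover have "0 < (delta_weight n r s 0)\<^sup>2" using assms by (simp add: delta_weight_def)
  ultimately have "0 < (\<Sum>k<s. (delta_weight n r s k)\<^sup>2)" by linarith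
  then show ?thesis using assms by (simp add: delta_var_def)
qed

lemma le_four_fifths_sum:
  fixes x :: "'b \<Rightarrow> real"
  assumes "finite A" "k \<in> A" "j \<in> A" "k \<noteq> j" "\<And>i. i \<in> A \<Longrightarrow> 0 \<le> x i" "x k \<le> 4 * x j"
  shows "x k \<le> 4 / 5 * sum x A"
proof -
  have "sum x {k, j} \<le> sum x A" using assms by (intro sum_mono2) auto
  then show ?thesis using assms by simp
qed

text \<open>A weight is never much larger than all the others. The weights with index at least \<open>r\<close> are
  equal, and there are at least two of them. Among the weights \<open>1 / (n - k)\<close> neighbours differ by a factor
  of at most 2, so their squares differ by a factor of at most 4. If \<open>r = 1\<close>, the weight
  \<open>1 / n\<close> has no neighbour of its kind, but the \<open>s - 1\<close> remaining weights have
  sum \<open>1 - 1 / n\<close>, so by the Cauchy-Schwarz bound their squares add up to at least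
  \<open>1 / n\<^sup>2\<close>.\<close>
lemma delta_weight_dominated:
  assumes r: "1 \<le> r" "r + 2 \<le> s" "s \<le> n" and k: "k < s"
  shows "(delta_weight n r s k)\<^sup>2 \<le> 4 / 5 * (\<Sum>k<s. (delta_weight n r s k)\<^sup>2)"
proof -
  let ?w = "delta_weight n r s"
  consider "r \<le> k" | "k + 1 < r" | "k + 1 = r" "2 \<le> r" | "k = 0" "r = 1"
    using k r by linarith
  then show ?thesis
  proof cases
    case 1
    \<comment> \<open>another index with the same weight\<close>
    define j where "j = (if k = r then r + 1 else r)"
    show ?thesis
      using 1 k r by (intro le_four_fifths_sum[where j = j]) (auto simp: j_def delta_weight_def)
  next
    case 2
    have "(1 / real (n - k))\<^sup>2 \<le> (1 / real (n - (r - 1)))\<^sup>2"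
      using 2 r by (intro power_mono divide_left_mono) auto
    then have "(?w k)\<^sup>2 \<le> (?w (r - 1))\<^sup>2"
      using 2 r by (simp add: delta_weight_def)
    then have "(?w k)\<^sup>2 \<le> 4 * (?w (r - 1))\<^sup>2"
      using zero_le_power2[of "?w (r - 1)"] by linarith
    then show ?thesis
      using 2 k r by (intro le_four_fifths_sum[where j = "r - 1"]) auto
  next
    case 3
    have "1 / real (n - k) \<le> 2 * (1 / real (n - (k - 1)))"
      using 3 r by (simp add: field_simps of_nat_diff)
    then have "(1 / real (n - k))\<^sup>2 \<le> (2 * (1 / real (n - (k - 1))))\<^sup>2"
      by (intro power_mono) auto
    moreover have "k < r" "k - 1 < r" using 3 by auto
    ultimately have "(?w k)\<^sup>2 \<le> 4 * (?w (k - 1))\<^sup>2"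
      by (simp add: delta_weight_def power_mult_distrib power_divide)
    then show ?thesis
      using 3 k r by (intro le_four_fifths_sum[where j = "k - 1"]) auto
  next
    case 4
    have n: "real n \<ge> 3" "real s \<le> real n" "real s \<ge> 3" using 4 r by auto
    have h: "h_coef n 1 = 1 / real n" using n h_coef_eq_sum[of 1 n] by simp
    have g: "g_coef n 1 = 1 / (real n)\<^sup>2" using n g_coef_eq_sum[of 1 n] by (simp add: power_divide)
    have "1 / (real n)\<^sup>2 \<le> (real n - 1) / (real n)\<^sup>2"
      using n by (intro divide_right_mono) auto
    also have "\<dots> = (1 - 1 / real n)\<^sup>2 / (real n - 1)"
      using n by (simp add: divide_simps power2_eq_square)
    also have "\<dots> \<le> (1 - 1 / real n)\<^sup>2 / (real s - 1)"
      using n by (intro divide_left_mono) auto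
    finally have "1 / (real n)\<^sup>2 \<le> (1 - h_coef n 1)\<^sup>2 / (real s - real 1)" by (simp only: h of_nat_1)
    moreover have "(\<Sum>k<s. (?w k)\<^sup>2) = g_coef n 1 + (1 - h_coef n 1)\<^sup>2 / (real s - real 1)"
      using delta_var_eq[of 1 s n 1] 4 r by (simp add: delta_var_def)
    moreover have "(?w k)\<^sup>2 = 1 / (real n)\<^sup>2" using 4 by (simp add: delta_weight_def power_divide)
    moreover have "0 \<le> 1 / (real n)\<^sup>2" by simp
    ultimately show ?thesis using g by linarith
  qed
qed

context prob_space begin

context
  fixes X :: "nat \<Rightarrow> 'a \<Rightarrow> real" and n r s :: nat and \<mu> \<sigma> :: real
  assumes \<sigma>: "0 < \<sigma>" and r: "1 \<le> r" "r < s" "s \<le> n"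
    and indep: "indep_vars (\<lambda>_. borel) X {1..n}"
    and X: "\<And>j. j \<in> {1..n} \<Longrightarrow> distributed M lborel (X j) (\<lambda>x. ennreal (two_param_exp_density \<mu> \<sigma> x))"
begin

lemma norm_spacing_iid:
  shows "indep_vars (\<lambda>_. borel) (\<lambda>k \<omega>. norm_spacing n \<mu> (\<lambda>j. X j \<omega>) k) {..<n}"
    and "k < n \<Longrightarrow> distributed M lborel (\<lambda>\<omega>. norm_spacing n \<mu> (\<lambda>j. X j \<omega>) k) (exponential_density (1 / \<sigma>))"
proof -
  have ne: "{1..n} \<noteq> {}" using r by simp
  note * = renyi_spacings[OF \<sigma> finite_atLeastAtMost ne indep X]
  show "indep_vars (\<lambda>_. borel) (\<lambda>k \<omega>. norm_spacing n \<mu> (\<lambda>j. X j \<omega>) k) {..<n}"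
    using *(1) by (simp add: norm_spacing_def)
  show "distributed M lborel (\<lambda>\<omega>. norm_spacing n \<mu> (\<lambda>j. X j \<omega>) k) (exponential_density (1 / \<sigma>))" if "k < n"
    using *(2)[of k] that by (simp add: norm_spacing_def)
qed

abbreviation "delta_err \<omega> \<equiv> delta_stat n r s (order_stat n (\<lambda>j. X j \<omega>) r) (V_stat n r s (\<lambda>j. X j \<omega>)) - (\<mu> + \<sigma>)"

lemma delta_error_tail:
  assumes "0 < e"
  shows "prob {\<omega> \<in> space M. e \<le> \<bar>delta_err \<omega>\<bar>} \<le> delta_var n r s \<sigma> / e\<^sup>2"
  unfolding delta_stat_eq_sum_spacings[OF r] delta_var_def
  using r by (intro weighted_exponential_sum_tail \<sigma> indep_vars_subset[OF norm_spacing_iid(1)] norm_spacing_iid(2) assms) auto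

lemma delta_error_char:
  assumes "r + 2 \<le> s"
  shows "cmod (char (distr M borel (\<lambda>\<omega>. delta_err \<omega>)) u) \<le> inverse (1 + delta_var n r s \<sigma> * u\<^sup>2 / 4)"
  unfolding delta_stat_eq_sum_spacings[OF r] delta_var_def
  using r by (intro weighted_exponential_sum_char \<sigma> indep_vars_subset[OF norm_spacing_iid(1)] norm_spacing_iid(2)
    delta_weight_dominated assms) auto

lemma V_stat_tail:
  assumes e: "0 < e"
  shows "prob {\<omega> \<in> space M. e \<le> \<bar>V_stat n r s (\<lambda>j. X j \<omega>) / ((real s - real r) * \<sigma>) - 1\<bar>}
    \<le> 1 / ((real s - real r) * e\<^sup>2)"
proof -
  define m where "m = real s - real r"
  have m: "0 < m" using r by (simp add: m_def)
  let ?D = "\<lambda>\<omega>. \<Sum>k\<in>{r..<s}. 1 * (norm_spacing n \<mu> (\<lambda>j. X j \<omega>) k - \<sigma>)"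
  have D: "?D \<omega> = V_stat n r s (\<lambda>j. X j \<omega>) - m * \<sigma>" for \<omega>
    using V_stat_eq_sum_spacings[OF r, of "\<lambda>j. X j \<omega>" \<mu>] r by (simp add: sum_subtractf m_def of_nat_diff)
  have "prob {\<omega> \<in> space M. e * (m * \<sigma>) \<le> \<bar>?D \<omega>\<bar>} \<le> \<sigma>\<^sup>2 * (\<Sum>k\<in>{r..<s}. 1\<^sup>2) / (e * (m * \<sigma>))\<^sup>2"
    using r e m \<sigma> by (intro weighted_exponential_sum_tail \<sigma> indep_vars_subset[OF norm_spacing_iid(1)] norm_spacing_iid(2)) auto
  also have "\<dots> = 1 / (m * e\<^sup>2)"
  proof -
    have "(\<Sum>k\<in>{r..<s}. 1\<^sup>2) = m" using r by (simp add: m_def of_nat_diff)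
    then show ?thesis using e m \<sigma> by (simp only:) (simp add: power2_eq_square)
  qed
  also have "{\<omega> \<in> space M. e * (m * \<sigma>) \<le> \<bar>?D \<omega>\<bar>}
      = {\<omega> \<in> space M. e \<le> \<bar>V_stat n r s (\<lambda>j. X j \<omega>) / (m * \<sigma>) - 1\<bar>}"
  proof -
    have "\<bar>v - m * \<sigma>\<bar> = \<bar>v / (m * \<sigma>) - 1\<bar> * (m * \<sigma>)" for v
    proof -
      have "v - m * \<sigma> = (v / (m * \<sigma>) - 1) * (m * \<sigma>)" using m \<sigma> by (simp add: field_simps)
      then show ?thesis using m \<sigma> by (simp add: abs_mult)
    qed
    moreover have "0 < m * \<sigma>" using m \<sigma> by simp
    ultimately show ?thesis unfolding D by (simp add: mult_le_cancel_right_pos)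
  qed
  finally show ?thesis by (simp add: m_def)
qed

end
end

lemma measurable_order_stat:
  assumes "\<And>j. j \<in> {1..n} \<Longrightarrow> X j \<in> borel_measurable M" "1 \<le> j" "j \<le> n"
  shows "(\<lambda>\<omega>. order_stat n (\<lambda>j. X j \<omega>) j) \<in> borel_measurable M"
  unfolding order_stat_eq_ascending using assms by (intro measurable_ascending_nth) auto

lemma measurable_V_stat:
  assumes X: "\<And>j. j \<in> {1..n} \<Longrightarrow> X j \<in> borel_measurable M" and r: "1 \<le> r" "r < s" "s \<le> n"
  shows "(\<lambda>\<omega>. V_stat n r s (\<lambda>j. X j \<omega>)) \<in> borel_measurable M"
  unfolding V_stat_def using r
  by (intro borel_measurable_add borel_measurable_times borel_measurable_const borel_measurable_sum measurable_order_stat X) auto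

section \<open>Quantiles of rescaled contrasts\<close>

text \<open>Here \<open>b\<close> and \<open>b'\<close> stand for ratios of an estimated to a true scale, and \<open>\<kappa>\<close>, \<open>\<kappa>'\<close> for
  the factors \<open>m / (m + 1)\<close> in the estimated variances.\<close>
lemma pooled_scale_bounds:
  fixes S T b b' \<kappa> \<kappa>' \<delta> :: real
  assumes \<delta>: "0 \<le> \<delta>" "\<delta> \<le> 1 / 4" and b: "\<bar>b - 1\<bar> \<le> \<delta>" "\<bar>b' - 1\<bar> \<le> \<delta>"
    and \<kappa>: "1 - \<delta> \<le> \<kappa>" "\<kappa> \<le> 1" "1 - \<delta> \<le> \<kappa>'" "\<kappa>' \<le> 1"
  defines "Q \<equiv> sqrt (S\<^sup>2 + T\<^sup>2)" and "R \<equiv> sqrt (b\<^sup>2 * S\<^sup>2 * \<kappa> + b'\<^sup>2 * T\<^sup>2 * \<kappa>')"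
  shows "(1 - 2 * \<delta>) * Q \<le> R" and "R \<le> (1 + \<delta>) * Q"
proof -
  have fac: "(1 - 2 * \<delta>)\<^sup>2 \<le> c\<^sup>2 * k \<and> c\<^sup>2 * k \<le> (1 + \<delta>)\<^sup>2"
    if c: "\<bar>c - 1\<bar> \<le> \<delta>" and k: "1 - \<delta> \<le> k" "k \<le> 1" for c k :: real
  proof
    have c2: "(1 - \<delta>)\<^sup>2 \<le> c\<^sup>2" "c\<^sup>2 \<le> (1 + \<delta>)\<^sup>2"
      using c \<delta> by (auto intro!: power_mono)
    have "(1 - 2 * \<delta>)\<^sup>2 \<le> ((1 - \<delta>)\<^sup>2)\<^sup>2"
      using \<delta> by (intro power_mono) (auto simp: power2_eq_square algebra_simps)
    also have "\<dots> = (1 - \<delta>)\<^sup>2 * ((1 - \<delta>) * (1 - \<delta>))" by (simp add: power2_eq_square)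
    also have "\<dots> \<le> (1 - \<delta>)\<^sup>2 * ((1 - \<delta>) * 1)"
      using \<delta> by (intro mult_left_mono) auto
    also have "\<dots> \<le> c\<^sup>2 * k"
      using c2 k \<delta> by (intro mult_mono) auto
    finally show "(1 - 2 * \<delta>)\<^sup>2 \<le> c\<^sup>2 * k" .
    have "c\<^sup>2 * k \<le> c\<^sup>2 * 1" using k by (intro mult_left_mono) auto
    with c2 show "c\<^sup>2 * k \<le> (1 + \<delta>)\<^sup>2" by simp
  qed
  have "(1 - 2 * \<delta>)\<^sup>2 * (S\<^sup>2 + T\<^sup>2) \<le> b\<^sup>2 * S\<^sup>2 * \<kappa> + b'\<^sup>2 * T\<^sup>2 * \<kappa>'"
    using mult_right_mono[OF fac[OF b(1) \<kappa>(1,2), THEN conjunct1], of "S\<^sup>2"]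
      mult_right_mono[OF fac[OF b(2) \<kappa>(3,4), THEN conjunct1], of "T\<^sup>2"]
    by (simp add: algebra_simps)
  then have "sqrt ((1 - 2 * \<delta>)\<^sup>2 * (S\<^sup>2 + T\<^sup>2)) \<le> R"
    unfolding R_def by (rule real_sqrt_le_mono)
  then show "(1 - 2 * \<delta>) * Q \<le> R"
    using \<delta> by (simp add: real_sqrt_mult Q_def)
  have "b\<^sup>2 * S\<^sup>2 * \<kappa> + b'\<^sup>2 * T\<^sup>2 * \<kappa>' \<le> (1 + \<delta>)\<^sup>2 * (S\<^sup>2 + T\<^sup>2)"
    using mult_right_mono[OF fac[OF b(1) \<kappa>(1,2), THEN conjunct2], of "S\<^sup>2"]
      mult_right_mono[OF fac[OF b(2) \<kappa>(3,4), THEN conjunct2], of "T\<^sup>2"]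
    by (simp add: algebra_simps)
  then have "R \<le> sqrt ((1 + \<delta>)\<^sup>2 * (S\<^sup>2 + T\<^sup>2))"
    unfolding R_def by (rule real_sqrt_le_mono)
  then show "R \<le> (1 + \<delta>) * Q"
    using \<delta> by (simp add: real_sqrt_mult Q_def)
qed

text \<open>The contrast \<open>d - d'\<close> of the errors of two copies, against the contrast that the fiducial
  pivots form, in which each error is multiplied by a ratio of scale estimates.\<close>
lemma rescaled_contrast_close:
  fixes S T d d' b b' c c' \<delta> K :: real
  assumes \<delta>: "0 \<le> \<delta>" "\<delta> \<le> 1 / 4"
    and b: "\<bar>b - 1\<bar> \<le> \<delta>" "\<bar>b' - 1\<bar> \<le> \<delta>" "\<bar>c - 1\<bar> \<le> \<delta>" "\<bar>c' - 1\<bar> \<le> \<delta>"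
    and d: "\<bar>d\<bar> \<le> K * S" "\<bar>d'\<bar> \<le> K * T" and K: "0 \<le> K"
  shows "\<bar>(b / c * d - b' / c' * d') - (d - d')\<bar> \<le> 8 * \<delta> * K * sqrt (S\<^sup>2 + T\<^sup>2)"
proof -
  have ratio: "\<bar>x / y - 1\<bar> \<le> 4 * \<delta>" if "\<bar>x - 1\<bar> \<le> \<delta>" "\<bar>y - 1\<bar> \<le> \<delta>" for x y :: real
  proof -
    have y: "1 / 2 \<le> y" using that \<delta> by linarith
    have "\<bar>x / y - 1\<bar> = \<bar>x - y\<bar> / y" using y by (simp add: field_simps abs_if)
    also have "\<dots> \<le> (2 * \<delta>) / (1 / 2)" using that y \<delta> by (intro frac_le) auto
    finally show ?thesis by simp
  qed
  have step: "\<bar>(x / y - 1) * e\<bar> \<le> 4 * \<delta> * (K * U)"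
    if "\<bar>x - 1\<bar> \<le> \<delta>" "\<bar>y - 1\<bar> \<le> \<delta>" "\<bar>e\<bar> \<le> K * U" for x y e U :: real
    unfolding abs_mult using ratio[OF that(1,2)] that(3) \<delta> by (intro mult_mono) auto
  have le: "S \<le> sqrt (S\<^sup>2 + T\<^sup>2)" "T \<le> sqrt (S\<^sup>2 + T\<^sup>2)"
    by (auto intro: real_le_rsqrt)
  have "(b / c * d - b' / c' * d') - (d - d') = (b / c - 1) * d - (b' / c' - 1) * d'"
    by (simp add: algebra_simps)
  then have "\<bar>(b / c * d - b' / c' * d') - (d - d')\<bar> \<le> 4 * \<delta> * (K * S) + 4 * \<delta> * (K * T)"
    using step[OF b(1,3) d(1)] step[OF b(2,4) d(2)] by linarith
  also have "\<dots> = (4 * \<delta> * K) * S + (4 * \<delta> * K) * T" by simp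
  also have "\<dots> \<le> (4 * \<delta> * K) * sqrt (S\<^sup>2 + T\<^sup>2) + (4 * \<delta> * K) * sqrt (S\<^sup>2 + T\<^sup>2)"
    using le \<delta> K by (intro add_mono mult_left_mono) auto
  finally show ?thesis by (simp add: mult_ac)
qed

text \<open>What the comparison of quantiles uses about the samples, at fixed sample sizes. \<open>D i\<close> is the
  error of \<open>\<delta>\<close> in sample \<open>i\<close> and \<open>B i\<close> the ratio of estimated to true scale; \<open>Ds\<close> and
  \<open>Bs\<close> are their fiducial copies. \<open>E i \<omega> \<omega>'\<close> is \<open>\<delta> - R\<^sub>\<theta>\<close>, with the data at \<open>\<omega>\<close> and the
  copy at \<open>\<omega>'\<close>: the product space \<open>M \<Otimes> M\<close> separates the two sources of randomness, so that
  conditioning on the data is fixing \<open>\<omega>\<close>. The identity for \<open>E\<close> excludes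
  \<open>Bs i \<omega>' = 0\<close>, where the divisions by zero on the two sides leave different default values.\<close>
locale fiducial_contrasts = prob_space M for M :: "'a measure" +
  fixes I :: "'i set" and D B Ds Bs :: "'i \<Rightarrow> 'a \<Rightarrow> real" and E :: "'i \<Rightarrow> 'a \<Rightarrow> 'a \<Rightarrow> real"
    and S \<kappa> :: "'i \<Rightarrow> real"
  assumes finI: "finite I" and cardI: "2 \<le> card I"
    and S_pos: "\<And>i. i \<in> I \<Longrightarrow> 0 < S i"
    and D_meas: "\<And>i. i \<in> I \<Longrightarrow> D i \<in> borel_measurable M"
    and B_meas: "\<And>i. i \<in> I \<Longrightarrow> B i \<in> borel_measurable M"
    and Ds_meas: "\<And>i. i \<in> I \<Longrightarrow> Ds i \<in> borel_measurable M"
    and Bs_meas: "\<And>i. i \<in> I \<Longrightarrow> Bs i \<in> borel_measurable M"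
    and E_meas: "\<And>i. i \<in> I \<Longrightarrow> case_prod (E i) \<in> borel_measurable (M \<Otimes>\<^sub>M M)"
    and E_eq: "\<And>i \<omega> \<omega>'. i \<in> I \<Longrightarrow> Bs i \<omega>' \<noteq> 0 \<Longrightarrow> E i \<omega> \<omega>' = B i \<omega> / Bs i \<omega>' * Ds i \<omega>'"
    and concentration: "\<And>i l a b. i \<in> I \<Longrightarrow> l \<in> I \<Longrightarrow> i \<noteq> l \<Longrightarrow> a \<le> b \<Longrightarrow>
      prob {\<omega> \<in> space M. D i \<omega> - D l \<omega> \<in> {a..b}} \<le> (b - a) / sqrt ((S i)\<^sup>2 + (S l)\<^sup>2)"
    and same_law: "\<And>y. prob {\<omega> \<in> space M. \<forall>i\<in>I. \<forall>l\<in>I. i \<noteq> l \<longrightarrow>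
        \<bar>Ds i \<omega> - Ds l \<omega>\<bar> \<le> y * sqrt ((S i)\<^sup>2 + (S l)\<^sup>2)}
      = prob {\<omega> \<in> space M. \<forall>i\<in>I. \<forall>l\<in>I. i \<noteq> l \<longrightarrow>
        \<bar>D i \<omega> - D l \<omega>\<bar> \<le> y * sqrt ((S i)\<^sup>2 + (S l)\<^sup>2)}"
begin

definition true_sd :: "'i \<Rightarrow> 'i \<Rightarrow> real" where "true_sd i l = sqrt ((S i)\<^sup>2 + (S l)\<^sup>2)"

text \<open>The plug-in estimate of \<open>true_sd\<close>; in the application \<open>\<kappa> i\<close> is
  \<open>m / (m + 1)\<close>, and the value is the square root of \<open>F\<^sub>i\<^sub>l\<close>.\<close>
definition est_sd :: "'i \<Rightarrow> 'i \<Rightarrow> 'a \<Rightarrow> real" where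
  "est_sd i l \<omega> = sqrt ((B i \<omega>)\<^sup>2 * (S i)\<^sup>2 * \<kappa> i + (B l \<omega>)\<^sup>2 * (S l)\<^sup>2 * \<kappa> l)"

definition fid_max :: "'a \<Rightarrow> 'a \<Rightarrow> real" where
  "fid_max \<omega> \<omega>' = Max {\<bar>(E i \<omega> \<omega>' - E l \<omega> \<omega>') / est_sd i l \<omega>\<bar> | i l. i \<in> I \<and> l \<in> I \<and> i \<noteq> l}"

text \<open>An infimum over uncountably many values; it is a measurable function of the data because
  \<open>crit_value_le_iff\<close> turns its sublevel sets into level sets of a partial integral over the
  product space.\<close>
definition crit_value :: "real \<Rightarrow> 'a \<Rightarrow> real" where
  "crit_value \<alpha> \<omega> = Inf {y. 1 - \<alpha> \<le> prob {\<omega>' \<in> space M. fid_max \<omega> \<omega>' \<le> y}}"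

definition contrasts_le :: "('i \<Rightarrow> 'a \<Rightarrow> real) \<Rightarrow> real \<Rightarrow> 'a set" where
  "contrasts_le Z y = {\<omega> \<in> space M. \<forall>i\<in>I. \<forall>l\<in>I. i \<noteq> l \<longrightarrow> \<bar>Z i \<omega> - Z l \<omega>\<bar> \<le> y * true_sd i l}"

abbreviation "pairs \<equiv> {(i, l). i \<in> I \<and> l \<in> I \<and> i \<noteq> l}"

lemma pairs: "finite pairs" "pairs \<noteq> {}" "card pairs \<le> (card I)\<^sup>2"
proof -
  have sub: "pairs \<subseteq> I \<times> I" by auto
  then show "finite pairs" using finI by (meson finite_SigmaI finite_subset)
  show "card pairs \<le> (card I)\<^sup>2"
    using card_mono[OF _ sub] finI by (simp add: card_cartesian_product power2_eq_square)
  obtain i where i: "i \<in> I" using cardI by (cases "I = {}") auto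
  have "I \<noteq> {i}" using cardI by auto
  with i obtain l where "l \<in> I" "l \<noteq> i" by auto
  with i show "pairs \<noteq> {}" by auto
qed

lemma true_sd_pos: "i \<in> I \<Longrightarrow> 0 < true_sd i l"
  using S_pos[of i] by (simp add: true_sd_def add_pos_nonneg)

lemma fid_max_le_iff: "fid_max \<omega> \<omega>' \<le> y \<longleftrightarrow> (\<forall>i\<in>I. \<forall>l\<in>I. i \<noteq> l \<longrightarrow> \<bar>(E i \<omega> \<omega>' - E l \<omega> \<omega>') / est_sd i l \<omega>\<bar> \<le> y)"
proof -
  have eq: "{\<bar>(E i \<omega> \<omega>' - E l \<omega> \<omega>') / est_sd i l \<omega>\<bar> | i l. i \<in> I \<and> l \<in> I \<and> i \<noteq> l}
    = (\<lambda>(i, l). \<bar>(E i \<omega> \<omega>' - E l \<omega> \<omega>') / est_sd i l \<omega>\<bar>) ` pairs"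
    by auto
  show ?thesis
    unfolding fid_max_def eq using pairs by (subst Max_le_iff) auto
qed

lemma fid_max_nonneg: "0 \<le> fid_max \<omega> \<omega>'"
proof -
  obtain i l where "i \<in> I" "l \<in> I" "i \<noteq> l" using pairs(2) by auto
  then have "\<bar>(E i \<omega> \<omega>' - E l \<omega> \<omega>') / est_sd i l \<omega>\<bar> \<le> fid_max \<omega> \<omega>'"
    using fid_max_le_iff[of \<omega> \<omega>' "fid_max \<omega> \<omega>'"] by auto
  then show ?thesis by (meson abs_ge_zero order_trans)
qed

lemma est_sd_meas: "i \<in> I \<Longrightarrow> l \<in> I \<Longrightarrow> est_sd i l \<in> borel_measurable M"
  unfolding est_sd_def using B_meas[of i] B_meas[of l] by measurable

lemma fid_max_le_meas: "{z \<in> space (M \<Otimes>\<^sub>M M). fid_max (fst z) (snd z) \<le> y} \<in> sets (M \<Otimes>\<^sub>M M)"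
  unfolding fid_max_le_iff
proof (intro sets.sets_Collect_finite_All finI)
  fix i l assume il: "i \<in> I" "l \<in> I"
  have [measurable]: "(\<lambda>z. E i (fst z) (snd z)) \<in> borel_measurable (M \<Otimes>\<^sub>M M)"
    "(\<lambda>z. E l (fst z) (snd z)) \<in> borel_measurable (M \<Otimes>\<^sub>M M)"
    using E_meas[OF il(1)] E_meas[OF il(2)] by (simp_all add: case_prod_beta')
  have [measurable]: "est_sd i l \<in> borel_measurable M" using il by (rule est_sd_meas)
  show "{z \<in> space (M \<Otimes>\<^sub>M M). i \<noteq> l \<longrightarrow>
      \<bar>(E i (fst z) (snd z) - E l (fst z) (snd z)) / est_sd i l (fst z)\<bar> \<le> y} \<in> sets (M \<Otimes>\<^sub>M M)"
    by measurable
qed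

lemma fid_max_le_section_meas: "\<omega> \<in> space M \<Longrightarrow> {\<omega>' \<in> space M. fid_max \<omega> \<omega>' \<le> y} \<in> sets M"
  using sets_Pair1[OF fid_max_le_meas, of \<omega> y] by (simp add: vimage_def space_pair_measure)

lemma prob_fid_max_le_meas: "(\<lambda>\<omega>. prob {\<omega>' \<in> space M. fid_max \<omega> \<omega>' \<le> y}) \<in> borel_measurable M"
proof -
  interpret pair_sigma_finite M M ..
  have "(\<lambda>\<omega>. emeasure M (Pair \<omega> -` {z \<in> space (M \<Otimes>\<^sub>M M). fid_max (fst z) (snd z) \<le> y})) \<in> borel_measurable M"
    by (rule measurable_emeasure_Pair1[OF fid_max_le_meas])
  then have "(\<lambda>\<omega>. measure M (Pair \<omega> -` {z \<in> space (M \<Otimes>\<^sub>M M). fid_max (fst z) (snd z) \<le> y})) \<in> borel_measurable M"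
    unfolding measure_def by measurable
  then show ?thesis
  proof (rule measurable_cong[THEN iffD1, rotated])
    fix \<omega> assume "\<omega> \<in> space M"
    then have "Pair \<omega> -` {z \<in> space (M \<Otimes>\<^sub>M M). fid_max (fst z) (snd z) \<le> y} = {\<omega>' \<in> space M. fid_max \<omega> \<omega>' \<le> y}"
      by (auto simp: space_pair_measure)
    then show "measure M (Pair \<omega> -` {z \<in> space (M \<Otimes>\<^sub>M M). fid_max (fst z) (snd z) \<le> y})
      = prob {\<omega>' \<in> space M. fid_max \<omega> \<omega>' \<le> y}" by simp
  qed
qed

lemma fid_max_rv: "\<omega> \<in> space M \<Longrightarrow> fid_max \<omega> \<in> borel_measurable M"
  by (rule borel_measurable_iff_le[THEN iffD2]) (auto intro: fid_max_le_section_meas)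

text \<open>The infimum is attained, because distribution functions are continuous from the right.\<close>
lemma crit_value_le_iff:
  assumes \<alpha>: "0 < \<alpha>" "\<alpha> < 1" and \<omega>: "\<omega> \<in> space M"
  shows "crit_value \<alpha> \<omega> \<le> y \<longleftrightarrow> 1 - \<alpha> \<le> prob {\<omega>' \<in> space M. fid_max \<omega> \<omega>' \<le> y}"
proof -
  define L where "L = distr M borel (fid_max \<omega>)"
  interpret L: real_distribution L
    unfolding L_def using fid_max_rv[OF \<omega>] by simp
  have cdf: "cdf L y = prob {\<omega>' \<in> space M. fid_max \<omega> \<omega>' \<le> y}" for y
    unfolding cdf_def L_def using fid_max_rv[OF \<omega>]
    by (subst measure_distr) (auto intro!: arg_cong[where f = prob])
  let ?A = "{y. 1 - \<alpha> \<le> cdf L y}"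
  have lb: "0 \<le> y" if "y \<in> ?A" for y
  proof (rule ccontr)
    assume "\<not> 0 \<le> y"
    then have empty: "{\<omega>' \<in> space M. fid_max \<omega> \<omega>' \<le> y} = {}"
      using fid_max_nonneg[of \<omega>] by (auto dest: order_trans)
    have "cdf L y = 0" unfolding cdf empty by simp
    then show False using that \<alpha> by simp
  qed
  then have bdd: "bdd_below ?A" by (rule bdd_belowI)
  have "eventually (\<lambda>y. 1 - \<alpha> < cdf L y) at_top"
    using L.cdf_lim_at_top_prob \<alpha> by (intro order_tendstoD(1)) auto
  then obtain y0 where "1 - \<alpha> < cdf L y0" by (auto simp: eventually_at_top_linorder)
  then have ne: "?A \<noteq> {}" by (auto intro: less_imp_le)
  have crit: "crit_value \<alpha> \<omega> = Inf ?A" by (simp add: crit_value_def cdf)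
  have "1 - \<alpha> \<le> cdf L (Inf ?A)"
  proof (rule tendsto_lowerbound)
    show "(cdf L \<longlongrightarrow> cdf L (Inf ?A)) (at_right (Inf ?A))"
      using L.cdf_is_right_cont[of "Inf ?A"] by (simp add: continuous_within)
    show "\<forall>\<^sub>F y in at_right (Inf ?A). 1 - \<alpha> \<le> cdf L y"
      unfolding eventually_at_right_field
    proof (intro exI[of _ "Inf ?A + 1"] conjI allI impI)
      fix y assume "y > Inf ?A"
      then obtain x where "x \<in> ?A" "x < y" using cInf_lessD[OF ne] by auto
      then show "1 - \<alpha> \<le> cdf L y" using L.cdf_nondecreasing[of x y] by auto
    qed simp
  qed simp
  then have "crit_value \<alpha> \<omega> \<le> y \<Longrightarrow> 1 - \<alpha> \<le> cdf L y"
    using L.cdf_nondecreasing[of "Inf ?A" y] by (simp add: crit)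
  moreover have "1 - \<alpha> \<le> cdf L y \<Longrightarrow> crit_value \<alpha> \<omega> \<le> y"
    unfolding crit using bdd by (intro cInf_lower) auto
  ultimately show ?thesis by (auto simp: cdf)
qed

lemma crit_value_meas:
  assumes "0 < \<alpha>" "\<alpha> < 1"
  shows "crit_value \<alpha> \<in> borel_measurable M"
proof (rule borel_measurable_iff_le[THEN iffD2], intro allI)
  fix y
  have "{\<omega> \<in> space M. crit_value \<alpha> \<omega> \<le> y} = {\<omega> \<in> space M. 1 - \<alpha> \<le> prob {\<omega>' \<in> space M. fid_max \<omega> \<omega>' \<le> y}}"
    using crit_value_le_iff[OF assms] by auto
  also have "\<dots> \<in> sets M" using prob_fid_max_le_meas[of y] by measurable
  finally show "{\<omega> \<in> space M. crit_value \<alpha> \<omega> \<le> y} \<in> sets M" .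
qed

lemma contrasts_le_meas:
  assumes "\<And>i. i \<in> I \<Longrightarrow> Z i \<in> borel_measurable M"
  shows "contrasts_le Z y \<in> sets M"
  unfolding contrasts_le_def
proof (intro sets.sets_Collect_finite_All finI)
  fix i l assume "i \<in> I" "l \<in> I"
  then have [measurable]: "Z i \<in> borel_measurable M" "Z l \<in> borel_measurable M" using assms by auto
  show "{\<omega> \<in> space M. i \<noteq> l \<longrightarrow> \<bar>Z i \<omega> - Z l \<omega>\<bar> \<le> y * true_sd i l} \<in> sets M" by measurable
qed

abbreviation data_cdf :: "real \<Rightarrow> real" where "data_cdf y \<equiv> prob (contrasts_le D y)"

lemma contrasts_le_mono:
  assumes "y \<le> y'"
  shows "contrasts_le Z y \<subseteq> contrasts_le Z y'"
proof -
  have "y * true_sd i l \<le> y' * true_sd i l" if "i \<in> I" for i l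
    using assms true_sd_pos[OF that, of l] by (intro mult_right_mono) auto
  then show ?thesis unfolding contrasts_le_def by (blast intro: order_trans)
qed

lemma data_cdf_mono: "y \<le> y' \<Longrightarrow> data_cdf y \<le> data_cdf y'"
  using contrasts_le_mono contrasts_le_meas[OF D_meas] by (intro finite_measure_mono) auto

text \<open>A pair whose contrast passes from at most \<open>y\<close> to at most \<open>y'\<close> true standard deviations lies
  in one of two intervals of length \<open>y' - y\<close> in that unit; the constant counts these intervals
  over all pairs.\<close>
lemma data_cdf_lipschitz:
  assumes "y \<le> y'"
  shows "data_cdf y' \<le> data_cdf y + 2 * (real (card I))\<^sup>2 * (y' - y)"
proof -
  let ?U = "\<lambda>(i, l). {\<omega> \<in> space M. D i \<omega> - D l \<omega> \<in> {y * true_sd i l..y' * true_sd i l}}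
      \<union> {\<omega> \<in> space M. D i \<omega> - D l \<omega> \<in> {- (y' * true_sd i l)..- (y * true_sd i l)}}"
  have U: "?U p \<in> sets M" "prob (?U p) \<le> 2 * (y' - y)" if pairs_p: "p \<in> pairs" for p
  proof -
    obtain i l where p: "p = (i, l)" "i \<in> I" "l \<in> I" "i \<noteq> l" using pairs_p by auto
    have [measurable]: "D i \<in> borel_measurable M" "D l \<in> borel_measurable M" using D_meas p by auto
    have q: "0 < true_sd i l" using true_sd_pos p by auto
    show "?U p \<in> sets M" unfolding p by simp
    have le: "y * true_sd i l \<le> y' * true_sd i l" using assms q by simp
    have "prob (?U p) \<le> prob {\<omega> \<in> space M. D i \<omega> - D l \<omega> \<in> {y * true_sd i l..y' * true_sd i l}}
      + prob {\<omega> \<in> space M. D i \<omega> - D l \<omega> \<in> {- (y' * true_sd i l)..- (y * true_sd i l)}}"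
      unfolding p by (simp only: prod.case, intro measure_Un_le) simp_all
    also have "\<dots> \<le> (y' * true_sd i l - y * true_sd i l) / true_sd i l + (- (y * true_sd i l) - - (y' * true_sd i l)) / true_sd i l"
      using le unfolding true_sd_def by (intro add_mono concentration[OF p(2-4)]) simp_all
    also have "\<dots> = 2 * (y' - y)" using q by (simp add: field_simps)
    finally show "prob (?U p) \<le> 2 * (y' - y)" .
  qed
  have "contrasts_le D y' \<subseteq> contrasts_le D y \<union> (\<Union>p\<in>pairs. ?U p)"
  proof
    fix \<omega> assume w: "\<omega> \<in> contrasts_le D y'"
    show "\<omega> \<in> contrasts_le D y \<union> (\<Union>p\<in>pairs. ?U p)"
    proof (cases "\<omega> \<in> contrasts_le D y")
      case False
      then obtain i l where p: "i \<in> I" "l \<in> I" "i \<noteq> l" "\<not> \<bar>D i \<omega> - D l \<omega>\<bar> \<le> y * true_sd i l"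
        using w by (auto simp: contrasts_le_def)
      then have "\<bar>D i \<omega> - D l \<omega>\<bar> \<le> y' * true_sd i l" "\<omega> \<in> space M" using w by (auto simp: contrasts_le_def)
      with p have "\<omega> \<in> ?U (i, l)" by (auto simp: abs_if split: if_splits)
      with p show ?thesis by blast
    qed simp
  qed
  then have "data_cdf y' \<le> prob (contrasts_le D y \<union> (\<Union>p\<in>pairs. ?U p))"
    using U(1) pairs(1) contrasts_le_meas[OF D_meas, where y = y] by (intro finite_measure_mono sets.Un sets.finite_UN) auto
  also have "\<dots> \<le> data_cdf y + prob (\<Union>p\<in>pairs. ?U p)"
    using U(1) pairs(1) contrasts_le_meas[OF D_meas, where y = y] by (intro measure_Un_le sets.finite_UN) auto
  also have "prob (\<Union>p\<in>pairs. ?U p) \<le> (\<Sum>p\<in>pairs. prob (?U p))"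
    using U(1) pairs(1) by (intro measure_UNION_le) auto
  also have "\<dots> \<le> (\<Sum>p\<in>pairs. 2 * (y' - y))" by (intro sum_mono U(2))
  also have "\<dots> = real (card pairs) * (2 * (y' - y))" by simp
  also have "\<dots> \<le> (real (card I))\<^sup>2 * (2 * (y' - y))"
    using assms pairs(3) by (intro mult_right_mono) (auto simp flip: of_nat_power)
  finally show ?thesis by (simp add: algebra_simps)
qed

lemma contrasts_le_negative: "y < 0 \<Longrightarrow> contrasts_le Z y = {}"
proof -
  assume y: "y < 0"
  obtain i l where p: "i \<in> I" "l \<in> I" "i \<noteq> l" using pairs(2) by auto
  then have "y * true_sd i l < 0" using y true_sd_pos by (simp add: mult_neg_pos)
  then have "\<not> \<bar>d\<bar> \<le> y * true_sd i l" for d by linarith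
  then show ?thesis using p unfolding contrasts_le_def by blast
qed

lemma data_cdf_zero: "data_cdf 0 = 0"
proof -
  have "data_cdf 0 \<le> 0 + e" if "0 < e" for e
  proof -
    define x where "x = e / (2 * (real (card I))\<^sup>2)"
    have x: "0 < x" "2 * (real (card I))\<^sup>2 * x = e" using that cardI by (auto simp: x_def)
    show ?thesis using data_cdf_lipschitz[of "- x" 0] contrasts_le_negative[of "- x" D] x by simp
  qed
  then have "data_cdf 0 \<le> 0" by (rule field_le_epsilon)
  then show ?thesis by (simp add: measure_le_0_iff)
qed

lemma data_cdf_attains:
  assumes "0 \<le> p" "p \<le> data_cdf K" "0 \<le> K"
  obtains y where "0 \<le> y" "y \<le> K" "data_cdf y = p"
proof -
  have "(2 * (real (card I))\<^sup>2)-lipschitz_on {0..K} data_cdf"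
  proof (rule lipschitz_onI)
    show "dist (data_cdf x) (data_cdf y) \<le> 2 * (real (card I))\<^sup>2 * dist x y" for x y
      using data_cdf_lipschitz[of x y] data_cdf_lipschitz[of y x] data_cdf_mono[of x y] data_cdf_mono[of y x]
      by (cases "x \<le> y") (auto simp: dist_real_def abs_if)
  qed simp
  then have "continuous_on {0..K} data_cdf" by (rule lipschitz_on_continuous_on)
  then show ?thesis using IVT'[of data_cdf 0 p K] assms data_cdf_zero that by auto
qed

text \<open>The quantitative form of the result. Outside the events \<open>bad_data\<close> and \<open>bad_copy\<close> below, of
  probability at most \<open>\<epsilon>\<close>, the scale ratios are \<open>\<delta>\<close>-close to 1 and errors are at most \<open>K\<close> standard
  deviations. There the fiducial statistic and the maximal standardised contrast of the copies
  determine each other up to the factors \<open>1 - 2 \<delta>\<close>, \<open>1 + \<delta>\<close> and the shift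
  \<open>8 \<delta> K\<close>. For data outside \<open>bad_data\<close>, the critical value therefore lies between \<open>z\<close> obtained from
  a point \<open>y\<close> where \<open>data_cdf\<close> is \<open>1 - \<alpha> - 2 \<epsilon>\<close> and \<open>z\<close> obtained from a point where it
  is \<open>1 - \<alpha> + \<epsilon>\<close>. The margins differ because the lower bound needs a probability strictly
  below \<open>1 - \<alpha>\<close>. Applying the same comparison to the data and the Lipschitz bound costs at
  most another \<open>\<epsilon>\<close> each.\<close>
lemma coverage_bound:
  assumes \<alpha>: "0 < \<alpha>" "\<alpha> < 1" and \<epsilon>: "0 < \<epsilon>" "2 * \<epsilon> \<le> \<alpha>" "2 * \<epsilon> \<le> 1 - \<alpha>"
    and \<delta>: "0 < \<delta>" "\<delta> \<le> 1 / 4" and K: "0 < K" and \<delta>K: "64 * (real (card I))\<^sup>2 * K * \<delta> \<le> \<epsilon>"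
    and \<kappa>: "\<And>i. i \<in> I \<Longrightarrow> 1 - \<delta> \<le> \<kappa> i" "\<And>i. i \<in> I \<Longrightarrow> \<kappa> i \<le> 1"
    and bad: "prob {\<omega> \<in> space M. \<exists>i\<in>I. \<delta> \<le> \<bar>B i \<omega> - 1\<bar> \<or> K * S i \<le> \<bar>D i \<omega>\<bar>} \<le> \<epsilon>"
    and bads: "prob {\<omega> \<in> space M. \<exists>i\<in>I. \<delta> \<le> \<bar>Bs i \<omega> - 1\<bar> \<or> K * S i \<le> \<bar>Ds i \<omega>\<bar>} \<le> \<epsilon>"
  shows "\<bar>prob {\<omega> \<in> space M. \<forall>i\<in>I. \<forall>l\<in>I. i \<noteq> l \<longrightarrow> \<bar>D i \<omega> - D l \<omega>\<bar> \<le> crit_value \<alpha> \<omega> * est_sd i l \<omega>}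
    - (1 - \<alpha>)\<bar> \<le> 4 * \<epsilon>"
proof -
  let ?L = "2 * (real (card I))\<^sup>2"
  define bad_data where "bad_data = {\<omega> \<in> space M. \<exists>i\<in>I. \<delta> \<le> \<bar>B i \<omega> - 1\<bar> \<or> K * S i \<le> \<bar>D i \<omega>\<bar>}"
  define bad_copy where "bad_copy = {\<omega> \<in> space M. \<exists>i\<in>I. \<delta> \<le> \<bar>Bs i \<omega> - 1\<bar> \<or> K * S i \<le> \<bar>Ds i \<omega>\<bar>}"
  define C where "C = {\<omega> \<in> space M. \<forall>i\<in>I. \<forall>l\<in>I. i \<noteq> l \<longrightarrow> \<bar>D i \<omega> - D l \<omega>\<bar> \<le> crit_value \<alpha> \<omega> * est_sd i l \<omega>}"
  have bad_data_meas: "bad_data \<in> sets M" unfolding bad_data_def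
  proof (intro sets.sets_Collect_finite_Ex finI)
    fix i assume "i \<in> I"
    note D_meas[OF this, measurable] B_meas[OF this, measurable]
    show "{\<omega> \<in> space M. \<delta> \<le> \<bar>B i \<omega> - 1\<bar> \<or> K * S i \<le> \<bar>D i \<omega>\<bar>} \<in> sets M" by measurable
  qed
  have bad_copy_meas: "bad_copy \<in> sets M" unfolding bad_copy_def
  proof (intro sets.sets_Collect_finite_Ex finI)
    fix i assume "i \<in> I"
    note Ds_meas[OF this, measurable] Bs_meas[OF this, measurable]
    show "{\<omega> \<in> space M. \<delta> \<le> \<bar>Bs i \<omega> - 1\<bar> \<or> K * S i \<le> \<bar>Ds i \<omega>\<bar>} \<in> sets M" by measurable
  qed
  have C_meas: "C \<in> sets M" unfolding C_def
  proof (intro sets.sets_Collect_finite_All finI)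
    fix i l assume il: "i \<in> I" "l \<in> I"
    note [measurable] = D_meas[OF il(1)] D_meas[OF il(2)] est_sd_meas[OF il] crit_value_meas[OF \<alpha>]
    show "{\<omega> \<in> space M. i \<noteq> l \<longrightarrow> \<bar>D i \<omega> - D l \<omega>\<bar> \<le> crit_value \<alpha> \<omega> * est_sd i l \<omega>} \<in> sets M" by measurable
  qed
  have D_le: "contrasts_le D y \<in> sets M" and Ds_le: "contrasts_le Ds y \<in> sets M" for y
    by (rule contrasts_le_meas, erule D_meas) (rule contrasts_le_meas, erule Ds_meas)
  have law: "prob (contrasts_le Ds y) = data_cdf y" for y
    using same_law by (simp add: contrasts_le_def true_sd_def)
  have good: "\<bar>B i \<omega> - 1\<bar> \<le> \<delta>" "\<bar>D i \<omega>\<bar> \<le> K * S i" if "\<omega> \<in> space M - bad_data" "i \<in> I" for \<omega> i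
  proof -
    have "\<not> (\<delta> \<le> \<bar>B i \<omega> - 1\<bar> \<or> K * S i \<le> \<bar>D i \<omega>\<bar>)" using that unfolding bad_data_def by blast
    then show "\<bar>B i \<omega> - 1\<bar> \<le> \<delta>" "\<bar>D i \<omega>\<bar> \<le> K * S i" by linarith+
  qed
  have goods: "\<bar>Bs i \<omega> - 1\<bar> \<le> \<delta>" "\<bar>Ds i \<omega>\<bar> \<le> K * S i" if "\<omega> \<in> space M - bad_copy" "i \<in> I" for \<omega> i
  proof -
    have "\<not> (\<delta> \<le> \<bar>Bs i \<omega> - 1\<bar> \<or> K * S i \<le> \<bar>Ds i \<omega>\<bar>)" using that unfolding bad_copy_def by blast
    then show "\<bar>Bs i \<omega> - 1\<bar> \<le> \<delta>" "\<bar>Ds i \<omega>\<bar> \<le> K * S i" by linarith+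
  qed
  have scale: "(1 - 2 * \<delta>) * true_sd i l \<le> est_sd i l \<omega>" "est_sd i l \<omega> \<le> (1 + \<delta>) * true_sd i l" "0 < est_sd i l \<omega>"
    if \<omega>: "\<omega> \<in> space M - bad_data" and il: "i \<in> I" "l \<in> I" for \<omega> i l
  proof -
    note b = good(1)[OF \<omega> il(1)] good(1)[OF \<omega> il(2)]
    show le: "(1 - 2 * \<delta>) * true_sd i l \<le> est_sd i l \<omega>" and "est_sd i l \<omega> \<le> (1 + \<delta>) * true_sd i l"
      unfolding true_sd_def est_sd_def
      by (rule pooled_scale_bounds[OF less_imp_le[OF \<delta>(1)] \<delta>(2) b \<kappa>(1,2)[OF il(1)] \<kappa>(1,2)[OF il(2)]])+
    have "0 < (1 - 2 * \<delta>) * true_sd i l" using true_sd_pos[OF il(1), of l] \<delta> by simp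
    then show "0 < est_sd i l \<omega>" using le by (rule less_le_trans)
  qed
  have close: "\<bar>(E i \<omega> \<omega>' - E l \<omega> \<omega>') - (Ds i \<omega>' - Ds l \<omega>')\<bar> \<le> 8 * \<delta> * K * true_sd i l"
    if \<omega>: "\<omega> \<in> space M - bad_data" and \<omega>': "\<omega>' \<in> space M - bad_copy" and il: "i \<in> I" "l \<in> I" for \<omega> \<omega>' i l
  proof -
    note b = good(1)[OF \<omega> il(1)] good(1)[OF \<omega> il(2)] goods(1)[OF \<omega>' il(1)] goods(1)[OF \<omega>' il(2)]
    note d = goods(2)[OF \<omega>' il(1)] goods(2)[OF \<omega>' il(2)]
    have "Bs i \<omega>' \<noteq> 0" "Bs l \<omega>' \<noteq> 0" using b(3,4) \<delta>(2) by auto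
    then show ?thesis
      unfolding true_sd_def E_eq[OF il(1) \<open>Bs i \<omega>' \<noteq> 0\<close>] E_eq[OF il(2) \<open>Bs l \<omega>' \<noteq> 0\<close>]
      by (intro rescaled_contrast_close less_imp_le[OF \<delta>(1)] \<delta>(2) b d less_imp_le[OF K])
  qed
  have two_K: "1 - \<epsilon> \<le> data_cdf (2 * K)"
  proof -
    have "space M - bad_data \<subseteq> contrasts_le D (2 * K)"
    proof
      fix \<omega> assume \<omega>: "\<omega> \<in> space M - bad_data"
      have "\<bar>D i \<omega> - D l \<omega>\<bar> \<le> 2 * K * true_sd i l" if il: "i \<in> I" "l \<in> I" for i l
      proof -
        have "\<bar>D i \<omega>\<bar> \<le> K * S i" "\<bar>D l \<omega>\<bar> \<le> K * S l" using good(2)[OF \<omega>] il by auto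
        moreover have "K * S i \<le> K * true_sd i l" "K * S l \<le> K * true_sd i l"
          using K unfolding true_sd_def by (auto intro!: mult_left_mono real_le_rsqrt)
        ultimately show ?thesis by linarith
      qed
      then show "\<omega> \<in> contrasts_le D (2 * K)" using \<omega> by (simp add: contrasts_le_def)
    qed
    then have "prob (space M - bad_data) \<le> data_cdf (2 * K)" using D_le by (intro finite_measure_mono) auto
    then show ?thesis using bad prob_compl[OF bad_data_meas] by (simp add: bad_data_def)
  qed
  have upper: "prob C \<le> 1 - \<alpha> + 3 * \<epsilon>"
  proof -
    \<comment> \<open>copies whose contrasts are within \<open>y\<close> have a fiducial statistic of at most \<open>z\<close>\<close>
    obtain y where y: "0 \<le> y" "y \<le> 2 * K" "data_cdf y = 1 - \<alpha> + \<epsilon>"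
      by (rule data_cdf_attains[of "1 - \<alpha> + \<epsilon>" "2 * K"]) (use \<alpha> \<epsilon> two_K K in auto)
    define z where "z = (y + 8 * \<delta> * K) / (1 - 2 * \<delta>)"
    have z: "0 \<le> z" using y \<delta> K by (simp add: z_def)
    have crit: "crit_value \<alpha> \<omega> \<le> z" if \<omega>: "\<omega> \<in> space M - bad_data" for \<omega>
    proof -
      have "contrasts_le Ds y - bad_copy \<subseteq> {\<omega>' \<in> space M. fid_max \<omega> \<omega>' \<le> z}"
      proof
        fix \<omega>' assume \<omega>': "\<omega>' \<in> contrasts_le Ds y - bad_copy"
        then have sp: "\<omega>' \<in> space M - bad_copy" by (auto simp: contrasts_le_def)
        have "\<bar>(E i \<omega> \<omega>' - E l \<omega> \<omega>') / est_sd i l \<omega>\<bar> \<le> z" if il: "i \<in> I" "l \<in> I" "i \<noteq> l" for i l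
        proof -
          have "\<bar>Ds i \<omega>' - Ds l \<omega>'\<bar> \<le> y * true_sd i l" using \<omega>' il by (auto simp: contrasts_le_def)
          then have "\<bar>E i \<omega> \<omega>' - E l \<omega> \<omega>'\<bar> \<le> y * true_sd i l + 8 * \<delta> * K * true_sd i l"
            using close[OF \<omega> sp il(1,2)] by linarith
          also have "\<dots> = z * ((1 - 2 * \<delta>) * true_sd i l)"
          proof -
            have "z * (1 - 2 * \<delta>) = y + 8 * \<delta> * K" using \<delta> by (simp add: z_def)
            then show ?thesis by (simp add: distrib_right flip: mult.assoc)
          qed
          also have "\<dots> \<le> z * est_sd i l \<omega>" using scale(1)[OF \<omega> il(1,2)] z by (rule mult_left_mono)
          finally show ?thesis using scale(3)[OF \<omega> il(1,2)] by (simp add: abs_divide divide_le_eq)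
        qed
        then show "\<omega>' \<in> {\<omega>' \<in> space M. fid_max \<omega> \<omega>' \<le> z}" using sp by (simp add: fid_max_le_iff)
      qed
      then have "prob (contrasts_le Ds y - bad_copy) \<le> prob {\<omega>' \<in> space M. fid_max \<omega> \<omega>' \<le> z}"
        using \<omega> by (intro finite_measure_mono fid_max_le_section_meas) auto
      moreover have "prob (contrasts_le Ds y) \<le> prob (contrasts_le Ds y - bad_copy) + prob bad_copy"
        using measure_Un_le[of "contrasts_le Ds y - bad_copy" M bad_copy] Ds_le[of y] bad_copy_meas
          finite_measure_mono[of "contrasts_le Ds y" "contrasts_le Ds y - bad_copy \<union> bad_copy"] by auto
      ultimately have "1 - \<alpha> \<le> prob {\<omega>' \<in> space M. fid_max \<omega> \<omega>' \<le> z}"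
        using law[of y] y(3) bads by (simp add: bad_copy_def)
      then show ?thesis using crit_value_le_iff[OF \<alpha>] \<omega> by simp
    qed
    have zle: "z * (1 + \<delta>) \<le> y + 32 * \<delta> * K"
    proof -
      have "1 + \<delta> \<le> (1 + 6 * \<delta>) * (1 - 2 * \<delta>)"
        using mult_left_mono[OF \<delta>(2), of "12 * \<delta>"] \<delta> by (simp add: algebra_simps)
      then have "(1 + \<delta>) / (1 - 2 * \<delta>) \<le> 1 + 6 * \<delta>" using \<delta> by (simp add: divide_le_eq)
      then have "(y + 8 * \<delta> * K) * ((1 + \<delta>) / (1 - 2 * \<delta>)) \<le> (y + 8 * \<delta> * K) * (1 + 6 * \<delta>)"
        using y \<delta> K by (intro mult_left_mono) auto
      also have "\<dots> = y + 8 * \<delta> * K + 6 * \<delta> * y + 48 * (\<delta> * K) * \<delta>" by (simp add: algebra_simps)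
      also have "\<dots> \<le> y + 8 * \<delta> * K + 6 * \<delta> * (2 * K) + 48 * (\<delta> * K) * (1 / 4)"
        using y \<delta> K by (intro add_mono mult_left_mono) auto
      finally show ?thesis by (simp add: z_def mult_ac)
    qed
    have "C \<subseteq> contrasts_le D (y + 32 * \<delta> * K) \<union> bad_data"
    proof
      fix \<omega> assume \<omega>: "\<omega> \<in> C"
      show "\<omega> \<in> contrasts_le D (y + 32 * \<delta> * K) \<union> bad_data"
      proof (cases "\<omega> \<in> bad_data")
        case False
        then have sp: "\<omega> \<in> space M - bad_data" using \<omega> by (simp add: C_def)
        have "\<omega> \<in> contrasts_le D (z * (1 + \<delta>))"
          unfolding contrasts_le_def
        proof (intro CollectI conjI ballI impI)
          show "\<omega> \<in> space M" using sp by simp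
          fix i l assume il: "i \<in> I" "l \<in> I" "i \<noteq> l"
          have "\<bar>D i \<omega> - D l \<omega>\<bar> \<le> crit_value \<alpha> \<omega> * est_sd i l \<omega>" using \<omega> il by (simp add: C_def)
          also have "\<dots> \<le> z * est_sd i l \<omega>" using crit[OF sp] scale(3)[OF sp il(1,2)] by (intro mult_right_mono) auto
          also have "\<dots> \<le> z * ((1 + \<delta>) * true_sd i l)" using scale(2)[OF sp il(1,2)] z by (rule mult_left_mono)
          finally show "\<bar>D i \<omega> - D l \<omega>\<bar> \<le> z * (1 + \<delta>) * true_sd i l" by simp
        qed
        then show ?thesis using contrasts_le_mono[OF zle] by auto
      qed simp
    qed
    then have "prob C \<le> data_cdf (y + 32 * \<delta> * K) + prob bad_data"
      using measure_Un_le[of "contrasts_le D (y + 32 * \<delta> * K)" M bad_data] D_le[of "y + 32 * \<delta> * K"] bad_data_meas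
        finite_measure_mono[of C "contrasts_le D (y + 32 * \<delta> * K) \<union> bad_data"] by auto
    moreover have "data_cdf (y + 32 * \<delta> * K) \<le> data_cdf y + ?L * (32 * \<delta> * K)"
      using data_cdf_lipschitz[of y "y + 32 * \<delta> * K"] \<delta> K by simp
    moreover have "?L * (32 * \<delta> * K) \<le> \<epsilon>" using \<delta>K by (simp add: mult_ac)
    ultimately show ?thesis using y(3) bad by (simp add: bad_data_def)
  qed
  have lower: "1 - \<alpha> - 4 * \<epsilon> \<le> prob C"
  proof -
    \<comment> \<open>here \<open>z\<close> may be negative; then no data satisfy the contrast bound at \<open>x\<close> below\<close>
    obtain y where y: "0 \<le> y" "y \<le> 2 * K" "data_cdf y = 1 - \<alpha> - 2 * \<epsilon>"
      by (rule data_cdf_attains[of "1 - \<alpha> - 2 * \<epsilon>" "2 * K"]) (use \<alpha> \<epsilon> two_K K in auto)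
    define z where "z = (y - 8 * \<delta> * K) / (1 + \<delta>)"
    have crit: "z \<le> crit_value \<alpha> \<omega>" if \<omega>: "\<omega> \<in> space M - bad_data" for \<omega>
    proof (rule ccontr)
      assume less: "\<not> z \<le> crit_value \<alpha> \<omega>"
      define x where "x = crit_value \<alpha> \<omega>"
      have x: "x < z" using less by (simp add: x_def)
      have ge: "1 - \<alpha> \<le> prob {\<omega>' \<in> space M. fid_max \<omega> \<omega>' \<le> x}"
        using crit_value_le_iff[OF \<alpha>, of \<omega> x] \<omega> by (simp add: x_def)
      have "{\<omega>' \<in> space M. fid_max \<omega> \<omega>' \<le> x} \<subseteq> contrasts_le Ds y \<union> bad_copy"
      proof
        fix \<omega>' assume \<omega>': "\<omega>' \<in> {\<omega>' \<in> space M. fid_max \<omega> \<omega>' \<le> x}"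
        show "\<omega>' \<in> contrasts_le Ds y \<union> bad_copy"
        proof (cases "\<omega>' \<in> bad_copy")
          case False
          then have sp: "\<omega>' \<in> space M - bad_copy" using \<omega>' by simp
          have x0: "0 \<le> x" using \<omega>' fid_max_nonneg[of \<omega> \<omega>'] by simp
          have "\<bar>Ds i \<omega>' - Ds l \<omega>'\<bar> \<le> y * true_sd i l" if il: "i \<in> I" "l \<in> I" "i \<noteq> l" for i l
          proof -
            have "\<bar>(E i \<omega> \<omega>' - E l \<omega> \<omega>') / est_sd i l \<omega>\<bar> \<le> x" using \<omega>' il by (simp add: fid_max_le_iff)
            then have "\<bar>E i \<omega> \<omega>' - E l \<omega> \<omega>'\<bar> \<le> x * est_sd i l \<omega>"
              using scale(3)[OF \<omega> il(1,2)] by (simp add: abs_divide divide_le_eq)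
            also have "\<dots> \<le> x * ((1 + \<delta>) * true_sd i l)"
              using scale(2)[OF \<omega> il(1,2)] x0 by (rule mult_left_mono)
            also have "\<dots> \<le> z * ((1 + \<delta>) * true_sd i l)"
              using x \<delta> true_sd_pos[OF il(1), of l] by (intro mult_right_mono) auto
            also have "\<dots> = y * true_sd i l - 8 * \<delta> * K * true_sd i l"
            proof -
              have "z * (1 + \<delta>) = y - 8 * \<delta> * K" using \<delta> by (simp add: z_def)
              then show ?thesis by (simp add: left_diff_distrib flip: mult.assoc)
            qed
            finally show ?thesis using close[OF \<omega> sp il(1,2)] by linarith
          qed
          then show ?thesis using sp by (simp add: contrasts_le_def)
        qed simp
      qed
      then have "prob {\<omega>' \<in> space M. fid_max \<omega> \<omega>' \<le> x} \<le> data_cdf y + prob bad_copy"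
        using measure_Un_le[of "contrasts_le Ds y" M bad_copy] Ds_le[of y] bad_copy_meas law[of y]
          finite_measure_mono[of "{\<omega>' \<in> space M. fid_max \<omega> \<omega>' \<le> x}" "contrasts_le Ds y \<union> bad_copy"] by auto
      then show False using ge y(3) bads \<epsilon> by (simp add: bad_copy_def)
    qed
    define x where "x = z * (1 - 2 * \<delta>)"
    have x: "x \<le> y" "y - 14 * \<delta> * K \<le> x"
    proof -
      define c where "c = (1 - 2 * \<delta>) / (1 + \<delta>)"
      have c: "c \<le> 1" "0 \<le> c" using \<delta> by (simp_all add: c_def)
      have "(1 - 3 * \<delta>) * (1 + \<delta>) \<le> 1 - 2 * \<delta>" by (simp add: algebra_simps)
      then have c3: "1 - 3 * \<delta> \<le> c" using \<delta> by (simp add: c_def le_divide_eq)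
      have "x = (y - 8 * \<delta> * K) * c" by (simp add: x_def z_def c_def)
      then have xc: "x = y - (y * (1 - c) + 8 * \<delta> * K * c)" by (simp add: algebra_simps)
      have "0 \<le> y * (1 - c)" "0 \<le> 8 * \<delta> * K * c" using y \<delta> K c by auto
      moreover have "y * (1 - c) \<le> (2 * K) * (3 * \<delta>)" using y \<delta> K c c3 by (intro mult_mono) auto
      moreover have "8 * \<delta> * K * c \<le> 8 * \<delta> * K * 1" using \<delta> K c by (intro mult_left_mono) auto
      ultimately show "x \<le> y" "y - 14 * \<delta> * K \<le> x" unfolding xc by (simp_all add: mult_ac)
    qed
    have "contrasts_le D x \<subseteq> C \<union> bad_data"
    proof
      fix \<omega> assume \<omega>: "\<omega> \<in> contrasts_le D x"
      show "\<omega> \<in> C \<union> bad_data"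
      proof (cases "\<omega> \<in> bad_data")
        case False
        then have sp: "\<omega> \<in> space M - bad_data" using \<omega> by (simp add: contrasts_le_def)
        have "0 \<le> x" using contrasts_le_negative[of x D] \<omega> by force
        then have z: "0 \<le> z" using \<delta> by (simp add: x_def zero_le_mult_iff)
        have "\<bar>D i \<omega> - D l \<omega>\<bar> \<le> crit_value \<alpha> \<omega> * est_sd i l \<omega>" if il: "i \<in> I" "l \<in> I" "i \<noteq> l" for i l
        proof -
          have "\<bar>D i \<omega> - D l \<omega>\<bar> \<le> z * ((1 - 2 * \<delta>) * true_sd i l)"
            using \<omega> il by (auto simp: contrasts_le_def x_def mult.assoc)
          also have "\<dots> \<le> z * est_sd i l \<omega>" using scale(1)[OF sp il(1,2)] z by (rule mult_left_mono)
          also have "\<dots> \<le> crit_value \<alpha> \<omega> * est_sd i l \<omega>"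
            using crit[OF sp] scale(3)[OF sp il(1,2)] by (intro mult_right_mono) auto
          finally show ?thesis .
        qed
        then show ?thesis using sp by (simp add: C_def)
      qed simp
    qed
    then have "data_cdf x \<le> prob C + prob bad_data"
      using measure_Un_le[of C M bad_data] C_meas bad_data_meas finite_measure_mono[of "contrasts_le D x" "C \<union> bad_data"] by auto
    moreover have "data_cdf y \<le> data_cdf x + ?L * (y - x)" using data_cdf_lipschitz[OF x(1)] .
    moreover have "?L * (y - x) \<le> ?L * (14 * \<delta> * K)" using x by (intro mult_left_mono) auto
    moreover have "?L * (14 * \<delta> * K) \<le> 64 * (real (card I))\<^sup>2 * K * \<delta>"
    proof -
      have "0 \<le> (real (card I))\<^sup>2 * (K * \<delta>)" using K \<delta> by simp
      then show ?thesis by (simp add: mult_ac)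
    qed
    moreover have "prob bad_data \<le> \<epsilon>" using bad by (simp add: bad_data_def)
    ultimately show ?thesis using \<delta>K y(3) by linarith
  qed
  show ?thesis
    using upper lower \<epsilon> unfolding C_def by (simp add: abs_le_iff)
qed

end

section \<open>Several censored samples and their fiducial copies\<close>

lemma order_stat_cong:
  assumes "\<And>j. j \<in> {1..n} \<Longrightarrow> x j = y j"
  shows "order_stat n x i = order_stat n y i"
proof -
  have "ascending {1..n} x = ascending {1..n} y" using assms by (rule ascending_cong)
  then show ?thesis by (simp add: order_stat_eq_ascending)
qed

lemma V_stat_cong:
  assumes "\<And>j. j \<in> {1..n} \<Longrightarrow> x j = y j"
  shows "V_stat n r s x = V_stat n r s y"
proof -
  have "order_stat n x i = order_stat n y i" for i using assms by (rule order_stat_cong)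
  then show ?thesis by (simp add: V_stat_def)
qed

lemma char_distr_uminus:
  assumes [measurable]: "Z \<in> borel_measurable M"
  shows "char (distr M borel (\<lambda>\<omega>. - Z \<omega>)) u = char (distr M borel Z) (- u)"
  by (simp add: char_def integral_distr)

text \<open>By independence the characteristic functions multiply, and the product of the two bounds is at
  most the bound for the sum of the variances.\<close>
lemma (in prob_space) indep_difference_concentration:
  assumes indep: "indep_var borel Z borel Z'" and ab: "a \<le> b"
    and v: "0 < v" "0 < v'"
    and char: "\<And>u. cmod (char (distr M borel Z) u) \<le> inverse (1 + v * u\<^sup>2 / 4)"
    and char': "\<And>u. cmod (char (distr M borel Z') u) \<le> inverse (1 + v' * u\<^sup>2 / 4)"
  shows "prob {\<omega> \<in> space M. Z \<omega> - Z' \<omega> \<in> {a..b}} \<le> (b - a) / sqrt (v + v')"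
proof -
  have Z: "Z \<in> borel_measurable M" and Z': "Z' \<in> borel_measurable M"
    using indep_var_rv1[OF indep] indep_var_rv2[OF indep] by auto
  define L where "L = distr M borel (\<lambda>\<omega>. Z \<omega> + - Z' \<omega>)"
  have Lm: "(\<lambda>\<omega>. Z \<omega> + - Z' \<omega>) \<in> borel_measurable M" using Z Z' by measurable
  interpret L: real_distribution L unfolding L_def using Lm by simp
  define c where "c = sqrt (v + v') / 2"
  have c: "0 < c" using v by (simp add: c_def)
  have indep': "indep_var borel Z borel (\<lambda>\<omega>. - Z' \<omega>)"
    using indep_var_compose[OF indep, of "\<lambda>x. x" borel uminus borel] by (simp add: comp_def)
  have "cmod (char L u) \<le> inverse (1 + (c * u)\<^sup>2)" for u
  proof -
    have "cmod (char L u) = cmod (char (distr M borel Z) u) * cmod (char (distr M borel Z') (- u))"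
      unfolding L_def char_distr_add[OF indep'] char_distr_uminus[OF Z'] norm_mult ..
    also have "\<dots> \<le> inverse (1 + v * u\<^sup>2 / 4) * inverse (1 + v' * u\<^sup>2 / 4)"
      using char[of u] char'[of "- u"] v by (intro mult_mono) auto
    also have "\<dots> = inverse ((1 + v * u\<^sup>2 / 4) * (1 + v' * u\<^sup>2 / 4))" by simp
    also have "\<dots> \<le> inverse (1 + (c * u)\<^sup>2)"
    proof (rule le_imp_inverse_le)
      have "0 \<le> (v * u\<^sup>2 / 4) * (v' * u\<^sup>2 / 4)" using v by simp
      moreover have "(c * u)\<^sup>2 = v * u\<^sup>2 / 4 + v' * u\<^sup>2 / 4"
        using v by (simp add: c_def power_mult_distrib power_divide field_simps)
      moreover have "(1 + x) * (1 + y) = 1 + (x + y) + x * y" for x y :: real by (simp add: algebra_simps)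
      ultimately show "1 + (c * u)\<^sup>2 \<le> (1 + v * u\<^sup>2 / 4) * (1 + v' * u\<^sup>2 / 4)" by simp
      show "0 < 1 + (c * u)\<^sup>2" by (simp add: add_pos_nonneg)
    qed
    finally show ?thesis .
  qed
  then have "measure L {a..b} \<le> (b - a) / (2 * c)"
    by (rule L.measure_Icc_le_of_char[OF c _ ab])
  moreover have "measure L {a..b} = prob {\<omega> \<in> space M. Z \<omega> - Z' \<omega> \<in> {a..b}}"
    unfolding L_def using Lm by (subst measure_distr) (auto intro!: arg_cong[where f = prob])
  ultimately show ?thesis by (simp add: c_def)
qed

text \<open>Independence of the whole array in the form of one sequence per sample; the singleton blocks
  serve to rename the index \<open>(i, j)\<close> to \<open>j\<close>.\<close>
lemma (in prob_space) indep_vars_slice: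
  assumes indep: "indep_vars (\<lambda>_. borel) (\<lambda>(i, j). X i j) (SIGMA i:A. J i)" and i: "i \<in> A"
  shows "indep_vars (\<lambda>_. borel) (X i) (J i)"
proof -
  have "indep_vars (\<lambda>j. PiM {(i, j)} (\<lambda>_. borel)) (\<lambda>j \<omega>. \<lambda>p\<in>{(i, j)}. (case p of (i, j) \<Rightarrow> X i j) \<omega>) (J i)"
    using i by (intro indep_vars_restrict[OF indep]) (auto simp: disjoint_family_on_def)
  then have "indep_vars (\<lambda>_. borel) (\<lambda>j \<omega>. (\<lambda>p\<in>{(i, j)}. (case p of (i, j) \<Rightarrow> X i j) \<omega>) (i, j)) (J i)"
    by (rule indep_vars_compose2) simp
  then show ?thesis by simp
qed

text \<open>The model at fixed sample sizes: everything but the final limit is a statement of this kind.\<close>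
locale censored_samples = prob_space M for M :: "'a measure" +
  fixes k :: nat and n r s :: "nat \<Rightarrow> nat" and \<mu> \<sigma> :: "nat \<Rightarrow> real"
    and X :: "nat \<Rightarrow> nat \<Rightarrow> 'a \<Rightarrow> real" and Xs Vs :: "nat \<Rightarrow> 'a \<Rightarrow> real"
    and Xr V :: "nat \<Rightarrow> 'a \<Rightarrow> real"
  assumes k: "2 \<le> k"
    and \<sigma>: "\<And>i. i \<in> {1..k} \<Longrightarrow> 0 < \<sigma> i"
    and ranks: "\<And>i. i \<in> {1..k} \<Longrightarrow> 1 \<le> r i" "\<And>i. i \<in> {1..k} \<Longrightarrow> r i < s i" "\<And>i. i \<in> {1..k} \<Longrightarrow> s i \<le> n i"
    and X_dist: "\<And>i j. i \<in> {1..k} \<Longrightarrow> j \<in> {1..n i} \<Longrightarrow>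
          distributed M lborel (X i j) (\<lambda>x. ennreal (two_param_exp_density (\<mu> i) (\<sigma> i) x))"
    and X_indep: "indep_vars (\<lambda>_. borel) (\<lambda>(i, j). X i j) (SIGMA i:{1..k}. {1..n i})"
    and Xr_eq: "\<And>i \<omega>. Xr i \<omega> = order_stat (n i) (\<lambda>j. X i j \<omega>) (r i)"
    and V_eq: "\<And>i \<omega>. V i \<omega> = V_stat (n i) (r i) (s i) (\<lambda>j. X i j \<omega>)"
    and copy_law:
          "distr M (PiM {1..k} (\<lambda>_. borel \<Otimes>\<^sub>M borel)) (\<lambda>\<omega>. \<lambda>i\<in>{1..k}. (Xs i \<omega>, Vs i \<omega>)) =
           distr M (PiM {1..k} (\<lambda>_. borel \<Otimes>\<^sub>M borel)) (\<lambda>\<omega>. \<lambda>i\<in>{1..k}. (Xr i \<omega>, V i \<omega>))"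
    and copy_meas: "(\<lambda>\<omega>. \<lambda>i\<in>{1..k}. (Xs i \<omega>, Vs i \<omega>)) \<in> measurable M (PiM {1..k} (\<lambda>_. borel \<Otimes>\<^sub>M borel))"
begin

definition m :: "nat \<Rightarrow> real" where "m i = real (s i) - real (r i)"

text \<open>The statistics are taken as functions of the values \<open>x\<close> and \<open>v\<close>, so that the data and the
  copies share one definition and an equality of laws transfers from the pairs \<open>(x, v)\<close>.\<close>
definition err :: "nat \<Rightarrow> real \<Rightarrow> real \<Rightarrow> real" where
  "err i x v = delta_stat (n i) (r i) (s i) x v - (\<mu> i + \<sigma> i)"

definition scl :: "nat \<Rightarrow> real \<Rightarrow> real" where "scl i v = v / (m i * \<sigma> i)"

definition sd :: "nat \<Rightarrow> real" where "sd i = sqrt (delta_var (n i) (r i) (s i) (\<sigma> i))"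

lemma m_pos: "i \<in> {1..k} \<Longrightarrow> 0 < m i"
  using ranks(2) by (simp add: m_def)

lemma sd_pos: "i \<in> {1..k} \<Longrightarrow> 0 < sd i"
  using delta_var_pos[of "\<sigma> i"] \<sigma> ranks by (simp add: sd_def)

lemma sd_square: "i \<in> {1..k} \<Longrightarrow> (sd i)\<^sup>2 = delta_var (n i) (r i) (s i) (\<sigma> i)"
  using delta_var_pos[of "\<sigma> i"] \<sigma> ranks by (simp add: sd_def less_imp_le)

lemma X_rv: "i \<in> {1..k} \<Longrightarrow> j \<in> {1..n i} \<Longrightarrow> X i j \<in> borel_measurable M"
  using distributed_measurable[OF X_dist] by simp

lemma Xr_meas: "i \<in> {1..k} \<Longrightarrow> Xr i \<in> borel_measurable M"
proof -
  assume i: "i \<in> {1..k}"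
  have "(\<lambda>\<omega>. order_stat (n i) (\<lambda>j. X i j \<omega>) (r i)) \<in> borel_measurable M"
    using ranks[OF i] by (intro measurable_order_stat X_rv i) auto
  then show ?thesis by (simp add: Xr_eq[abs_def])
qed

lemma V_meas: "i \<in> {1..k} \<Longrightarrow> V i \<in> borel_measurable M"
proof -
  assume i: "i \<in> {1..k}"
  have "(\<lambda>\<omega>. V_stat (n i) (r i) (s i) (\<lambda>j. X i j \<omega>)) \<in> borel_measurable M"
    by (intro measurable_V_stat X_rv i ranks)
  then show ?thesis by (simp add: V_eq[abs_def])
qed

lemma Xs_meas: "i \<in> {1..k} \<Longrightarrow> Xs i \<in> borel_measurable M"
  and Vs_meas: "i \<in> {1..k} \<Longrightarrow> Vs i \<in> borel_measurable M"
proof -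
  assume i: "i \<in> {1..k}"
  have *: "(\<lambda>\<omega>. (\<lambda>i\<in>{1..k}. (Xs i \<omega>, Vs i \<omega>)) i) \<in> measurable M (borel \<Otimes>\<^sub>M borel)"
    using measurable_compose[OF copy_meas measurable_component_singleton[OF i]] .
  then have "(\<lambda>\<omega>. (Xs i \<omega>, Vs i \<omega>)) \<in> measurable M (borel \<Otimes>\<^sub>M borel)" using i by simp
  from measurable_compose[OF this measurable_fst] measurable_compose[OF this measurable_snd]
  show "Xs i \<in> borel_measurable M" "Vs i \<in> borel_measurable M" by simp_all
qed

lemma prob_copy:
  assumes A: "{z \<in> space (PiM {1..k} (\<lambda>_. borel \<Otimes>\<^sub>M borel)). P z} \<in> sets (PiM {1..k} (\<lambda>_. borel \<Otimes>\<^sub>M borel))"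
  shows "prob {\<omega> \<in> space M. P (\<lambda>i\<in>{1..k}. (Xs i \<omega>, Vs i \<omega>))} = prob {\<omega> \<in> space M. P (\<lambda>i\<in>{1..k}. (Xr i \<omega>, V i \<omega>))}"
proof -
  let ?P = "PiM {1..k} (\<lambda>_. borel \<Otimes>\<^sub>M borel) :: (nat \<Rightarrow> real \<times> real) measure"
  let ?A = "{z \<in> space ?P. P z}"
  have meas: "(\<lambda>\<omega>. \<lambda>i\<in>{1..k}. (Xr i \<omega>, V i \<omega>)) \<in> measurable M ?P"
    by (intro measurable_restrict measurable_Pair Xr_meas V_meas)
  have pull: "prob {\<omega> \<in> space M. P (g \<omega>)} = measure (distr M ?P g) ?A" if g: "g \<in> measurable M ?P" for g
    using measurable_space[OF g] by (subst measure_distr[OF g A]) (auto intro!: arg_cong[where f = prob])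
  show ?thesis unfolding pull[OF meas] pull[OF copy_meas] copy_law ..
qed

lemma err_meas:
  assumes "x \<in> borel_measurable N" "v \<in> borel_measurable N"
  shows "(\<lambda>\<omega>. err i (x \<omega>) (v \<omega>)) \<in> borel_measurable N"
    and "(\<lambda>\<omega>. scl i (v \<omega>)) \<in> borel_measurable N"
  unfolding err_def delta_stat_def scl_def using assms by measurable

lemma err_data_eq: "err i (Xr i \<omega>) (V i \<omega>) = delta_stat (n i) (r i) (s i)
    (order_stat (n i) (\<lambda>j. X i j \<omega>) (r i)) (V_stat (n i) (r i) (s i) (\<lambda>j. X i j \<omega>)) - (\<mu> i + \<sigma> i)"
  by (simp add: err_def Xr_eq V_eq)

lemma err_char:
  assumes i: "i \<in> {1..k}" and "2 \<le> m i"
  shows "cmod (char (distr M borel (\<lambda>\<omega>. err i (Xr i \<omega>) (V i \<omega>))) u) \<le> inverse (1 + (sd i)\<^sup>2 * u\<^sup>2 / 4)"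
  unfolding err_data_eq sd_square[OF i]
  by (rule delta_error_char[OF \<sigma>[OF i] ranks(1)[OF i] ranks(2)[OF i] ranks(3)[OF i] indep_vars_slice[OF X_indep i] X_dist[OF i]])
    (use assms in \<open>auto simp: m_def\<close>)

lemma err_indep:
  assumes il: "i \<in> {1..k}" "l \<in> {1..k}" "i \<noteq> l"
  shows "indep_var borel (\<lambda>\<omega>. err i (Xr i \<omega>) (V i \<omega>)) borel (\<lambda>\<omega>. err l (Xr l \<omega>) (V l \<omega>))"
proof -
  let ?A = "\<lambda>i. {i} \<times> {1..n i}"
  let ?g = "\<lambda>i x. err i (order_stat (n i) (\<lambda>j. x (i, j)) (r i)) (V_stat (n i) (r i) (s i) (\<lambda>j. x (i, j)))"
  let ?Z = "\<lambda>i \<omega>. \<lambda>p\<in>?A i. (case p of (i, j) \<Rightarrow> X i j) \<omega>"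
  have "indep_var (PiM (?A i) (\<lambda>_. borel)) (?Z i) (PiM (?A l) (\<lambda>_. borel)) (?Z l)"
    using il by (intro indep_var_restrict[OF X_indep]) auto
  moreover have "?g i \<in> borel_measurable (PiM (?A i) (\<lambda>_. borel))" if "i \<in> {1..k}" for i
    using ranks[OF that] by (intro err_meas measurable_order_stat measurable_V_stat measurable_component_singleton) auto
  ultimately have "indep_var borel (?g i \<circ> ?Z i) borel (?g l \<circ> ?Z l)"
    using il by (intro indep_var_compose) auto
  moreover have "?g i \<circ> ?Z i = (\<lambda>\<omega>. err i (Xr i \<omega>) (V i \<omega>))" for i
  proof
    fix \<omega>
    have "order_stat (n i) (\<lambda>j. ?Z i \<omega> (i, j)) (r i) = Xr i \<omega>"
      unfolding Xr_eq by (rule order_stat_cong) simp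
    moreover have "V_stat (n i) (r i) (s i) (\<lambda>j. ?Z i \<omega> (i, j)) = V i \<omega>"
      unfolding V_eq by (rule V_stat_cong) simp
    ultimately show "(?g i \<circ> ?Z i) \<omega> = err i (Xr i \<omega>) (V i \<omega>)" by (simp only: comp_def)
  qed
  ultimately show ?thesis by simp
qed

lemma err_tail:
  assumes i: "i \<in> {1..k}" and K: "0 < K"
  shows "prob {\<omega> \<in> space M. K * sd i \<le> \<bar>err i (Xr i \<omega>) (V i \<omega>)\<bar>} \<le> 1 / K\<^sup>2"
proof -
  have pos: "0 < K * sd i" using K sd_pos[OF i] by simp
  have "prob {\<omega> \<in> space M. K * sd i \<le> \<bar>err i (Xr i \<omega>) (V i \<omega>)\<bar>}
      \<le> delta_var (n i) (r i) (s i) (\<sigma> i) / (K * sd i)\<^sup>2"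
    unfolding err_data_eq
    by (rule delta_error_tail[OF \<sigma>[OF i] ranks(1)[OF i] ranks(2)[OF i] ranks(3)[OF i] indep_vars_slice[OF X_indep i] X_dist[OF i] pos])
  also have "\<dots> = 1 / K\<^sup>2"
    using sd_pos[OF i] K by (simp add: sd_square[OF i, symmetric] power_mult_distrib)
  finally show ?thesis .
qed

lemma scl_tail:
  assumes i: "i \<in> {1..k}" and e: "0 < e"
  shows "prob {\<omega> \<in> space M. e \<le> \<bar>scl i (V i \<omega>) - 1\<bar>} \<le> 1 / (m i * e\<^sup>2)"
  unfolding scl_def V_eq m_def
  by (rule V_stat_tail[OF \<sigma>[OF i] ranks(1)[OF i] ranks(2)[OF i] ranks(3)[OF i] indep_vars_slice[OF X_indep i] X_dist[OF i] e])

lemma bad_event: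
  assumes "0 < e" "0 < K" and small: "\<And>i. i \<in> {1..k} \<Longrightarrow> 1 / (m i * e\<^sup>2) + 1 / K\<^sup>2 \<le> \<epsilon> / real k"
  shows "prob {\<omega> \<in> space M. \<exists>i\<in>{1..k}. e \<le> \<bar>scl i (V i \<omega>) - 1\<bar> \<or> K * sd i \<le> \<bar>err i (Xr i \<omega>) (V i \<omega>)\<bar>} \<le> \<epsilon>"
proof -
  let ?U = "\<lambda>i. {\<omega> \<in> space M. e \<le> \<bar>scl i (V i \<omega>) - 1\<bar>} \<union> {\<omega> \<in> space M. K * sd i \<le> \<bar>err i (Xr i \<omega>) (V i \<omega>)\<bar>}"
  have U: "?U i \<in> sets M" "prob (?U i) \<le> \<epsilon> / real k" if i: "i \<in> {1..k}" for i
  proof -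
    note [measurable] = err_meas[OF Xr_meas[OF i] V_meas[OF i], of i]
    have sets: "{\<omega> \<in> space M. e \<le> \<bar>scl i (V i \<omega>) - 1\<bar>} \<in> sets M"
      "{\<omega> \<in> space M. K * sd i \<le> \<bar>err i (Xr i \<omega>) (V i \<omega>)\<bar>} \<in> sets M" by measurable
    then show "?U i \<in> sets M" by (rule sets.Un)
    have "prob (?U i) \<le> prob {\<omega> \<in> space M. e \<le> \<bar>scl i (V i \<omega>) - 1\<bar>} + prob {\<omega> \<in> space M. K * sd i \<le> \<bar>err i (Xr i \<omega>) (V i \<omega>)\<bar>}"
      using sets by (rule measure_Un_le)
    also have "\<dots> \<le> \<epsilon> / real k" using scl_tail[OF i assms(1)] err_tail[OF i assms(2)] small[OF i] by linarith
    finally show "prob (?U i) \<le> \<epsilon> / real k" .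
  qed
  have "{\<omega> \<in> space M. \<exists>i\<in>{1..k}. e \<le> \<bar>scl i (V i \<omega>) - 1\<bar> \<or> K * sd i \<le> \<bar>err i (Xr i \<omega>) (V i \<omega>)\<bar>} = (\<Union>i\<in>{1..k}. ?U i)"
    by blast
  then have "prob {\<omega> \<in> space M. \<exists>i\<in>{1..k}. e \<le> \<bar>scl i (V i \<omega>) - 1\<bar> \<or> K * sd i \<le> \<bar>err i (Xr i \<omega>) (V i \<omega>)\<bar>}
      = prob (\<Union>i\<in>{1..k}. ?U i)" by (rule arg_cong)
  moreover have "prob (\<Union>i\<in>{1..k}. ?U i) \<le> (\<Sum>i\<in>{1..k}. prob (?U i))"
    by (rule measure_UNION_le[OF finite_atLeastAtMost U(1)])
  moreover have "(\<Sum>i\<in>{1..k}. prob (?U i)) \<le> (\<Sum>i\<in>{1..k}. \<epsilon> / real k)" by (rule sum_mono[OF U(2)])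
  moreover have "(\<Sum>i\<in>{1..k}. \<epsilon> / real k) = \<epsilon>" using k by simp
  ultimately show ?thesis by linarith
qed

text \<open>The pivot rescales the error of the copy by the ratio of the two scale estimates: \<open>\<delta>\<close> is \<open>x\<close>
  plus a multiple of \<open>v\<close>, and \<open>v = (v / vs) vs\<close>.\<close>
lemma pivot_identity:
  assumes i: "i \<in> {1..k}" and "vs \<noteq> 0"
  shows "delta_stat (n i) (r i) (s i) x v - R_theta (\<mu> i) (\<sigma> i) x v xs vs = scl i v / scl i vs * err i xs vs"
proof -
  have "scl i v / scl i vs = v / vs" using m_pos[OF i] \<sigma>[OF i] by (simp add: scl_def)
  moreover have "v / vs * (vs / m i * (1 - h_coef (n i) (r i))) = v / m i * (1 - h_coef (n i) (r i))"
    using assms(2) by simp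
  ultimately show ?thesis
    by (simp add: R_theta_def err_def delta_stat_def m_def[symmetric] distrib_left right_diff_distrib mult.commute
        del: times_divide_eq_left times_divide_eq_right)
qed

text \<open>Compare with \<open>delta_var_eq\<close>: replacing \<open>\<sigma>\<close> by \<open>v / m\<close> in the variance of \<open>\<delta>\<close> and
  multiplying by \<open>m / (m + 1)\<close> gives the term of one sample.\<close>
lemma F_pair_eq:
  assumes il: "i \<in> {1..k}" "l \<in> {1..k}" "i \<noteq> l"
  shows "F_pair n r s v i l = (scl i (v i))\<^sup>2 * (sd i)\<^sup>2 * (m i / (m i + 1)) + (scl l (v l))\<^sup>2 * (sd l)\<^sup>2 * (m l / (m l + 1))"
proof -
  have summand: "(v j)\<^sup>2 / (m j * (m j + 1)) * g_coef (n j) (r j) + (v j)\<^sup>2 / ((m j)\<^sup>2 * (m j + 1)) * (1 - h_coef (n j) (r j))\<^sup>2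
      = (scl j (v j))\<^sup>2 * (sd j)\<^sup>2 * (m j / (m j + 1))" if j: "j \<in> {1..k}" for j
  proof -
    have pos: "0 < m j" "0 < m j + 1" "0 < \<sigma> j" using m_pos[OF j] \<sigma>[OF j] by auto
    have "(scl j (v j))\<^sup>2 * (sd j)\<^sup>2 = (v j / m j)\<^sup>2 * (g_coef (n j) (r j) + (1 - h_coef (n j) (r j))\<^sup>2 / m j)"
      unfolding sd_square[OF j] delta_var_eq[OF ranks(1)[OF j] ranks(2)[OF j] ranks(3)[OF j]] scl_def m_def[symmetric]
      using pos by (simp add: power_divide power_mult_distrib)
    moreover have "w\<^sup>2 / (x * (x + 1)) * g + w\<^sup>2 / (x\<^sup>2 * (x + 1)) * h = (w / x)\<^sup>2 * (g + h / x) * (x / (x + 1))"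
      if "0 < x" for w x g h :: real
    proof -
      have "x \<noteq> 0" "x + 1 \<noteq> 0" using that by auto
      then show ?thesis by (simp add: divide_simps power2_eq_square) (simp add: algebra_simps)
    qed
    ultimately show ?thesis using pos(1) by (simp only:)
  qed
  show ?thesis
    using il(3) summand[OF il(1)] summand[OF il(2)] unfolding F_pair_def by (simp add: m_def)
qed

lemma coverage:
  assumes \<alpha>: "0 < \<alpha>" "\<alpha> < 1" and \<epsilon>: "0 < \<epsilon>" "2 * \<epsilon> \<le> \<alpha>" "2 * \<epsilon> \<le> 1 - \<alpha>"
    and e: "0 < e" "e \<le> 1 / 4" and K: "0 < K" and eK: "64 * (real k)\<^sup>2 * K * e \<le> \<epsilon>"
    and m: "\<And>i. i \<in> {1..k} \<Longrightarrow> 2 \<le> m i" "\<And>i. i \<in> {1..k} \<Longrightarrow> 1 / e \<le> m i"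
    and small: "\<And>i. i \<in> {1..k} \<Longrightarrow> 1 / (m i * e\<^sup>2) + 1 / K\<^sup>2 \<le> \<epsilon> / real k"
  defines "\<delta> \<equiv> \<lambda>i \<omega>. delta_stat (n i) (r i) (s i) (Xr i \<omega>) (V i \<omega>)"
    and "F \<equiv> \<lambda>i l \<omega>. F_pair n r s (\<lambda>j. V j \<omega>) i l"
    and "f \<equiv> \<lambda>\<omega>. dist_quantile (fiducial_law M k n r s \<mu> \<sigma> Xs Vs (\<lambda>i. Xr i \<omega>) (\<lambda>i. V i \<omega>)) (1 - \<alpha>)"
  shows "\<bar>prob {\<omega> \<in> space M. \<forall>i\<in>{1..k}. \<forall>l\<in>{1..k}. i \<noteq> l \<longrightarrow>
            (\<mu> i + \<sigma> i) - (\<mu> l + \<sigma> l) \<in> {\<delta> i \<omega> - \<delta> l \<omega> - f \<omega> * sqrt (F i l \<omega>) ..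
                          \<delta> i \<omega> - \<delta> l \<omega> + f \<omega> * sqrt (F i l \<omega>)}} - (1 - \<alpha>)\<bar> \<le> 4 * \<epsilon>"
proof -
  let ?I = "{1..k}" and ?P = "PiM {1..k} (\<lambda>_. borel \<Otimes>\<^sub>M borel) :: (nat \<Rightarrow> real \<times> real) measure"
  define D where "D i \<omega> = err i (Xr i \<omega>) (V i \<omega>)" for i \<omega>
  define B where "B i \<omega> = scl i (V i \<omega>)" for i \<omega>
  define Ds where "Ds i \<omega> = err i (Xs i \<omega>) (Vs i \<omega>)" for i \<omega>
  define Bs where "Bs i \<omega> = scl i (Vs i \<omega>)" for i \<omega>
  define E where "E i \<omega> \<omega>' = \<delta> i \<omega> - R_theta (\<mu> i) (\<sigma> i) (Xr i \<omega>) (V i \<omega>) (Xs i \<omega>') (Vs i \<omega>')" for i \<omega> \<omega>'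
  define \<kappa> where "\<kappa> i = m i / (m i + 1)" for i
  have comp: "(\<lambda>z. fst (z i)) \<in> borel_measurable ?P" "(\<lambda>z. snd (z i)) \<in> borel_measurable ?P" if "i \<in> ?I" for i
    using that by measurable
  interpret fiducial_contrasts M ?I D B Ds Bs E sd \<kappa>
  proof unfold_locales
    show "finite ?I" "2 \<le> card ?I" using k by simp_all
    fix i assume i: "i \<in> ?I"
    show "0 < sd i" using sd_pos[OF i] .
    show "D i \<in> borel_measurable M" "B i \<in> borel_measurable M"
      unfolding D_def[abs_def] B_def[abs_def] by (rule err_meas[OF Xr_meas[OF i] V_meas[OF i]])+
    show "Ds i \<in> borel_measurable M" "Bs i \<in> borel_measurable M"
      unfolding Ds_def[abs_def] Bs_def[abs_def] by (rule err_meas[OF Xs_meas[OF i] Vs_meas[OF i]])+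
    note [measurable] = Xr_meas[OF i] V_meas[OF i] Xs_meas[OF i] Vs_meas[OF i]
    show "case_prod (E i) \<in> borel_measurable (M \<Otimes>\<^sub>M M)"
      unfolding E_def \<delta>_def R_theta_def delta_stat_def by measurable
  next
    fix i \<omega> \<omega>' assume i: "i \<in> ?I" and "Bs i \<omega>' \<noteq> 0"
    then have "Vs i \<omega>' \<noteq> 0" by (auto simp: Bs_def scl_def)
    then show "E i \<omega> \<omega>' = B i \<omega> / Bs i \<omega>' * Ds i \<omega>'"
      unfolding E_def \<delta>_def B_def Bs_def Ds_def by (rule pivot_identity[OF i])
  next
    fix i l and a b :: real assume il: "i \<in> ?I" "l \<in> ?I" "i \<noteq> l" and ab: "a \<le> b"
    show "prob {\<omega> \<in> space M. D i \<omega> - D l \<omega> \<in> {a..b}} \<le> (b - a) / sqrt ((sd i)\<^sup>2 + (sd l)\<^sup>2)"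
      unfolding D_def
      using sd_pos[OF il(1)] sd_pos[OF il(2)]
      by (intro indep_difference_concentration err_indep il ab err_char m(1)) auto
  next
    fix y
    let ?S = "\<lambda>z. \<forall>i\<in>?I. \<forall>l\<in>?I. i \<noteq> l \<longrightarrow>
      \<bar>err i (fst (z i)) (snd (z i)) - err l (fst (z l)) (snd (z l))\<bar> \<le> y * sqrt ((sd i)\<^sup>2 + (sd l)\<^sup>2)"
    have "{z \<in> space ?P. ?S z} \<in> sets ?P"
    proof (intro sets.sets_Collect_finite_All finite_atLeastAtMost)
      fix i l assume "i \<in> ?I" "l \<in> ?I"
      note [measurable] = err_meas(1)[OF comp[OF this(1)], of i] err_meas(1)[OF comp[OF this(2)], of l]
      show "{z \<in> space ?P. i \<noteq> l \<longrightarrow>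
        \<bar>err i (fst (z i)) (snd (z i)) - err l (fst (z l)) (snd (z l))\<bar> \<le> y * sqrt ((sd i)\<^sup>2 + (sd l)\<^sup>2)} \<in> sets ?P"
        by measurable
    qed
    then have "prob {\<omega> \<in> space M. ?S (\<lambda>i\<in>?I. (Xs i \<omega>, Vs i \<omega>))} = prob {\<omega> \<in> space M. ?S (\<lambda>i\<in>?I. (Xr i \<omega>, V i \<omega>))}"
      by (rule prob_copy)
    moreover have "?S (\<lambda>i\<in>?I. (Xs i \<omega>, Vs i \<omega>)) \<longleftrightarrow> (\<forall>i\<in>?I. \<forall>l\<in>?I. i \<noteq> l \<longrightarrow> \<bar>Ds i \<omega> - Ds l \<omega>\<bar> \<le> y * sqrt ((sd i)\<^sup>2 + (sd l)\<^sup>2))" for \<omega>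
      by (intro ball_cong refl) (simp only: restrict_apply' fst_conv snd_conv Ds_def)
    moreover have "?S (\<lambda>i\<in>?I. (Xr i \<omega>, V i \<omega>)) \<longleftrightarrow> (\<forall>i\<in>?I. \<forall>l\<in>?I. i \<noteq> l \<longrightarrow> \<bar>D i \<omega> - D l \<omega>\<bar> \<le> y * sqrt ((sd i)\<^sup>2 + (sd l)\<^sup>2))" for \<omega>
      by (intro ball_cong refl) (simp only: restrict_apply' fst_conv snd_conv D_def)
    ultimately show "prob {\<omega> \<in> space M. \<forall>i\<in>?I. \<forall>l\<in>?I. i \<noteq> l \<longrightarrow> \<bar>Ds i \<omega> - Ds l \<omega>\<bar> \<le> y * sqrt ((sd i)\<^sup>2 + (sd l)\<^sup>2)}
      = prob {\<omega> \<in> space M. \<forall>i\<in>?I. \<forall>l\<in>?I. i \<noteq> l \<longrightarrow> \<bar>D i \<omega> - D l \<omega>\<bar> \<le> y * sqrt ((sd i)\<^sup>2 + (sd l)\<^sup>2)}"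
      by (simp only:)
  qed
  have bad: "prob {\<omega> \<in> space M. \<exists>i\<in>?I. e \<le> \<bar>B i \<omega> - 1\<bar> \<or> K * sd i \<le> \<bar>D i \<omega>\<bar>} \<le> \<epsilon>"
    unfolding B_def D_def by (rule bad_event[OF e(1) K small])
  have bads: "prob {\<omega> \<in> space M. \<exists>i\<in>?I. e \<le> \<bar>Bs i \<omega> - 1\<bar> \<or> K * sd i \<le> \<bar>Ds i \<omega>\<bar>} \<le> \<epsilon>"
  proof -
    let ?S = "\<lambda>z. \<exists>i\<in>?I. e \<le> \<bar>scl i (snd (z i)) - 1\<bar> \<or> K * sd i \<le> \<bar>err i (fst (z i)) (snd (z i))\<bar>"
    have "{z \<in> space ?P. ?S z} \<in> sets ?P"
    proof (intro sets.sets_Collect_finite_Ex finite_atLeastAtMost)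
      fix i assume "i \<in> ?I"
      note [measurable] = err_meas[OF comp[OF this], of i]
      show "{z \<in> space ?P. e \<le> \<bar>scl i (snd (z i)) - 1\<bar> \<or> K * sd i \<le> \<bar>err i (fst (z i)) (snd (z i))\<bar>} \<in> sets ?P"
        by measurable
    qed
    then have "prob {\<omega> \<in> space M. ?S (\<lambda>i\<in>?I. (Xs i \<omega>, Vs i \<omega>))} = prob {\<omega> \<in> space M. ?S (\<lambda>i\<in>?I. (Xr i \<omega>, V i \<omega>))}"
      by (rule prob_copy)
    moreover have "?S (\<lambda>i\<in>?I. (Xs i \<omega>, Vs i \<omega>)) \<longleftrightarrow> (\<exists>i\<in>?I. e \<le> \<bar>Bs i \<omega> - 1\<bar> \<or> K * sd i \<le> \<bar>Ds i \<omega>\<bar>)" for \<omega>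
      by (intro bex_cong refl) (simp only: restrict_apply' fst_conv snd_conv Bs_def Ds_def)
    moreover have "?S (\<lambda>i\<in>?I. (Xr i \<omega>, V i \<omega>)) \<longleftrightarrow> (\<exists>i\<in>?I. e \<le> \<bar>B i \<omega> - 1\<bar> \<or> K * sd i \<le> \<bar>D i \<omega>\<bar>)" for \<omega>
      by (intro bex_cong refl) (simp only: restrict_apply' fst_conv snd_conv B_def D_def)
    ultimately show ?thesis using bad by (simp only:)
  qed
  have \<kappa>: "1 - e \<le> \<kappa> i" "\<kappa> i \<le> 1" if i: "i \<in> ?I" for i
  proof -
    have pos: "0 < m i" using m_pos[OF i] .
    have "1 \<le> e * m i" using m(2)[OF i] e by (simp add: divide_le_eq mult.commute)
    then show "1 - e \<le> \<kappa> i" using pos e by (simp add: \<kappa>_def le_divide_eq algebra_simps)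
    show "\<kappa> i \<le> 1" using pos by (simp add: \<kappa>_def)
  qed
  have est_sd_F: "sqrt (F i l \<omega>) = est_sd i l \<omega>" if "i \<in> ?I" "l \<in> ?I" "i \<noteq> l" for i l \<omega>
    unfolding F_def F_pair_eq[OF that] est_sd_def B_def \<kappa>_def ..
  have fid_max_F: "F_max k n r s \<mu> \<sigma> (\<lambda>i. Xr i \<omega>) (\<lambda>i. V i \<omega>) (\<lambda>i. Xs i \<omega>') (\<lambda>i. Vs i \<omega>') = fid_max \<omega> \<omega>'" for \<omega> \<omega>'
  proof -
    have contrast: "((\<delta> i \<omega> - \<delta> l \<omega>) - (R_theta (\<mu> i) (\<sigma> i) (Xr i \<omega>) (V i \<omega>) (Xs i \<omega>') (Vs i \<omega>')
        - R_theta (\<mu> l) (\<sigma> l) (Xr l \<omega>) (V l \<omega>) (Xs l \<omega>') (Vs l \<omega>'))) / sqrt (F i l \<omega>)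
        = (E i \<omega> \<omega>' - E l \<omega> \<omega>') / est_sd i l \<omega>" if "i \<in> ?I" "l \<in> ?I" "i \<noteq> l" for i l
      unfolding est_sd_F[OF that] E_def by (simp add: algebra_simps)
    show ?thesis
      unfolding F_max_def fid_max_def Let_def
      by (intro arg_cong[where f = Max] Collect_cong iff_exI rev_conj_cong refl)
        (simp only: contrast[unfolded \<delta>_def F_def] not_False_eq_True)
  qed
  have f_crit: "f \<omega> = crit_value \<alpha> \<omega>" if \<omega>: "\<omega> \<in> space M" for \<omega>
  proof -
    have "cdf (fiducial_law M k n r s \<mu> \<sigma> Xs Vs (\<lambda>i. Xr i \<omega>) (\<lambda>i. V i \<omega>)) y = prob {\<omega>' \<in> space M. fid_max \<omega> \<omega>' \<le> y}" for y
      unfolding cdf_def fiducial_law_def fid_max_F using fid_max_rv[OF \<omega>]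
      by (subst measure_distr) (auto intro!: arg_cong[where f = prob])
    then show ?thesis unfolding f_def dist_quantile_def crit_value_def by (simp only:)
  qed
  have "{\<omega> \<in> space M. \<forall>i\<in>?I. \<forall>l\<in>?I. i \<noteq> l \<longrightarrow>
            (\<mu> i + \<sigma> i) - (\<mu> l + \<sigma> l) \<in> {\<delta> i \<omega> - \<delta> l \<omega> - f \<omega> * sqrt (F i l \<omega>) ..
                          \<delta> i \<omega> - \<delta> l \<omega> + f \<omega> * sqrt (F i l \<omega>)}}
      = {\<omega> \<in> space M. \<forall>i\<in>?I. \<forall>l\<in>?I. i \<noteq> l \<longrightarrow> \<bar>D i \<omega> - D l \<omega>\<bar> \<le> crit_value \<alpha> \<omega> * est_sd i l \<omega>}"
  proof (intro Collect_cong conj_cong refl ball_cong imp_cong)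
    fix \<omega> i l assume *: "\<omega> \<in> space M" "i \<in> ?I" "l \<in> ?I" "i \<noteq> l"
    have "D i \<omega> - D l \<omega> = (\<delta> i \<omega> - \<delta> l \<omega>) - ((\<mu> i + \<sigma> i) - (\<mu> l + \<sigma> l))"
      by (simp add: D_def err_def \<delta>_def)
    then show "(\<mu> i + \<sigma> i) - (\<mu> l + \<sigma> l) \<in> {\<delta> i \<omega> - \<delta> l \<omega> - f \<omega> * sqrt (F i l \<omega>) ..
                          \<delta> i \<omega> - \<delta> l \<omega> + f \<omega> * sqrt (F i l \<omega>)}
        \<longleftrightarrow> \<bar>D i \<omega> - D l \<omega>\<bar> \<le> crit_value \<alpha> \<omega> * est_sd i l \<omega>"
      unfolding f_crit[OF *(1)] est_sd_F[OF *(2-4)] abs_le_iff atLeastAtMost_iff by auto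
  qed
  moreover have "64 * (real (card ?I))\<^sup>2 * K * e \<le> \<epsilon>" using eK by simp
  from coverage_bound[OF \<alpha> \<epsilon> e K this \<kappa> bad bads]
  have "\<bar>prob {\<omega> \<in> space M. \<forall>i\<in>?I. \<forall>l\<in>?I. i \<noteq> l \<longrightarrow> \<bar>D i \<omega> - D l \<omega>\<bar> \<le> crit_value \<alpha> \<omega> * est_sd i l \<omega>}
    - (1 - \<alpha>)\<bar> \<le> 4 * \<epsilon>" by simp
  ultimately show ?thesis by (simp only:)
qed

end

section \<open>The coverage probability\<close>

theorem theorem3:
  fixes M :: "'a measure" and k :: nat and \<alpha> :: real
    and \<mu> \<sigma> \<theta> p q c :: "nat \<Rightarrow> real"
    and n r s :: "nat \<Rightarrow> nat \<Rightarrow> nat"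
    and X :: "nat \<Rightarrow> nat \<Rightarrow> nat \<Rightarrow> 'a \<Rightarrow> real"
    and Xr V Xs Vs \<delta> :: "nat \<Rightarrow> nat \<Rightarrow> 'a \<Rightarrow> real"
    and F :: "nat \<Rightarrow> nat \<Rightarrow> nat \<Rightarrow> 'a \<Rightarrow> real"
    and f :: "nat \<Rightarrow> 'a \<Rightarrow> real"
  assumes M: "prob_space M"
    and k: "2 \<le> k"
    and \<alpha>: "0 < \<alpha>" "\<alpha> < 1"
    and \<sigma>: "\<And>i. i \<in> {1..k} \<Longrightarrow> 0 < \<sigma> i"
    and \<theta>_eq: "\<And>i. \<theta> i = \<mu> i + \<sigma> i"
    and p: "\<And>i. i \<in> {1..k} \<Longrightarrow> 0 \<le> p i"
    and q: "\<And>i. i \<in> {1..k} \<Longrightarrow> 0 \<le> q i"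
    and pq: "\<And>i. i \<in> {1..k} \<Longrightarrow> p i + q i < 1"
    and r: "\<And>t i. i \<in> {1..k} \<Longrightarrow> real (r t i) - 1 = real (n t i) * p i"
    and s: "\<And>t i. i \<in> {1..k} \<Longrightarrow> real (n t i) - real (s t i) = real (n t i) * q i"
    and rs: "\<And>t i. i \<in> {1..k} \<Longrightarrow> r t i < s t i"
    and n_total: "filterlim (\<lambda>t. \<Sum>i = 1..k. n t i) at_top sequentially"
    and c: "\<And>i. i \<in> {1..k} \<Longrightarrow> 0 < c i" "\<And>i. i \<in> {1..k} \<Longrightarrow> c i < 1"
    and n_ratio: "\<And>i. i \<in> {1..k} \<Longrightarrow>
          (\<lambda>t. real (n t i) / real (\<Sum>l = 1..k. n t l)) \<longlonglongrightarrow> c i"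
    and X_dist: "\<And>t i j. i \<in> {1..k} \<Longrightarrow> j \<in> {1..n t i} \<Longrightarrow>
          distributed M lborel (X t i j) (\<lambda>x. ennreal (two_param_exp_density (\<mu> i) (\<sigma> i) x))"
    and X_indep: "\<And>t. prob_space.indep_vars M (\<lambda>_. borel) (\<lambda>(i, j). X t i j)
          (SIGMA i:{1..k}. {1..n t i})"
    and Xr_eq: "\<And>t i \<omega>. Xr t i \<omega> = order_stat (n t i) (\<lambda>j. X t i j \<omega>) (r t i)"
    and V_eq: "\<And>t i \<omega>. V t i \<omega> = V_stat (n t i) (r t i) (s t i) (\<lambda>j. X t i j \<omega>)"
    and copy_law: "\<And>t.
          distr M (PiM {1..k} (\<lambda>_. borel \<Otimes>\<^sub>M borel)) (\<lambda>\<omega>. \<lambda>i\<in>{1..k}. (Xs t i \<omega>, Vs t i \<omega>)) =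
          distr M (PiM {1..k} (\<lambda>_. borel \<Otimes>\<^sub>M borel)) (\<lambda>\<omega>. \<lambda>i\<in>{1..k}. (Xr t i \<omega>, V t i \<omega>))"
    and copy_indep: "\<And>t. prob_space.indep_var M
          (PiM {1..k} (\<lambda>_. borel \<Otimes>\<^sub>M borel)) (\<lambda>\<omega>. \<lambda>i\<in>{1..k}. (Xs t i \<omega>, Vs t i \<omega>))
          (PiM {1..k} (\<lambda>_. borel \<Otimes>\<^sub>M borel)) (\<lambda>\<omega>. \<lambda>i\<in>{1..k}. (Xr t i \<omega>, V t i \<omega>))"
    and \<delta>_eq: "\<And>t i \<omega>. \<delta> t i \<omega> = delta_stat (n t i) (r t i) (s t i) (Xr t i \<omega>) (V t i \<omega>)"
    and F_eq: "\<And>t i l \<omega>. F t i l \<omega> = F_pair (n t) (r t) (s t) (\<lambda>m. V t m \<omega>) i l"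
    and f_eq: "\<And>t \<omega>. f t \<omega> =
          dist_quantile
            (fiducial_law M k (n t) (r t) (s t) \<mu> \<sigma> (Xs t) (Vs t) (\<lambda>i. Xr t i \<omega>) (\<lambda>i. V t i \<omega>))
            (1 - \<alpha>)"
  shows "(\<lambda>t. measure M {\<omega> \<in> space M. \<forall>i\<in>{1..k}. \<forall>l\<in>{1..k}. i \<noteq> l \<longrightarrow>
            \<theta> i - \<theta> l \<in> {\<delta> t i \<omega> - \<delta> t l \<omega> - f t \<omega> * sqrt (F t i l \<omega>) ..
                          \<delta> t i \<omega> - \<delta> t l \<omega> + f t \<omega> * sqrt (F t i l \<omega>)}})
         \<longlonglongrightarrow> 1 - \<alpha>"
proof -
  interpret prob_space M by (rule M)
  define P where "P t = prob {\<omega> \<in> space M. \<forall>i\<in>{1..k}. \<forall>l\<in>{1..k}. i \<noteq> l \<longrightarrow>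
            \<theta> i - \<theta> l \<in> {\<delta> t i \<omega> - \<delta> t l \<omega> - f t \<omega> * sqrt (F t i l \<omega>) ..
                          \<delta> t i \<omega> - \<delta> t l \<omega> + f t \<omega> * sqrt (F t i l \<omega>)}}" for t
  have samples: "censored_samples M k (n t) (r t) (s t) \<mu> \<sigma> (X t) (Xs t) (Vs t) (Xr t) (V t)" for t
  proof unfold_locales
    fix i assume i: "i \<in> {1..k}"
    have "0 \<le> real (n t i) * p i" using p[OF i] by simp
    then show "1 \<le> r t i" using r[OF i, of t] by linarith
    have "0 \<le> real (n t i) * q i" using q[OF i] by simp
    then show "s t i \<le> n t i" using s[OF i, of t] by linarith
  qed (use k \<sigma> rs X_dist X_indep Xr_eq V_eq copy_law indep_var_rv1[OF copy_indep] in auto)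
  have gap: "real (s t i) - real (r t i) = (1 - p i - q i) * real (n t i) - 1" if i: "i \<in> {1..k}" for t i
    using r[OF i, of t] s[OF i, of t] by (simp add: algebra_simps)
  have n_large: "filterlim (\<lambda>t. real (n t i)) at_top sequentially" if i: "i \<in> {1..k}" for i
  proof -
    have "filterlim (\<lambda>t. real (\<Sum>l = 1..k. n t l)) at_top sequentially"
      using n_total by (rule filterlim_compose[OF filterlim_real_sequentially])
    then have "filterlim (\<lambda>t. real (n t i) / real (\<Sum>l = 1..k. n t l) * real (\<Sum>l = 1..k. n t l)) at_top sequentially"
      by (rule filterlim_tendsto_pos_mult_at_top[OF n_ratio[OF i] c(1)[OF i]])
    moreover have "real (n t i) / real (\<Sum>l = 1..k. n t l) * real (\<Sum>l = 1..k. n t l) = real (n t i)" for t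
    proof -
      interpret censored_samples M k "n t" "r t" "s t" \<mu> \<sigma> "X t" "Xs t" "Vs t" "Xr t" "V t" by (rule samples)
      have "n t i \<noteq> 0" using ranks[OF i] by auto
      then have "(\<Sum>l = 1..k. n t l) \<noteq> 0" using i by (auto simp: sum_eq_0_iff)
      then show ?thesis by (simp del: of_nat_sum)
    qed
    ultimately show ?thesis by (simp only:)
  qed
  have gap_large: "filterlim (\<lambda>t. real (s t i) - real (r t i)) at_top sequentially" if i: "i \<in> {1..k}" for i
  proof -
    have "filterlim (\<lambda>t. (1 - p i - q i) * real (n t i)) at_top sequentially"
      using pq[OF i] by (intro filterlim_tendsto_pos_mult_at_top[OF tendsto_const _ n_large[OF i]]) auto
    then have "filterlim (\<lambda>t. - 1 + (1 - p i - q i) * real (n t i)) at_top sequentially"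
      by (rule filterlim_tendsto_add_at_top[OF tendsto_const])
    then show ?thesis by (simp add: gap[OF i])
  qed
  have "P \<longlonglongrightarrow> 1 - \<alpha>"
  proof (rule LIMSEQ_I)
    fix \<eta> :: real assume \<eta>: "0 < \<eta>"
    define \<epsilon> where "\<epsilon> = min (\<eta> / 5) (min (\<alpha> / 2) ((1 - \<alpha>) / 2))"
    have "0 < \<epsilon>" using \<eta> \<alpha> by (simp add: \<epsilon>_def)
    moreover have "\<epsilon> \<le> \<eta> / 5" "\<epsilon> \<le> \<alpha> / 2" "\<epsilon> \<le> (1 - \<alpha>) / 2"
      by (simp_all only: \<epsilon>_def min_le_iff_disj order_refl simp_thms)
    ultimately have \<epsilon>: "0 < \<epsilon>" "2 * \<epsilon> \<le> \<alpha>" "2 * \<epsilon> \<le> 1 - \<alpha>" "4 * \<epsilon> < \<eta>"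
      using \<eta> by (auto simp: field_simps)
    have kpos: "0 < real k" using k by simp
    \<comment> \<open>Chebyshev bounds the tails of the \<open>k\<close> errors by \<open>1 / K\<^sup>2\<close> each, \<open>\<epsilon> / 2\<close> in total\<close>
    define K where "K = sqrt (2 * real k / \<epsilon>)"
    have K: "0 < K" "1 / K\<^sup>2 = \<epsilon> / real k / 2" using \<epsilon> kpos by (auto simp: K_def)
    define e where "e = min (1 / 4) (\<epsilon> / (64 * (real k)\<^sup>2 * K))"
    have Kk: "0 < 64 * (real k)\<^sup>2 * K" using K kpos by simp
    have e: "0 < e" "e \<le> 1 / 4" using \<epsilon> Kk by (auto simp: e_def)
    have "e \<le> \<epsilon> / (64 * (real k)\<^sup>2 * K)" by (simp add: e_def)
    then have eK: "64 * (real k)\<^sup>2 * K * e \<le> \<epsilon>" using Kk by (simp add: le_divide_eq mult.commute)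
    \<comment> \<open>2 for the domination of weights, \<open>1 / e\<close> for \<open>m / (m + 1) \<ge> 1 - e\<close>, and the last
      entry for the tails of the scale ratios, \<open>\<epsilon> / 2\<close> in total\<close>
    define N where "N = max 2 (max (1 / e) (2 * real k / (\<epsilon> * e\<^sup>2)))"
    have "\<forall>\<^sub>F t in sequentially. \<forall>i\<in>{1..k}. N \<le> real (s t i) - real (r t i)"
      using gap_large by (intro eventually_ball_finite ballI) (auto simp: filterlim_at_top)
    then obtain t0 where t0: "\<And>t i. t0 \<le> t \<Longrightarrow> i \<in> {1..k} \<Longrightarrow> N \<le> real (s t i) - real (r t i)"
      unfolding eventually_sequentially by blast
    have "norm (P t - (1 - \<alpha>)) < \<eta>" if t: "t0 \<le> t" for t
    proof -
      interpret censored_samples M k "n t" "r t" "s t" \<mu> \<sigma> "X t" "Xs t" "Vs t" "Xr t" "V t" by (rule samples)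
      have mN: "2 \<le> m i" "1 / e \<le> m i" "2 * real k / (\<epsilon> * e\<^sup>2) \<le> m i" if "i \<in> {1..k}" for i
        using t0[OF t that] by (auto simp: N_def m_def)
      have small: "1 / (m i * e\<^sup>2) + 1 / K\<^sup>2 \<le> \<epsilon> / real k" if i: "i \<in> {1..k}" for i
      proof -
        have "2 * real k \<le> m i * (\<epsilon> * e\<^sup>2)" using mN(3)[OF i] \<epsilon>(1) e(1) by (simp add: divide_le_eq)
        then have "1 / (m i * e\<^sup>2) \<le> \<epsilon> / real k / 2"
          using m_pos[OF i] e(1) kpos by (simp add: divide_simps mult_ac)
        then show ?thesis unfolding K(2) by simp
      qed
      have "\<bar>P t - (1 - \<alpha>)\<bar> \<le> 4 * \<epsilon>"
        using coverage[OF \<alpha> \<epsilon>(1-3) e K(1) eK mN(1,2) small] unfolding P_def \<theta>_eq \<delta>_eq F_eq f_eq .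
      then show ?thesis using \<epsilon>(4) by simp
    qed
    then show "\<exists>t0. \<forall>t\<ge>t0. norm (P t - (1 - \<alpha>)) < \<eta>" by blast
  qed
  then show ?thesis by (simp only: P_def[abs_def])
qed

end
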